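(* For every integer $n\geq 3$, the Vietoris--Rips complex $\mathrm{VR}(\mathbb{Z}^n;2)$ is homotopy equivalent to a wedge sum of countably infinitely many copies of the $3$-sphere $\mathbb{S}^3$.
   Context: $\mathbb{Z}^n$ is equipped with the Manhattan metric $d(x,y)=\sum_{i=1}^n |x_i-y_i|$. For a metric space $X$ and $r\geq 0$, $\mathrm{VR}(X;r)$ is the simplicial complex with vertex set $X$ whose simplices are the finite subsets of $X$ of diameter at most $r$. *)

theory Defs
  imports "HOL-Analysis.Analysis"
begin

definition manhattan :: "int ^ 'n::finite \<Rightarrow> int ^ 'n \<Rightarrow> real" where
  "manhattan x y = (\<Sum>i\<in>UNIV. real_of_int \<bar>x $ i - y $ i\<bar>)"

definition VR_complex :: "('a \<Rightarrow> 'a \<Rightarrow> real) \<Rightarrow> 'a set \<Rightarrow> real \<Rightarrow> 'a set set" where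
  "VR_complex d X r = {\<sigma>. finite \<sigma> \<and> \<sigma> \<noteq> {} \<and> \<sigma> \<subseteq> X \<and> (\<forall>x\<in>\<sigma>. \<forall>y\<in>\<sigma>. d x y \<le> r)}"

definition geom_simplex :: "'a set \<Rightarrow> ('a \<Rightarrow> real) set" where
  "geom_simplex \<sigma> = {f. (\<forall>v. 0 \<le> f v) \<and> (\<forall>v. v \<notin> \<sigma> \<longrightarrow> f v = 0) \<and> sum f \<sigma> = 1}"

text \<open>The geometric realization |K|: union of the closed simplices, with the coherent topology:
  a set is open iff its intersection with every closed simplex is open in that simplex
  (each closed simplex carrying its Euclidean topology, here the subspace topology of the product
  topology, which coincides with the Euclidean one on a finite simplex).\<close>

definition geom_realization :: "'a set set \<Rightarrow> ('a \<Rightarrow> real) topology" where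
  "geom_realization K = topology (\<lambda>U. U \<subseteq> (\<Union>\<sigma>\<in>K. geom_simplex \<sigma>) \<and>
      (\<forall>\<sigma>\<in>K. openin (subtopology (powertop_real UNIV) (geom_simplex \<sigma>)) (U \<inter> geom_simplex \<sigma>)))"

definition sphere_base :: "nat \<Rightarrow> real" where
  "sphere_base = (\<lambda>i. if i = 0 then 1 else 0)"

definition wedge_incl :: "nat \<Rightarrow> (nat \<Rightarrow> real) \<Rightarrow> nat \<times> (nat \<Rightarrow> real)" where
  "wedge_incl i x = (if x = sphere_base then (0, sphere_base) else (i, x))"

definition wedge_S3_nat :: "(nat \<times> (nat \<Rightarrow> real)) topology" where
  "wedge_S3_nat = topology (\<lambda>U. U \<subseteq> (\<Union>i. wedge_incl i ` topspace (nsphere 3)) \<and>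
      (\<forall>i. openin (nsphere 3) {x \<in> topspace (nsphere 3). wedge_incl i x \<in> U}))"

end

(* Order the lattice by a height function for which every simplex has a unique highest vertex.
   The simplices inside closed unit balls, the unit squares, and one of the two inscribed
   tetrahedra of each 3-cube whose directions include the dominant nonzero coordinate of its outer
   corner generate a subcomplex T. Attaching the facets of T in order of height glues each of them
   along a cone, so T is a union of stages each of which collapses onto the previous one, and
   concatenating these infinitely many retractions contracts T. A median argument shows that every
   simplex with at most three or at least five vertices lies in a unit ball. Hence the simplices
   outside T are tetrahedra with boundary in T; there are infinitely many of them, and collapsing
   the contractible subcomplex T turns each of them into a 3-sphere. *)
theory Submission
  imports Defs
begin

subsection \<open>Final topologies\<close>

text \<open>Two demands shape the height. Sublevel sets must be finite, so that every stage is a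
  finite complex; and for two perpendicular unit steps the heavier coordinate alone must decide
  whether their sum climbs. Steps of \<open>zeta\<close> have size 2 or 3 and distinct weights
  differ by a factor of at least 2, so the heavy step counts at least 4 against 3. Unit balls alone
  do not glue along cones. Balls with top \<open>v\<close> centred at descending neighbours
  \<open>v + a\<close>, \<open>v + b\<close> share only \<open>v\<close> and
  \<open>v + (a + b)\<close> below their top; adding the apex \<open>v + a\<close> gives three
  corners of a square, hence the squares. A ball centred at an ascending neighbour
  \<open>v + u\<close> has apex \<open>v + (lead v + u)\<close>, and its overlap with the ball at
  \<open>v + b\<close> then calls for the triangle on \<open>v\<close>,
  \<open>v + (lead v + u)\<close>, \<open>v + (b + u)\<close>; the chosen tetrahedra supply it. Each
  of them misses the outer corner \<open>v + u\<close> of its cube. The tetrahedra through an outer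
  corner stay outside, which yields infinitely many spheres. Retractions are written in coordinates
  on finite stages, where product and coherent topology agree.\<close>

definition final_topology ::
    "'i set \<Rightarrow> ('i \<Rightarrow> 'b topology) \<Rightarrow> ('i \<Rightarrow> 'b \<Rightarrow> 'a) \<Rightarrow> 'a topology \<Rightarrow> bool" where
  "final_topology I Y j X \<longleftrightarrow> topspace X = (\<Union>i\<in>I. j i ` topspace (Y i)) \<and>
     (\<forall>U. U \<subseteq> topspace X \<longrightarrow>
        (openin X U \<longleftrightarrow> (\<forall>i\<in>I. openin (Y i) {y \<in> topspace (Y i). j i y \<in> U})))"

text \<open>Both colimit topologies of the statement, the realization and the wedge, are final
  topologies. Seeing them as quotients of a disjoint sum gives access to the theory of quotient
  maps.\<close>

lemma final_topology_quotient_map: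
  assumes "final_topology I Y j X"
  shows "quotient_map (sum_topology Y I) X (\<lambda>(i, y). j i y)"
  unfolding quotient_map_def
proof (intro conjI allI impI)
  show "(\<lambda>(i, y). j i y) ` topspace (sum_topology Y I) = topspace X"
    using assms by (force simp: final_topology_def)
  fix U assume U: "U \<subseteq> topspace X"
  have "{x. (i, x) \<in> {x \<in> topspace (sum_topology Y I). (case x of (i, y) \<Rightarrow> j i y) \<in> U}} =
        {y \<in> topspace (Y i). j i y \<in> U}" if "i \<in> I" for i
    using that by auto
  then show "openin (sum_topology Y I) {x \<in> topspace (sum_topology Y I). (case x of (i, y) \<Rightarrow> j i y) \<in> U}
           = openin X U"
    using assms U by (auto simp: final_topology_def openin_sum_topology)
qed

lemma final_topology_continuous_map:
  assumes "final_topology I Y j X"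
  shows "continuous_map X Z f \<longleftrightarrow> (\<forall>i\<in>I. continuous_map (Y i) Z (\<lambda>y. f (j i y)))"
proof -
  have "continuous_map X Z f \<longleftrightarrow> continuous_map (sum_topology Y I) Z (f \<circ> (\<lambda>(i, y). j i y))"
    using continuous_compose_quotient_map_eq[OF final_topology_quotient_map[OF assms]] by metis
  also have "\<dots> \<longleftrightarrow> (\<forall>i\<in>I. continuous_map (Y i) Z (\<lambda>y. f (j i y)))"
    by (auto simp: continuous_map_def openin_sum_topology Pi_iff)
  finally show ?thesis .
qed

lemma final_topology_continuous_map_component:
  assumes "final_topology I Y j X" "i \<in> I"
  shows "continuous_map (Y i) X (j i)"
  using assms final_topology_continuous_map[OF assms(1), of X "\<lambda>x. x"] by simp

text \<open>Products distribute over disjoint sums, because \<open>Pair i\<close> maps open sets of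
  \<open>Y i\<close> to open sets of the sum.\<close>

lemma continuous_map_prod_sum_topology:
  assumes "\<And>i. i \<in> I \<Longrightarrow> continuous_map (prod_topology Z (Y i)) W (\<lambda>(t, y). f (t, (i, y)))"
  shows "continuous_map (prod_topology Z (sum_topology Y I)) W f"
  unfolding continuous_map_def
proof (intro conjI allI impI)
  show "f \<in> topspace (prod_topology Z (sum_topology Y I)) \<rightarrow> topspace W"
    using assms by (fastforce simp: continuous_map_def Pi_iff)
  fix U assume U: "openin W U"
  let ?P = "{x \<in> topspace (prod_topology Z (sum_topology Y I)). f x \<in> U}"
  show "openin (prod_topology Z (sum_topology Y I)) ?P"
    unfolding openin_prod_topology_alt
  proof (intro allI impI)
    fix t k assume "(t, k) \<in> ?P"
    then obtain i y where k: "k = (i, y)" "i \<in> I" "y \<in> topspace (Y i)" "t \<in> topspace Z" "f (t, (i, y)) \<in> U"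
      by auto
    let ?Q = "{x \<in> topspace (prod_topology Z (Y i)). (\<lambda>(t, y). f (t, (i, y))) x \<in> U}"
    have "openin (prod_topology Z (Y i)) ?Q"
      using assms[OF k(2)] U by (rule openin_continuous_map_preimage)
    moreover have "(t, y) \<in> ?Q"
      using k by simp
    ultimately obtain A B where AB: "openin Z A" "openin (Y i) B" "t \<in> A" "y \<in> B" "A \<times> B \<subseteq> ?Q"
      unfolding openin_prod_topology_alt by meson
    have "openin (sum_topology Y I) (Pair i ` B)"
    proof -
      have "{x. (l, x) \<in> Pair i ` B} = (if l = i then B else {})" for l
        by auto
      then show ?thesis
        using AB(2) k(2) openin_subset[OF AB(2)] by (auto simp: openin_sum_topology)
    qed
    then show "\<exists>U V. openin Z U \<and> openin (sum_topology Y I) V \<and> t \<in> U \<and> k \<in> V \<and> U \<times> V \<subseteq> ?P"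
      using AB k by (intro exI[of _ A] exI[of _ "Pair i ` B"]) auto
  qed
qed

text \<open>The product of a quotient map with a locally compact Hausdorff space is again a quotient
  map. With \<open>Z\<close> the unit interval, a homotopy may be checked simplex by
  simplex.\<close>

lemma final_topology_continuous_map_prod:
  assumes X: "final_topology I Y j X"
    and Z: "locally_compact_space Z" "Hausdorff_space Z"
    and f: "\<And>i. i \<in> I \<Longrightarrow> continuous_map (prod_topology Z (Y i)) W (\<lambda>(t, y). f (t, j i y))"
  shows "continuous_map (prod_topology Z X) W f"
proof -
  have q: "quotient_map (prod_topology Z (sum_topology Y I)) (prod_topology Z X)
        (\<lambda>(x, y). (x, (case y of (i, y) \<Rightarrow> j i y)))"
    using quotient_map_prod_right[OF Z(1) _ final_topology_quotient_map[OF X]] Z(2) by blast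
  have "continuous_map (prod_topology Z (sum_topology Y I)) W
        (f \<circ> (\<lambda>(x, y). (x, (case y of (i, y) \<Rightarrow> j i y))))"
    using f by (intro continuous_map_prod_sum_topology) (simp add: o_def case_prod_unfold)
  then show ?thesis
    using continuous_compose_quotient_map_eq[OF q] by metis
qed

section \<open>Quotient maps and the collapse of a contractible subset\<close>

lemma quotient_map_lift:
  assumes "quotient_map X Y f" "continuous_map X Z h"
    and "\<And>x y. \<lbrakk>x \<in> topspace X; y \<in> topspace X; f x = f y\<rbrakk> \<Longrightarrow> h x = h y"
  shows "\<exists>g. continuous_map Y Z g \<and> (\<forall>x\<in>topspace X. g (f x) = h x)"
proof -
  obtain g where g: "\<forall>x. x \<in> topspace X \<longrightarrow> h x = g (f x)"
    using function_factors_left_gen[of "\<lambda>x. x \<in> topspace X" f h] assms(3) by blast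
  then have "continuous_map X Z (g \<circ> f)"
    using continuous_map_eq[OF assms(2)] by simp
  then show ?thesis
    using g continuous_compose_quotient_map_eq[OF assms(1)] by metis
qed

abbreviation unit_interval :: "real topology" where
  "unit_interval \<equiv> top_of_set {0..1}"

lemma unit_interval_nice: "locally_compact_space unit_interval" "Hausdorff_space unit_interval"
  by (simp_all add: compact_imp_locally_compact_space compact_space_subtopology Hausdorff_space_subtopology)

text \<open>The end of \<open>h\<close> factors through \<open>f\<close> and yields the homotopy inverse; as \<open>h\<close> preserves \<open>A\<close>,
  it also descends to a homotopy of \<open>W\<close>.\<close>

theorem homotopy_equivalent_space_collapse:
  assumes f: "quotient_map X W f"
    and fib: "\<And>x y. \<lbrakk>x \<in> topspace X; y \<in> topspace X; f x = f y\<rbrakk> \<Longrightarrow> x = y \<or> x \<in> A \<and> y \<in> A"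
    and fA: "\<And>x y. \<lbrakk>x \<in> A; y \<in> A\<rbrakk> \<Longrightarrow> f x = f y"
    and h: "continuous_map (prod_topology unit_interval X) X h"
    and h0: "\<And>x. x \<in> topspace X \<Longrightarrow> h (0, x) = x"
    and hA: "\<And>t x. \<lbrakk>t \<in> {0..1}; x \<in> A\<rbrakk> \<Longrightarrow> h (t, x) \<in> A"
    and h1: "\<And>x. x \<in> A \<Longrightarrow> h (1, x) = a"
  shows "X homotopy_equivalent_space W"
proof -
  have cf: "continuous_map X W f" using f by (rule quotient_imp_continuous_map)
  have "continuous_map X X (\<lambda>x. h (1, x))"
    using continuous_map_compose[of X "prod_topology unit_interval X" "\<lambda>x. (1, x)" X h] h
    by (simp add: o_def continuous_map_pairedI)
  moreover have "h (1, x) = h (1, y)" if "x \<in> topspace X" "y \<in> topspace X" "f x = f y" for x y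
    using fib[OF that] h1 by metis
  ultimately have "\<exists>g. continuous_map W X g \<and> (\<forall>x\<in>topspace X. g (f x) = h (1, x))"
    by (rule quotient_map_lift[OF f])
  then obtain g where g: "continuous_map W X g" "\<And>x. x \<in> topspace X \<Longrightarrow> g (f x) = h (1, x)"
    by blast
  \<comment> \<open>Local compactness of the interval keeps the product of \<open>f\<close> with the
    identity a quotient map, so the homotopy can descend to \<open>W\<close>.\<close>
  have qI: "quotient_map (prod_topology unit_interval X) (prod_topology unit_interval W) (\<lambda>(t, x). (t, f x))"
    using quotient_map_prod_right[OF unit_interval_nice(1) _ f] unit_interval_nice(2) by blast
  have "continuous_map (prod_topology unit_interval X) W (\<lambda>p. f (h p))"
    using continuous_map_compose[OF h cf] by (simp add: o_def)
  moreover have "f (h p) = f (h q)"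
    if "p \<in> topspace (prod_topology unit_interval X)" "q \<in> topspace (prod_topology unit_interval X)"
      "(\<lambda>(t, x). (t, f x)) p = (\<lambda>(t, x). (t, f x)) q" for p q
  proof -
    obtain t x where p: "p = (t, x)" by fastforce
    obtain s y where q: "q = (s, y)" by fastforce
    have txy: "p = (t, x)" "q = (t, y)" "t \<in> {0..1}" "x \<in> topspace X" "y \<in> topspace X" "f x = f y"
      using that unfolding p q by auto
    from fib[OF txy(4-6)] show ?thesis
      using txy fA[OF hA hA, of t x t y] by auto
  qed
  ultimately have "\<exists>k. continuous_map (prod_topology unit_interval W) W k \<and>
      (\<forall>p\<in>topspace (prod_topology unit_interval X). k ((\<lambda>(t, x). (t, f x)) p) = f (h p))"
    by (rule quotient_map_lift[OF qI])
  then obtain k where k: "continuous_map (prod_topology unit_interval W) W k"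
    "\<And>p. p \<in> topspace (prod_topology unit_interval X) \<Longrightarrow> k ((\<lambda>(t, x). (t, f x)) p) = f (h p)"
    by blast
  have k': "k (t, f x) = f (h (t, x))" if "t \<in> {0..1}" "x \<in> topspace X" for t x
    using k(2)[of "(t, x)"] that by simp
  have surj: "\<exists>x\<in>topspace X. w = f x" if "w \<in> topspace W" for w
    using quotient_imp_surjective_map[OF f] that by blast
  have "homotopic_with (\<lambda>_. True) X X id (g \<circ> f)"
    using h h0 g by (subst homotopic_with) auto
  moreover have "homotopic_with (\<lambda>_. True) W W id (f \<circ> g)"
  proof -
    have "k (0, w) = w \<and> k (1, w) = f (g w)" if w: "w \<in> topspace W" for w
    proof -
      obtain x where "x \<in> topspace X" "w = f x" using surj[OF w] by blast
      then show ?thesis using k'[of 0 x] k'[of 1 x] h0[of x] g(2)[of x] by simp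
    qed
    then show ?thesis
      using k(1) by (subst homotopic_with) auto
  qed
  ultimately show ?thesis
    unfolding homotopy_equivalent_space_def
    using cf g(1) by (intro exI[of _ f] exI[of _ g]) (simp add: homotopic_with_sym)
qed

subsection \<open>Geometric realizations\<close>

definition simplicial_complex :: "'a set set \<Rightarrow> bool" where
  "simplicial_complex K \<longleftrightarrow>
     (\<forall>\<sigma>\<in>K. finite \<sigma> \<and> \<sigma> \<noteq> {} \<and> (\<forall>\<tau>. \<tau> \<subseteq> \<sigma> \<and> \<tau> \<noteq> {} \<longrightarrow> \<tau> \<in> K))"

definition realization_set :: "'a set set \<Rightarrow> ('a \<Rightarrow> real) set" where
  "realization_set K = (\<Union>\<sigma>\<in>K. geom_simplex \<sigma>)"

lemma realization_set_mono: "K \<subseteq> L \<Longrightarrow> realization_set K \<subseteq> realization_set L"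
  by (auto simp: realization_set_def)

lemma powertop_real_eq_euclidean: "powertop_real UNIV = (euclidean :: ('a \<Rightarrow> real) topology)"
  by (simp add: euclidean_product_topology)

lemma prod_topology_unit_interval:
  "prod_topology unit_interval (top_of_set S) = top_of_set ({0..1} \<times> S)"
  using subtopology_Times[of euclidean euclidean "{0..1::real}" S] by simp

lemma istopology_geom_realization:
  "istopology (\<lambda>U. U \<subseteq> (\<Union>\<sigma>\<in>K. geom_simplex \<sigma>) \<and>
      (\<forall>\<sigma>\<in>K. openin (subtopology (powertop_real UNIV) (geom_simplex \<sigma>)) (U \<inter> geom_simplex \<sigma>)))"
  unfolding istopology_def
proof (intro conjI allI impI ballI)
  fix U V \<sigma>
  assume "U \<subseteq> (\<Union>\<sigma>\<in>K. geom_simplex \<sigma>) \<and>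
      (\<forall>\<sigma>\<in>K. openin (subtopology (powertop_real UNIV) (geom_simplex \<sigma>)) (U \<inter> geom_simplex \<sigma>))"
    "V \<subseteq> (\<Union>\<sigma>\<in>K. geom_simplex \<sigma>) \<and>
      (\<forall>\<sigma>\<in>K. openin (subtopology (powertop_real UNIV) (geom_simplex \<sigma>)) (V \<inter> geom_simplex \<sigma>))" "\<sigma> \<in> K"
  moreover have "U \<inter> V \<inter> geom_simplex \<sigma> = (U \<inter> geom_simplex \<sigma>) \<inter> (V \<inter> geom_simplex \<sigma>)" by blast
  ultimately show "openin (subtopology (powertop_real UNIV) (geom_simplex \<sigma>)) (U \<inter> V \<inter> geom_simplex \<sigma>)"
    by (metis openin_Int)
next
  fix \<U> \<sigma>
  assume "\<forall>U\<in>\<U>. U \<subseteq> (\<Union>\<sigma>\<in>K. geom_simplex \<sigma>) \<and>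
      (\<forall>\<sigma>\<in>K. openin (subtopology (powertop_real UNIV) (geom_simplex \<sigma>)) (U \<inter> geom_simplex \<sigma>))" "\<sigma> \<in> K"
  then have "openin (subtopology (powertop_real UNIV) (geom_simplex \<sigma>)) (\<Union>((\<lambda>U. U \<inter> geom_simplex \<sigma>) ` \<U>))"
    by (intro openin_Union) blast
  then show "openin (subtopology (powertop_real UNIV) (geom_simplex \<sigma>)) (\<Union>\<U> \<inter> geom_simplex \<sigma>)"
    by (simp only: Int_Union2)
qed blast+

lemma openin_geom_realization:
  "openin (geom_realization K) U \<longleftrightarrow> U \<subseteq> realization_set K \<and>
     (\<forall>\<sigma>\<in>K. openin (top_of_set (geom_simplex \<sigma>)) (U \<inter> geom_simplex \<sigma>))"
  unfolding geom_realization_def realization_set_def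
  by (subst topology_inverse'[OF istopology_geom_realization]) (simp add: powertop_real_eq_euclidean)

lemma topspace_geom_realization [simp]: "topspace (geom_realization K) = realization_set K"
proof -
  have "openin (geom_realization K) (realization_set K)"
    unfolding openin_geom_realization
    by (auto simp: realization_set_def intro!: openin_subtopology_self
        simp: Int_absorb1[OF UN_upper])
  then show ?thesis
    using openin_geom_realization openin_subset openin_topspace subset_antisym by metis
qed

lemma final_topology_geom_realization:
  "final_topology K (\<lambda>\<sigma>. top_of_set (geom_simplex \<sigma>)) (\<lambda>\<sigma> x. x) (geom_realization K)"
proof -
  have "{y \<in> geom_simplex \<sigma>. y \<in> U} = U \<inter> geom_simplex \<sigma>" for U and \<sigma> :: "'a set" by blast
  then show ?thesis
    by (auto simp: final_topology_def openin_geom_realization realization_set_def)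
qed

lemma continuous_map_geom_realization:
  "continuous_map (geom_realization K) Y f \<longleftrightarrow> (\<forall>\<sigma>\<in>K. continuous_map (top_of_set (geom_simplex \<sigma>)) Y f)"
  by (rule final_topology_continuous_map[OF final_topology_geom_realization])

lemma continuous_map_prod_geom_realization:
  assumes "\<And>\<sigma>. \<sigma> \<in> K \<Longrightarrow> continuous_map (prod_topology unit_interval (top_of_set (geom_simplex \<sigma>))) Y f"
  shows "continuous_map (prod_topology unit_interval (geom_realization K)) Y f"
  using assms by (intro final_topology_continuous_map_prod[OF final_topology_geom_realization unit_interval_nice])
    (simp add: case_prod_unfold)

lemma geom_simplex_nonneg: "x \<in> geom_simplex \<sigma> \<Longrightarrow> 0 \<le> x v"
  by (simp add: geom_simplex_def)

lemma geom_simplex_outside: "x \<in> geom_simplex \<sigma> \<Longrightarrow> v \<notin> \<sigma> \<Longrightarrow> x v = 0"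
  by (simp add: geom_simplex_def)

lemma geom_simplex_mono:
  assumes "\<tau> \<subseteq> \<sigma>" "finite \<sigma>" shows "geom_simplex \<tau> \<subseteq> geom_simplex \<sigma>"
proof
  fix x assume x: "x \<in> geom_simplex \<tau>"
  then have "sum x \<sigma> = sum x \<tau>"
    using assms by (intro sum.mono_neutral_right) (auto simp: geom_simplex_def)
  then show "x \<in> geom_simplex \<sigma>"
    using x assms by (auto simp: geom_simplex_def)
qed

lemma geom_simplex_restrict:
  assumes "x \<in> geom_simplex \<sigma>" "finite \<sigma>" "\<And>v. v \<in> \<sigma> - \<tau> \<Longrightarrow> x v = 0" "\<tau> \<subseteq> \<sigma>"
  shows "x \<in> geom_simplex \<tau>"
proof -
  have "sum x \<tau> = sum x \<sigma>"
    using assms by (intro sum.mono_neutral_left) auto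
  then show ?thesis using assms by (auto simp: geom_simplex_def)
qed

lemma geom_simplex_empty [simp]: "geom_simplex {} = {}"
  by (simp add: geom_simplex_def)

lemma closed_geom_simplex: "closed (geom_simplex \<sigma>)"
proof -
  have "closed ((\<Inter>v. {f. 0 \<le> f v}) \<inter> (\<Inter>v\<in>-\<sigma>. {f. f v = 0}) \<inter> {f :: 'a \<Rightarrow> real. sum f \<sigma> = 1})"
    by (intro closed_Int closed_INT ballI closed_Collect_le closed_Collect_eq continuous_on_sum
        continuous_on_const continuous_on_product_coordinates)
  also have "\<dots> = geom_simplex \<sigma>"
    by (auto simp: geom_simplex_def)
  finally show ?thesis .
qed

lemma compact_geom_simplex:
  assumes "finite \<sigma>" shows "compact (geom_simplex \<sigma>)"
proof -
  have "compactin (powertop_real UNIV) (PiE UNIV (\<lambda>_. {0..1}))"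
    by (subst compactin_PiE) auto
  then have "compact (PiE UNIV (\<lambda>_. {0..1}) :: ('a \<Rightarrow> real) set)"
    by (simp add: powertop_real_eq_euclidean)
  moreover have "geom_simplex \<sigma> \<subseteq> PiE UNIV (\<lambda>_. {0..1})"
  proof
    fix x assume x: "x \<in> geom_simplex \<sigma>"
    have "x v \<le> 1" for v
    proof (cases "v \<in> \<sigma>")
      case True
      then have "x v \<le> sum x \<sigma>"
        using x assms by (intro member_le_sum) (auto simp: geom_simplex_def)
      then show ?thesis using x by (simp add: geom_simplex_def)
    next
      case False then show ?thesis using x by (simp add: geom_simplex_def)
    qed
    then show "x \<in> PiE UNIV (\<lambda>_. {0..1})"
      using x by (auto simp: geom_simplex_def)
  qed
  ultimately show ?thesis
    using closed_geom_simplex compact_Int_closed by (metis inf.absorb_iff2)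
qed

text \<open>Finitely many closed simplices can be pasted, so on a finite subcomplex the product
  topology is as fine as the coherent one. Through this lemma homotopies given by coordinate
  formulas enter a realization.\<close>

lemma continuous_map_finite_into_realization:
  assumes "finite L" "L \<subseteq> K"
  shows "continuous_map (top_of_set (realization_set L)) (geom_realization K) (\<lambda>x. x)"
proof (rule pasting_lemma_closed[of L _ geom_simplex _ "\<lambda>_ x. x"])
  fix \<sigma> assume \<sigma>: "\<sigma> \<in> L"
  then have sub: "geom_simplex \<sigma> \<subseteq> realization_set L"
    by (auto simp: realization_set_def)
  then show "closedin (top_of_set (realization_set L)) (geom_simplex \<sigma>)"
    by (simp add: closed_geom_simplex closed_subset)
  have "subtopology (top_of_set (realization_set L)) (geom_simplex \<sigma>) = top_of_set (geom_simplex \<sigma>)"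
    using sub by (simp add: subtopology_subtopology Int_absorb1)
  then show "continuous_map (subtopology (top_of_set (realization_set L)) (geom_simplex \<sigma>))
      (geom_realization K) (\<lambda>x. x)"
    using final_topology_continuous_map_component[OF final_topology_geom_realization, of \<sigma> K] \<sigma> assms
    by auto
qed (use assms in \<open>auto simp: realization_set_def\<close>)

lemma continuous_map_subcomplex:
  assumes "L \<subseteq> K"
  shows "continuous_map (geom_realization L) (geom_realization K) (\<lambda>x. x)"
  unfolding continuous_map_geom_realization
  using final_topology_continuous_map_component[OF final_topology_geom_realization, of _ K] assms by auto

subsection \<open>Strong deformation retractions and infinite concatenation\<close>

lemma continuous_on_reparam:
  fixes f :: "real \<Rightarrow> real"
  assumes "continuous_on UNIV f"
  shows "continuous_on S (\<lambda>p. (f (fst p), snd p))"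
  by (intro continuous_on_Pair continuous_on_compose2[OF assms] continuous_on_fst continuous_on_snd
      continuous_on_id) auto

text \<open>Strong deformation retraction in the topology of pointwise convergence. The stages it
  serves are finite complexes, where this is also the coherent topology.\<close>

definition sdr :: "('a \<Rightarrow> real) set \<Rightarrow> ('a \<Rightarrow> real) set \<Rightarrow> bool" where
  "sdr B A \<longleftrightarrow> A \<subseteq> B \<and> (\<exists>h. continuous_on ({0..1::real} \<times> B) h \<and> h ` ({0..1::real} \<times> B) \<subseteq> B \<and>
      (\<forall>x\<in>B. h (0::real, x) = x \<and> h (1, x) \<in> A) \<and> (\<forall>t\<in>{0..1}. \<forall>x\<in>A. h (t, x) = x))"

lemma sdr_refl: "sdr A A"
  unfolding sdr_def by (auto intro!: exI[of _ snd] continuous_on_snd continuous_on_id)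

lemma sdr_trans:
  assumes "sdr C B" "sdr B A" shows "sdr C A"
proof -
  obtain h where h: "B \<subseteq> C" "continuous_on ({0..1::real} \<times> C) h" "h ` ({0..1::real} \<times> C) \<subseteq> C"
    "\<And>x. x \<in> C \<Longrightarrow> h (0::real, x) = x" "\<And>x. x \<in> C \<Longrightarrow> h (1, x) \<in> B"
    "\<And>t x. t \<in> {0..1} \<Longrightarrow> x \<in> B \<Longrightarrow> h (t, x) = x"
    using assms(1) unfolding sdr_def by auto
  obtain k where k: "A \<subseteq> B" "continuous_on ({0..1::real} \<times> B) k" "k ` ({0..1::real} \<times> B) \<subseteq> B"
    "\<And>x. x \<in> B \<Longrightarrow> k (0::real, x) = x" "\<And>x. x \<in> B \<Longrightarrow> k (1, x) \<in> A"
    "\<And>t x. t \<in> {0..1} \<Longrightarrow> x \<in> A \<Longrightarrow> k (t, x) = x"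
    using assms(2) unfolding sdr_def by auto
  define g where "g = (\<lambda>p. if fst p \<le> 1/2 then h (2 * fst p, snd p) else k (2 * fst p - 1, h (1, snd p)))"
  have "continuous_on ({0..1::real} \<times> C) g"
    unfolding g_def
  proof (rule continuous_on_cases_le)
    show "continuous_on {p \<in> {0..1::real} \<times> C. fst p \<le> 1/2} (\<lambda>p. h (2 * fst p, snd p))"
      by (rule continuous_on_compose2[OF h(2) continuous_on_reparam]) (auto intro!: continuous_intros)
    show "continuous_on {p \<in> {0..1::real} \<times> C. 1/2 \<le> fst p} (\<lambda>p. k (2 * fst p - 1, h (1, snd p)))"
    proof (rule continuous_on_compose2[OF k(2)])
      show "continuous_on {p \<in> {0..1::real} \<times> C. 1/2 \<le> fst p} (\<lambda>p. (2 * fst p - 1, h (1, snd p)))"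
      proof (rule continuous_on_Pair)
        show "continuous_on {p \<in> {0..1::real} \<times> C. 1/2 \<le> fst p} (\<lambda>p. h (1, snd p))"
          by (rule continuous_on_compose2[OF h(2) continuous_on_reparam]) (auto intro!: continuous_intros)
      qed (auto intro!: continuous_intros)
    qed (use h(5) in auto)
    show "\<And>p. p \<in> {0..1::real} \<times> C \<Longrightarrow> fst p = 1/2 \<Longrightarrow> h (2 * fst p, snd p) = k (2 * fst p - 1, h (1, snd p))"
    proof -
      fix p assume "p \<in> {0..1::real} \<times> C" "fst p = 1/2"
      then have "2 * fst p = 1" "k (0, h (1, snd p)) = h (1, snd p)"
        using h(5) k(4) by auto
      then show "h (2 * fst p, snd p) = k (2 * fst p - 1, h (1, snd p))"
        by simp
    qed
  qed (intro continuous_intros)+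
  moreover have "g ` ({0..1::real} \<times> C) \<subseteq> C"
  proof clarify
    fix t :: real and x assume tx: "t \<in> {0..1}" "x \<in> C"
    show "g (t, x) \<in> C"
    proof (cases "t \<le> 1/2")
      case True
      then have "(2 * t, x) \<in> {0..1::real} \<times> C" using tx by auto
      then show ?thesis using h(3) True by (auto simp: g_def)
    next
      case False
      then have "(2 * t - 1, h (1, x)) \<in> {0..1::real} \<times> B" using tx h(5) by auto
      then have "k (2 * t - 1, h (1, x)) \<in> C" using k(3) h(1) by blast
      then show ?thesis using False by (simp add: g_def)
    qed
  qed
  moreover have "\<forall>x\<in>C. g (0, x) = x \<and> g (1, x) \<in> A"
    using h k by (simp add: g_def)
  moreover have "\<forall>t\<in>{0..1}. \<forall>x\<in>A. g (t, x) = x"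
    using h(6) k(1,6) by (auto simp: g_def)
  ultimately show ?thesis
    unfolding sdr_def using h(1) k(1) by blast
qed

text \<open>The \<open>k\<close>-th retraction is performed during the time interval from \<open>(1/2)^(k+1)\<close> to
  \<open>(1/2)^k\<close>, so that the contraction of each stage extends that of the previous one.\<close>

lemma sdr_sequence_contraction:
  fixes X :: "nat \<Rightarrow> ('a \<Rightarrow> real) set"
  assumes X: "\<And>k. sdr (X (Suc k)) (X k)" and X0: "X 0 = {a}"
  shows "\<exists>C. \<forall>k. continuous_on ({0..1::real} \<times> X k) C \<and> C ` ({0..1::real} \<times> X k) \<subseteq> X k \<and>
      (\<forall>x\<in>X k. C (0::real, x) = x \<and> C (1, x) = a)"
proof -
  have "\<forall>k. \<exists>h. continuous_on ({0..1::real} \<times> X (Suc k)) h \<and> h ` ({0..1} \<times> X (Suc k)) \<subseteq> X (Suc k) \<and>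
      (\<forall>x\<in>X (Suc k). h (0, x) = x \<and> h (1, x) \<in> X k) \<and> (\<forall>t\<in>{0..1}. \<forall>x\<in>X k. h (t, x) = x)"
    using X unfolding sdr_def by (rule allI[OF conjunct2])
  from choice[OF this] obtain h where hh: "\<forall>k. continuous_on ({0..1::real} \<times> X (Suc k)) (h k) \<and>
      h k ` ({0..1} \<times> X (Suc k)) \<subseteq> X (Suc k) \<and>
      (\<forall>x\<in>X (Suc k). h k (0, x) = x \<and> h k (1, x) \<in> X k) \<and> (\<forall>t\<in>{0..1}. \<forall>x\<in>X k. h k (t, x) = x)"
    by (rule exE)
  have h: "\<And>k. continuous_on ({0..1::real} \<times> X (Suc k)) (h k)"
    "\<And>k. h k ` ({0..1} \<times> X (Suc k)) \<subseteq> X (Suc k)"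
    "\<And>k x. x \<in> X (Suc k) \<Longrightarrow> h k (0, x) = x"
    "\<And>k x. x \<in> X (Suc k) \<Longrightarrow> h k (1, x) \<in> X k"
    "\<And>k t x. t \<in> {0..1} \<Longrightarrow> x \<in> X k \<Longrightarrow> h k (t, x) = x"
    using hh by blast+
  have Xmono: "X k \<subseteq> X (Suc k)" for k using X unfolding sdr_def by blast
  \<comment> \<open>\<open>D k\<close> stands still up to time \<open>(1/2)^k\<close>.
    \<open>D (Suc k)\<close> uses the second half of that pause to run \<open>h k\<close> and then
    hands the endpoint to \<open>D k\<close>; the \<open>max 0\<close> keeps it still during the
    first half.\<close>
  define D where "D = rec_nat (\<lambda>p. snd p)
    (\<lambda>k c (p :: real \<times> ('a \<Rightarrow> real)). if fst p \<le> (1/2)^k then h k (max 0 (2^(Suc k) * fst p - 1), snd p) else c (fst p, h k (1, snd p)))"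
  have D0: "D 0 = (\<lambda>p. snd p)" by (simp add: D_def)
  have DS: "D (Suc k) = (\<lambda>p. if fst p \<le> (1/2)^k then h k (max 0 (2^(Suc k) * fst p - 1), snd p)
      else D k (fst p, h k (1, snd p)))" for k
    unfolding D_def by simp
  have inv: "continuous_on ({0..1::real} \<times> X k) (D k) \<and> D k ` ({0..1::real} \<times> X k) \<subseteq> X k \<and>
      (\<forall>x\<in>X k. \<forall>t\<in>{0..(1/2)^k}. D k (t, x) = x) \<and> (\<forall>x\<in>X k. D k (1, x) = a)" for k
  proof (induction k)
    case 0
    then show ?case using X0 by (auto simp: D0 intro!: continuous_on_snd continuous_on_id)
  next
    case (Suc k)
    have half: "(1/2::real)^k \<le> 1" by (simp add: power_le_one)
    have mx: "max 0 (2^(Suc k) * t - 1) \<in> {0..1}" if "t \<le> (1/2)^k" for t :: real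
      using mult_left_mono[OF that, of "2^k"] by (auto simp: power_one_over)
    have "continuous_on ({0..1::real} \<times> X (Suc k)) (D (Suc k))"
      unfolding DS
    proof (rule continuous_on_cases_le)
      show "continuous_on {p \<in> {0..1::real} \<times> X (Suc k). fst p \<le> (1/2)^k}
          (\<lambda>p. h k (max 0 (2^(Suc k) * fst p - 1), snd p))"
      proof (rule continuous_on_compose2[OF h(1) continuous_on_reparam])
        show "(\<lambda>p. (max 0 (2^(Suc k) * fst p - 1), snd p)) ` {p \<in> {0..1::real} \<times> X (Suc k). fst p \<le> (1/2)^k}
           \<subseteq> {0..1::real} \<times> X (Suc k)"
          using mx by auto
      qed (auto intro!: continuous_intros)
      show "continuous_on {p \<in> {0..1::real} \<times> X (Suc k). (1/2)^k \<le> fst p} (\<lambda>p. D k (fst p, h k (1, snd p)))"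
      proof (rule continuous_on_compose2[of "{0..1::real} \<times> X k" "D k"])
        show "continuous_on ({0..1::real} \<times> X k) (D k)" using Suc by blast
        show "continuous_on {p \<in> {0..1::real} \<times> X (Suc k). (1/2)^k \<le> fst p} (\<lambda>p. (fst p, h k (1, snd p)))"
        proof (rule continuous_on_Pair)
          show "continuous_on {p \<in> {0..1::real} \<times> X (Suc k). (1/2)^k \<le> fst p} (\<lambda>p. h k (1, snd p))"
            by (rule continuous_on_compose2[OF h(1) continuous_on_reparam]) (auto intro!: continuous_intros)
        qed (intro continuous_intros)
      qed (use h(4) in auto)
      show "\<And>p. p \<in> {0..1::real} \<times> X (Suc k) \<Longrightarrow> fst p = (1/2)^k \<Longrightarrow>
          h k (max 0 (2^(Suc k) * fst p - 1), snd p) = D k (fst p, h k (1, snd p))"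
        using Suc h(4) half by (auto simp: power_one_over)
    qed (intro continuous_intros)+
    moreover have "D (Suc k) (t, x) \<in> X (Suc k)" if "t \<in> {0..1}" "x \<in> X (Suc k)" for t x
    proof (cases "t \<le> (1/2)^k")
      case True
      then show ?thesis using h(2)[of k] mx[OF True] that(2) by (auto simp: DS simp del: power_Suc)
    next
      case False
      then have "D (Suc k) (t, x) = D k (t, h k (1, x))" by (simp add: DS)
      moreover have "D k (t, h k (1, x)) \<in> X k"
        using Suc that h(4) by blast
      ultimately show ?thesis using Xmono by auto
    qed
    moreover have "D (Suc k) (t, x) = x" if "x \<in> X (Suc k)" "t \<in> {0..(1/2)^Suc k}" for t x
    proof -
      have "2^(Suc k) * t - 1 \<le> 0"
        using that(2) mult_left_mono[of t "(1/2)^Suc k" "2^Suc k"] by (simp add: power_one_over)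
      moreover have "t \<le> (1/2)^k" using that(2) by simp
      ultimately show ?thesis using h(3) that(1) by (simp add: DS max_def)
    qed
    moreover have "D (Suc k) (1, x) = a" if "x \<in> X (Suc k)" for x
    proof (cases "k = 0")
      case True
      then show ?thesis using h(4)[of x 0] X0 that by (simp add: DS)
    next
      case False
      then have "\<not> (1 \<le> (1/2::real)^k)"
        by (simp add: power_less_one_iff linorder_not_le)
      then show ?thesis using Suc h(4)[OF that] by (simp add: DS)
    qed
    ultimately show ?case by auto
  qed
  \<comment> \<open>On \<open>X k\<close> the retraction \<open>h k\<close> moves nothing, and
    \<open>D k\<close> is still pausing while it runs.\<close>
  have ext1: "D (Suc k) (t, x) = D k (t, x)" if "t \<in> {0..1}" "x \<in> X k" for k t x
  proof (cases "t \<le> (1/2)^k")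
    case True
    have "max 0 (2^(Suc k) * t - 1) \<in> {0..1}"
      using mult_left_mono[OF True, of "2^k"] by (auto simp: power_one_over)
    then show ?thesis using True that h(5) inv[of k] by (simp add: DS)
  next
    case False
    then show ?thesis using that h(5) by (simp add: DS)
  qed
  have Xmono': "X k \<subseteq> X l" if "k \<le> l" for k l
    using Xmono lift_Suc_mono_le that by blast
  have ext: "D l (t, x) = D k (t, x)" if "k \<le> l" "t \<in> {0..1}" "x \<in> X k" for k l t x
    using that(1)
  proof (induction l rule: dec_induct)
    case (step l)
    show ?case by (rule trans[OF ext1[OF that(2) subsetD[OF Xmono'[OF step(1)] that(3)]] step.IH])
  qed simp
  define C where "C = (\<lambda>p. D (LEAST k. snd p \<in> X k) p)"
  have C: "C (t, x) = D k (t, x)" if "t \<in> {0..1}" "x \<in> X k" for t x k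
  proof -
    have "(LEAST k. x \<in> X k) \<le> k" "x \<in> X (LEAST k. x \<in> X k)"
      using that(2) by (auto intro: Least_le LeastI)
    then show ?thesis using ext that by (simp add: C_def)
  qed
  show ?thesis
  proof (intro exI[of _ C] allI conjI ballI)
    fix k
    show "continuous_on ({0..1::real} \<times> X k) C"
      using inv[of k] C by (subst continuous_on_cong[OF refl, of _ _ "D k"]) auto
    show "C ` ({0..1::real} \<times> X k) \<subseteq> X k"
    proof
      fix y assume "y \<in> C ` ({0..1::real} \<times> X k)"
      then obtain t x where tx: "t \<in> {0..1}" "x \<in> X k" "y = C (t, x)" by blast
      then have "y = D k (t, x)" using C by simp
      then show "y \<in> X k" using inv[of k] tx by blast
    qed
    fix x assume "x \<in> X k"
    then show "C (0, x) = x" "C (1, x) = a"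
      using inv[of k] C by auto
  qed
qed

subsection \<open>Collapses\<close>

lemma continuous_on_Min_image:
  fixes f :: "'i \<Rightarrow> 'b::topological_space \<Rightarrow> real"
  assumes "finite S" "S \<noteq> {}" "\<And>i. i \<in> S \<Longrightarrow> continuous_on A (f i)"
  shows "continuous_on A (\<lambda>x. Min ((\<lambda>i. f i x) ` S))"
  using assms
proof (induction S rule: finite_ne_induct)
  case (insert i S)
  then have "continuous_on A (\<lambda>x. min (f i x) (Min ((\<lambda>i. f i x) ` S)))"
    by (intro continuous_on_min) auto
  with insert show ?case by simp
qed simp

text \<open>Moving the minimum over \<open>\<tau>\<close> from the vertices of \<open>\<tau>\<close> to \<open>p\<close> is a single linear formula:
  it fixes the other simplices, since there some coordinate in \<open>\<tau>\<close> vanishes.\<close>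

lemma sdr_elementary_collapse:
  assumes A: "simplicial_complex A" and \<tau>: "finite \<tau>" "\<tau> \<noteq> {}" "p \<notin> \<tau>" "\<tau> \<notin> A"
    and faces: "\<And>i. i \<in> \<tau> \<Longrightarrow> insert p \<tau> - {i} \<in> A"
  shows "sdr (realization_set (A \<union> {\<tau>, insert p \<tau>})) (realization_set A)"
proof -
  let ?B = "realization_set (A \<union> {\<tau>, insert p \<tau>})"
  define \<mu> where "\<mu> = (\<lambda>x :: 'a \<Rightarrow> real. Min (x ` \<tau>))"
  \<comment> \<open>The entries of \<open>c\<close> on \<open>insert p \<tau>\<close> add up to
    zero, so the total mass stays 1; at time 1 a coordinate attaining the minimum has become
    zero.\<close>
  define c where "c = (\<lambda>v. if v = p then real (card \<tau>) else if v \<in> \<tau> then -1 else 0)"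
  define r where "r = (\<lambda>q v. snd q v + fst q * \<mu> (snd q) * c v)"
  have cont: "continuous_on ({0..1::real} \<times> ?B) r"
  proof (rule continuous_on_coordinatewise_then_product)
    fix v
    have *: "continuous_on S (\<lambda>q :: real \<times> ('a \<Rightarrow> real). snd q i)" for S i
      by (rule continuous_on_compose2[OF continuous_on_product_coordinates continuous_on_snd]) auto
    have "continuous_on ({0..1::real} \<times> ?B) (\<lambda>q. \<mu> (snd q))"
      unfolding \<mu>_def using continuous_on_Min_image[where f = "\<lambda>i q. snd q i", OF \<tau>(1,2) *] .
    then show "continuous_on ({0..1::real} \<times> ?B) (\<lambda>q. r q v)"
      unfolding r_def by (intro continuous_intros *)
  qed
  have fix_A: "\<mu> x = 0" if "x \<in> realization_set A" for x
  proof -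
    from that obtain \<sigma> where \<sigma>: "\<sigma> \<in> A" "x \<in> geom_simplex \<sigma>"
      by (auto simp: realization_set_def)
    then have "\<not> \<tau> \<subseteq> \<sigma>"
      using A \<tau>(2,4) unfolding simplicial_complex_def by meson
    then obtain i where "i \<in> \<tau>" "i \<notin> \<sigma>" by blast
    then show ?thesis
      unfolding \<mu>_def using \<sigma> \<tau>(1) geom_simplex_nonneg geom_simplex_outside[OF \<sigma>(2)]
      by (intro Min_eqI) force+
  qed
  have new: "r (t, x) \<in> geom_simplex (insert p \<tau>)" "\<exists>i\<in>\<tau>. r (1, x) i = 0"
    if x: "x \<in> geom_simplex (insert p \<tau>)" and t: "t \<in> {0..1}" for x t
  proof -
    have \<mu>_le: "\<mu> x \<le> x i" if "i \<in> \<tau>" for i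
      using that \<tau>(1) by (simp add: \<mu>_def)
    have "\<mu> x \<in> x ` \<tau>" unfolding \<mu>_def using \<tau> by (intro Min_in) auto
    then obtain i where i: "i \<in> \<tau>" "\<mu> x = x i" by auto
    then have \<mu>0: "0 \<le> \<mu> x" using geom_simplex_nonneg[OF x] by simp
    then have t\<mu>: "t * \<mu> x \<le> \<mu> x" "0 \<le> t * \<mu> x" using t by (auto intro: mult_left_le_one_le)
    have "0 \<le> r (t, x) v" for v
      using geom_simplex_nonneg[OF x, of v] t\<mu> \<mu>_le[of v] by (auto simp: r_def c_def)
    moreover have "r (t, x) v = 0" if "v \<notin> insert p \<tau>" for v
      using that geom_simplex_outside[OF x that] by (auto simp: r_def c_def)
    moreover have "sum c (insert p \<tau>) = 0"
    proof -
      have "sum c \<tau> = (\<Sum>v\<in>\<tau>. -1)" using \<tau>(3) by (intro sum.cong) (auto simp: c_def)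
      then show ?thesis using \<tau> by (simp add: c_def)
    qed
    then have "sum (r (t, x)) (insert p \<tau>) = sum x (insert p \<tau>)"
      by (simp add: r_def sum.distrib flip: sum_distrib_left)
    ultimately show "r (t, x) \<in> geom_simplex (insert p \<tau>)"
      using x by (simp add: geom_simplex_def)
    show "\<exists>i\<in>\<tau>. r (1, x) i = 0"
      using i \<tau>(3) by (intro bexI[of _ i]) (auto simp: r_def c_def)
  qed
  have sub: "geom_simplex \<tau> \<subseteq> geom_simplex (insert p \<tau>)"
    using \<tau> by (intro geom_simplex_mono) auto
  have B_cases: "x \<in> realization_set A \<or> x \<in> geom_simplex (insert p \<tau>)" if "x \<in> ?B" for x
    using that sub by (auto simp: realization_set_def)
  have B_new: "geom_simplex (insert p \<tau>) \<subseteq> ?B" "realization_set A \<subseteq> ?B"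
    by (auto simp: realization_set_def)
  have r_A: "r (t, x) = x" if "x \<in> realization_set A" for t x
    using fix_A[OF that] by (simp add: r_def)
  show ?thesis
    unfolding sdr_def
  proof (intro conjI exI[of _ r] ballI)
    show "r ` ({0..1::real} \<times> ?B) \<subseteq> ?B"
    proof clarify
      fix t :: real and x assume t: "t \<in> {0..1}" and x: "x \<in> ?B"
      from B_cases[OF x] show "r (t, x) \<in> ?B"
      proof
        assume "x \<in> realization_set A"
        then show ?thesis using x r_A by simp
      qed (use new(1)[OF _ t] B_new in blast)
    qed
    fix x assume x: "x \<in> ?B"
    show "r (0, x) = x" by (simp add: r_def)
    show "r (1, x) \<in> realization_set A"
      using B_cases[OF x]
    proof
      assume x: "x \<in> geom_simplex (insert p \<tau>)"
      obtain i where i: "i \<in> \<tau>" "r (1, x) i = 0" using new(2)[OF x, of 1] by auto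
      have "r (1, x) \<in> geom_simplex (insert p \<tau> - {i})"
      proof (rule geom_simplex_restrict[of _ "insert p \<tau>"])
        show "r (1, x) \<in> geom_simplex (insert p \<tau>)" by (rule new(1)[OF x]) simp
        show "r (1, x) v = 0" if "v \<in> insert p \<tau> - (insert p \<tau> - {i})" for v
        proof -
          have "v = i" using that by blast
          then show ?thesis using i(2) by (rule ssubst)
        qed
      qed (use \<tau>(1) in auto)
      then show ?thesis unfolding realization_set_def by (rule UN_I[OF faces[OF i(1)]])
    qed (simp add: r_A)
  qed (use cont r_A B_new in auto)
qed

section \<open>Attaching facets along cones, and contractions from shellings\<close>

definition faces :: "'a set set \<Rightarrow> 'a set set" where
  "faces F = {\<tau>. \<tau> \<noteq> {} \<and> (\<exists>\<Delta>\<in>F. \<tau> \<subseteq> \<Delta>)}"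

lemma faces_Un: "faces (F \<union> G) = faces F \<union> faces G"
  by (auto simp: faces_def)

lemma simplicial_complex_faces: "(\<And>\<Delta>. \<Delta> \<in> F \<Longrightarrow> finite \<Delta>) \<Longrightarrow> simplicial_complex (faces F)"
  unfolding simplicial_complex_def faces_def by (blast intro: finite_subset)

lemma simplicial_complex_Un: "simplicial_complex K \<Longrightarrow> simplicial_complex L \<Longrightarrow> simplicial_complex (K \<union> L)"
  unfolding simplicial_complex_def by blast

text \<open>The missing faces come in pairs \<open>\<tau>\<close>, \<open>insert p \<tau>\<close>.
  For a missing \<open>\<tau>\<close> of least cardinality all proper faces are present, and by the
  cone condition so are their joins with \<open>p\<close>; adding the pair is therefore the reverse
  of an elementary collapse. The induction counts the missing faces that avoid
  \<open>p\<close>.\<close>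

lemma sdr_attach_cone:
  assumes "simplicial_complex A" "finite \<Delta>" "p \<in> \<Delta>" "{p} \<in> A"
    and "\<And>\<tau>. \<tau> \<subseteq> \<Delta> \<Longrightarrow> \<tau> \<in> A \<Longrightarrow> insert p \<tau> \<in> A"
  shows "sdr (realization_set (A \<union> faces {\<Delta>})) (realization_set A)"
  using assms
proof (induction "card {\<tau>. \<tau> \<subseteq> \<Delta> - {p} \<and> \<tau> \<noteq> {} \<and> \<tau> \<notin> A}" arbitrary: A rule: less_induct)
  case less
  define N where "N = {\<tau>. \<tau> \<subseteq> \<Delta> - {p} \<and> \<tau> \<noteq> {} \<and> \<tau> \<notin> A}"
  have finN: "finite N" using less.prems(2) by (auto simp: N_def)
  show ?case
  proof (cases "N = {}")
    case True
    have "\<tau> \<in> A" if "\<tau> \<in> faces {\<Delta>}" for \<tau>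
    proof (cases "p \<in> \<tau>")
      case pt: True
      then have "\<tau> = insert p (\<tau> - {p})" by blast
      moreover have "insert p (\<tau> - {p}) \<in> A"
      proof (cases "\<tau> - {p} = {}")
        case False
        have sub: "\<tau> - {p} \<subseteq> \<Delta> - {p}" using that by (auto simp: faces_def)
        then have "\<tau> - {p} \<in> A" using True False unfolding N_def by blast
        then show ?thesis using less.prems(5) sub by blast
      next
        case True
        then have "insert p (\<tau> - {p}) = {p}" by simp
        then show ?thesis using less.prems(4) by (rule ssubst)
      qed
      ultimately show ?thesis by simp
    qed (use that True in \<open>auto simp: N_def faces_def\<close>)
    then have "A \<union> faces {\<Delta>} = A" by blast
    then show ?thesis by (simp add: sdr_refl)
  next
    case False
    then have "\<exists>\<tau>. \<tau> \<in> N \<and> (\<forall>\<rho>. \<rho> \<in> N \<longrightarrow> card \<tau> \<le> card \<rho>)"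
      using ex_has_least_nat[of "\<lambda>\<tau>. \<tau> \<in> N" _ card] by blast
    then obtain \<tau> where \<tau>: "\<tau> \<in> N" and min: "\<And>\<rho>. \<rho> \<in> N \<Longrightarrow> card \<tau> \<le> card \<rho>"
      by blast
    have ft: "finite \<tau>" "\<tau> \<noteq> {}" "p \<notin> \<tau>" "\<tau> \<notin> A" "\<tau> \<subseteq> \<Delta>"
      using \<tau> less.prems(2) finite_subset by (auto simp: N_def)
    have sub_in: "\<rho> \<in> A" if "\<rho> \<subset> \<tau>" "\<rho> \<noteq> {}" for \<rho>
    proof (rule ccontr)
      assume "\<rho> \<notin> A"
      then have "\<rho> \<in> N" using that \<tau> by (auto simp: N_def)
      then show False using min[of \<rho>] psubset_card_mono[OF ft(1) that(1)] by simp
    qed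
    have insp: "insert p \<rho> \<in> A" if "\<rho> \<subset> \<tau>" for \<rho>
      using sub_in[OF that] less.prems(4) less.prems(5)[of \<rho>] that ft(5) by (cases "\<rho> = {}") auto
    let ?A = "A \<union> {\<tau>, insert p \<tau>}"
    have "sdr (realization_set ?A) (realization_set A)"
    proof (rule sdr_elementary_collapse[OF less.prems(1) ft(1-4)])
      fix i assume "i \<in> \<tau>"
      then show "insert p \<tau> - {i} \<in> A"
        using insp[of "\<tau> - {i}"] ft(3) by (auto simp: insert_Diff_if)
    qed
    moreover have "sdr (realization_set (?A \<union> faces {\<Delta>})) (realization_set ?A)"
    proof (rule less.hyps)
      have "{\<tau>'. \<tau>' \<subseteq> \<Delta> - {p} \<and> \<tau>' \<noteq> {} \<and> \<tau>' \<notin> ?A} \<subset> N"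
        using \<tau> by (auto simp: N_def)
      then show "card {\<tau>'. \<tau>' \<subseteq> \<Delta> - {p} \<and> \<tau>' \<noteq> {} \<and> \<tau>' \<notin> ?A}
          < card {\<tau>. \<tau> \<subseteq> \<Delta> - {p} \<and> \<tau> \<noteq> {} \<and> \<tau> \<notin> A}"
        using finN unfolding N_def by (rule psubset_card_mono[rotated])
      show "simplicial_complex ?A"
        unfolding simplicial_complex_def
      proof (intro ballI conjI allI impI)
        fix \<sigma> \<rho> assume \<sigma>: "\<sigma> \<in> ?A" and \<rho>: "\<rho> \<subseteq> \<sigma> \<and> \<rho> \<noteq> {}"
        show "\<rho> \<in> ?A"
        proof (cases "\<sigma> \<in> A")
          case True then show ?thesis using \<rho> less.prems(1) unfolding simplicial_complex_def by blast
        next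
          case False
          then have sub: "\<rho> \<subseteq> insert p \<tau>" using \<sigma> \<rho> by auto
          show ?thesis
          proof (cases "p \<in> \<rho>")
            case True
            then have e: "\<rho> = insert p (\<rho> - {p})" by blast
            have "\<rho> - {p} \<subset> \<tau> \<or> \<rho> - {p} = \<tau>" using sub ft(3) by blast
            then show ?thesis using insp e by (metis UnCI insertCI)
          next
            case False
            then have "\<rho> \<subset> \<tau> \<or> \<rho> = \<tau>" using sub by blast
            then show ?thesis using sub_in \<rho> by blast
          qed
        qed
      qed (use less.prems(1) ft in \<open>auto simp: simplicial_complex_def\<close>)
      show "insert p \<rho> \<in> ?A" if "\<rho> \<subseteq> \<Delta>" "\<rho> \<in> ?A" for \<rho>
        using that less.prems(5) by auto
    qed (use less.prems in auto)
    moreover have "?A \<union> faces {\<Delta>} = A \<union> faces {\<Delta>}"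
      using ft less.prems(3) by (auto simp: faces_def)
    ultimately show ?thesis using sdr_trans by metis
  qed
qed

text \<open>The last condition forces two new facets to overlap inside \<open>A\<close>, even after
  joining the apex. Hence they do not interfere and can be attached one at a time in any
  order.\<close>

lemma sdr_attach_cones:
  assumes "finite F" "simplicial_complex A"
    and "\<And>\<Delta>. \<Delta> \<in> F \<Longrightarrow> finite \<Delta> \<and> (\<exists>p\<in>\<Delta>. {p} \<in> A \<and>
        (\<forall>\<tau>. \<tau> \<subseteq> \<Delta> \<and> \<tau> \<in> A \<longrightarrow> insert p \<tau> \<in> A) \<and>
        (\<forall>\<Delta>'\<in>F. \<Delta>' \<noteq> \<Delta> \<longrightarrow> insert p (\<Delta> \<inter> \<Delta>') \<in> A))"
  shows "sdr (realization_set (A \<union> faces F)) (realization_set A)"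
  using assms
proof (induction F rule: finite_induct)
  case empty
  then show ?case by (simp add: faces_def sdr_refl)
next
  case (insert \<Delta> F)
  obtain p where p: "finite \<Delta>" "p \<in> \<Delta>" "{p} \<in> A" "\<And>\<tau>. \<tau> \<subseteq> \<Delta> \<Longrightarrow> \<tau> \<in> A \<Longrightarrow> insert p \<tau> \<in> A"
    "\<And>\<Delta>'. \<Delta>' \<in> F \<Longrightarrow> insert p (\<Delta> \<inter> \<Delta>') \<in> A"
    using insert.prems(2)[OF insertI1] insert.hyps(2) by (metis insertI2)
  have "sdr (realization_set ((A \<union> faces F) \<union> faces {\<Delta>})) (realization_set (A \<union> faces F))"
  proof (rule sdr_attach_cone[OF _ p(1,2)])
    show "simplicial_complex (A \<union> faces F)"
      using insert.prems by (intro simplicial_complex_Un simplicial_complex_faces) auto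
    fix \<tau> assume \<tau>: "\<tau> \<subseteq> \<Delta>" "\<tau> \<in> A \<union> faces F"
    show "insert p \<tau> \<in> A \<union> faces F"
    proof (cases "\<tau> \<in> A")
      case False
      then obtain \<Delta>' where D: "\<Delta>' \<in> F" "\<tau> \<subseteq> \<Delta>'" using \<tau> by (auto simp: faces_def)
      then have "insert p \<tau> \<subseteq> insert p (\<Delta> \<inter> \<Delta>')" using \<tau> by blast
      then show ?thesis
        using p(5)[OF D(1)] insert.prems(1) unfolding simplicial_complex_def by blast
    qed (use p(4) \<tau> in auto)
  qed (use p in auto)
  moreover have "sdr (realization_set (A \<union> faces F)) (realization_set A)"
  proof (rule insert.IH[OF insert.prems(1)])
    fix \<Delta>' assume "\<Delta>' \<in> F"
    then show "finite \<Delta>' \<and> (\<exists>p\<in>\<Delta>'. {p} \<in> A \<and> (\<forall>\<tau>. \<tau> \<subseteq> \<Delta>' \<and> \<tau> \<in> A \<longrightarrow> insert p \<tau> \<in> A) \<and>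
        (\<forall>\<Delta>''\<in>F. \<Delta>'' \<noteq> \<Delta>' \<longrightarrow> insert p (\<Delta>' \<inter> \<Delta>'') \<in> A))"
      using insert.prems(2)[of \<Delta>'] by blast
  qed
  moreover have "A \<union> faces F \<union> faces {\<Delta>} = A \<union> faces (insert \<Delta> F)"
    by (auto simp: faces_def)
  ultimately show ?case using sdr_trans by metis
qed

text \<open>Each stage retracts onto the previous one by attaching cones, and the retractions are
  then run in a single unit of time. In \<open>shell\<close>, the case \<open>s < r\<close> provides
  the cone condition over earlier stages, and \<open>s = r\<close> the independence of facets within
  one stage.\<close>

theorem shelling_contraction:
  fixes G :: "nat \<Rightarrow> 'a set set"
  assumes G0: "G 0 = {{a}}" and finG: "\<And>r. finite (G r)"
    and fin: "\<And>r \<Delta>. \<Delta> \<in> G r \<Longrightarrow> finite \<Delta>"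
    and shell: "\<And>r \<Delta>. \<Delta> \<in> G r \<Longrightarrow> 0 < r \<Longrightarrow>
        \<exists>p\<in>\<Delta>. \<forall>s\<le>r. \<forall>\<Delta>'\<in>G s. \<Delta>' \<noteq> \<Delta> \<longrightarrow> (\<exists>s'<r. \<exists>\<Delta>''\<in>G s'. insert p (\<Delta> \<inter> \<Delta>') \<subseteq> \<Delta>'')"
  defines "T \<equiv> faces (\<Union>r. G r)"
  shows "\<exists>C b. continuous_map (prod_topology unit_interval (geom_realization T)) (geom_realization T) C \<and>
     (\<forall>x \<in> realization_set T. C (0, x) = x \<and> C (1, x) = b)"
proof -
  define S where "S = (\<lambda>r. faces (\<Union>s\<le>r. G s))"
  have S_Suc: "S (Suc r) = S r \<union> faces (G (Suc r))" for r
    by (auto simp: S_def atMost_Suc faces_Un)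
  have S_sc: "simplicial_complex (S r)" for r
    unfolding S_def using fin by (intro simplicial_complex_faces) auto
  have S_fin: "finite (S r)" for r
  proof (rule finite_subset)
    show "S r \<subseteq> Pow (\<Union>(\<Union>s\<le>r. G s))" by (auto simp: S_def faces_def)
    show "finite (Pow (\<Union>(\<Union>s\<le>r. G s)))" using finG fin by auto
  qed
  have S_T: "S r \<subseteq> T" for r by (auto simp: S_def T_def faces_def)
  have T_S: "\<exists>r. \<sigma> \<in> S r" if "\<sigma> \<in> T" for \<sigma>
    using that unfolding S_def T_def faces_def by blast
  have in_S: "\<tau> \<in> S r" if "\<exists>s'<Suc r. \<exists>\<Delta>''\<in>G s'. \<tau> \<subseteq> \<Delta>''" "\<tau> \<noteq> {}" for \<tau> r
    using that unfolding S_def faces_def less_Suc_eq_le by blast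
  have sdr_S: "sdr (realization_set (S (Suc r))) (realization_set (S r))" for r
    unfolding S_Suc
  proof (rule sdr_attach_cones[OF finG S_sc])
    fix \<Delta> assume \<Delta>: "\<Delta> \<in> G (Suc r)"
    have "\<exists>p\<in>\<Delta>. \<forall>s\<le>Suc r. \<forall>\<Delta>'\<in>G s. \<Delta>' \<noteq> \<Delta> \<longrightarrow>
        (\<exists>s'<Suc r. \<exists>\<Delta>''\<in>G s'. insert p (\<Delta> \<inter> \<Delta>') \<subseteq> \<Delta>'')"
      by (rule shell[OF \<Delta>]) simp
    then obtain p where p: "p \<in> \<Delta>" and shp: "\<And>s \<Delta>'. s \<le> Suc r \<Longrightarrow> \<Delta>' \<in> G s \<Longrightarrow> \<Delta>' \<noteq> \<Delta> \<Longrightarrow>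
        \<exists>s'<Suc r. \<exists>\<Delta>''\<in>G s'. insert p (\<Delta> \<inter> \<Delta>') \<subseteq> \<Delta>''"
      by metis
    have insS: "insert p (\<Delta> \<inter> \<Delta>') \<in> S r" if "s \<le> Suc r" "\<Delta>' \<in> G s" "\<Delta>' \<noteq> \<Delta>" for s \<Delta>'
      using shp[OF that] by (intro in_S) auto
    \<comment> \<open>Comparison with the base facet \<open>{a}\<close> places the apex in an
      earlier stage.\<close>
    have "{p} \<in> S r"
    proof (cases "\<Delta> = {a}")
      case True
      then show ?thesis using p G0 by (intro in_S) auto
    next
      case False
      then have "\<exists>s'<Suc r. \<exists>\<Delta>''\<in>G s'. insert p (\<Delta> \<inter> {a}) \<subseteq> \<Delta>''"
        using shp[of 0 "{a}"] G0 by auto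
      then show ?thesis by (intro in_S) auto
    qed
    moreover have "insert p \<tau> \<in> S r" if \<tau>: "\<tau> \<subseteq> \<Delta>" "\<tau> \<in> S r" for \<tau>
    proof -
      obtain s \<Delta>' where s: "s \<le> r" "\<Delta>' \<in> G s" "\<tau> \<subseteq> \<Delta>'"
        using \<tau>(2) by (auto simp: S_def faces_def)
      show ?thesis
      \<comment> \<open>\<open>shell\<close> is silent when the two facets are equal, but then
        \<open>\<Delta>\<close> occurred already at stage \<open>s\<close> and all its faces are
        present.\<close>
      proof (cases "\<Delta>' = \<Delta>")
        case True
        then show ?thesis using s p by (intro in_S) (auto simp: less_Suc_eq_le)
      next
        case False
        then have "insert p (\<Delta> \<inter> \<Delta>') \<in> S r" using insS[OF _ s(2)] s(1) by simp
        moreover have "insert p \<tau> \<subseteq> insert p (\<Delta> \<inter> \<Delta>')" using s \<tau> by blast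
        ultimately show ?thesis using S_sc[of r] unfolding simplicial_complex_def by blast
      qed
    qed
    ultimately show "finite \<Delta> \<and> (\<exists>p\<in>\<Delta>. {p} \<in> S r \<and> (\<forall>\<tau>. \<tau> \<subseteq> \<Delta> \<and> \<tau> \<in> S r \<longrightarrow> insert p \<tau> \<in> S r) \<and>
        (\<forall>\<Delta>'\<in>G (Suc r). \<Delta>' \<noteq> \<Delta> \<longrightarrow> insert p (\<Delta> \<inter> \<Delta>') \<in> S r))"
      using fin[OF \<Delta>] p insS[of "Suc r"] by blast
  qed
  define b where "b = (\<lambda>v. if v = a then 1 else 0 :: real)"
  have "S 0 = {{a}}" by (auto simp: S_def G0 faces_def)
  moreover have "geom_simplex {a} = {b}"
  proof
    show "geom_simplex {a} \<subseteq> {b}" by (auto simp: geom_simplex_def b_def)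
  qed (simp add: geom_simplex_def b_def)
  ultimately have S0: "realization_set (S 0) = {b}"
    by (simp add: realization_set_def)
  obtain C where C: "\<And>k. continuous_on ({0..1::real} \<times> realization_set (S k)) C"
    "\<And>k. C ` ({0..1::real} \<times> realization_set (S k)) \<subseteq> realization_set (S k)"
    "\<And>k x. x \<in> realization_set (S k) \<Longrightarrow> C (0::real, x) = x \<and> C (1, x) = b"
    using sdr_sequence_contraction[of "\<lambda>k. realization_set (S k)", OF sdr_S S0] by blast
  \<comment> \<open>Each simplex lies in a finite stage that the contraction never leaves, so
    continuity for the product topology there is enough.\<close>
  have "continuous_map (prod_topology unit_interval (geom_realization T)) (geom_realization T) C"
  proof (rule continuous_map_prod_geom_realization)
    fix \<sigma> assume "\<sigma> \<in> T"
    then obtain r where r: "\<sigma> \<in> S r" using T_S by blast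
    have sub: "{0..1::real} \<times> geom_simplex \<sigma> \<subseteq> {0..1::real} \<times> realization_set (S r)"
      using r by (auto simp: realization_set_def)
    have "continuous_map (top_of_set ({0..1::real} \<times> geom_simplex \<sigma>)) (top_of_set (realization_set (S r))) C"
      using continuous_on_subset[OF C(1) sub] subset_trans[OF image_mono[OF sub, of C] C(2)[of r]]
      unfolding continuous_map_subtopology_eu by (simp add: image_subset_iff_funcset)
    then have "continuous_map (top_of_set ({0..1::real} \<times> geom_simplex \<sigma>)) (geom_realization T) C"
      using continuous_map_compose[OF _ continuous_map_finite_into_realization[OF S_fin S_T], where f = C]
      unfolding o_def by blast
    then show "continuous_map (prod_topology unit_interval (top_of_set (geom_simplex \<sigma>))) (geom_realization T) C"
      by (simp add: prod_topology_unit_interval)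
  qed
  moreover have "C (0, x) = x \<and> C (1, x) = b" if "x \<in> realization_set T" for x
    using that T_S C(3) unfolding realization_set_def by blast
  ultimately show ?thesis by blast
qed

subsection \<open>Unit vectors and the Manhattan norm\<close>

definition l1 :: "int ^ 'n::finite \<Rightarrow> int" where
  "l1 x = (\<Sum>i\<in>UNIV. \<bar>x $ i\<bar>)"

definition units :: "(int ^ 'n::finite) set" where
  "units = {axis i s | i s. s = 1 \<or> s = -1}"

definition crd :: "int ^ 'n::finite \<Rightarrow> 'n" where
  "crd a = (SOME i. a $ i \<noteq> 0)"

lemma manhattan_l1: "manhattan x y = of_int (l1 (x - y))"
  by (simp add: manhattan_def l1_def)

lemma l1_minus_commute: "l1 (x - y) = l1 (y - x)"
  by (simp add: l1_def abs_minus_commute)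

lemma l1_uminus [simp]: "l1 (- x) = l1 x"
  by (simp add: l1_def)

lemma l1_nonneg: "0 \<le> l1 x"
  by (simp add: l1_def sum_nonneg)

lemma l1_eq_0_iff [simp]: "l1 x = 0 \<longleftrightarrow> x = 0"
  by (auto simp: l1_def sum_nonneg_eq_0_iff vec_eq_iff)

lemma axis_nth': "axis i s $ j = (if j = i then s else 0)"
  by (simp add: axis_def)

lemma l1_add_axis: "l1 (x + axis i s) = l1 x + \<bar>x $ i + s\<bar> - \<bar>x $ i\<bar>"
proof -
  have "l1 (x + axis i s) = \<bar>x $ i + s\<bar> + (\<Sum>j\<in>UNIV - {i}. \<bar>x $ j\<bar>)"
    unfolding l1_def by (subst sum.remove[of _ i]) (auto simp: axis_nth' intro!: sum.cong)
  moreover have "l1 x = \<bar>x $ i\<bar> + (\<Sum>j\<in>UNIV - {i}. \<bar>x $ j\<bar>)"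
    unfolding l1_def by (subst sum.remove[of _ i]) auto
  ultimately show ?thesis by simp
qed

lemma l1_zero [simp]: "l1 0 = 0"
  by simp

lemma l1_axis: "l1 (axis i s) = \<bar>s\<bar>"
  using l1_add_axis[of 0 i s] by simp

lemma units_axis: "a \<in> units \<Longrightarrow> \<exists>i s. a = axis i s \<and> (s = 1 \<or> s = -1)"
  by (auto simp: units_def)

lemma crd_axis: "s \<noteq> 0 \<Longrightarrow> crd (axis i s) = i"
  unfolding crd_def by (rule some_equality) (auto simp: axis_nth' split: if_splits)

lemma units_crd: "a \<in> units \<Longrightarrow> \<exists>s. a = axis (crd a) s \<and> (s = 1 \<or> s = -1)"
  by (auto simp: units_def crd_axis)

lemma uminus_axis: "- axis i s = axis i (- s :: int)"
  by (simp add: vec_eq_iff axis_nth')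

lemma axis_eq_axis_int: "axis i s = axis j (t::int) \<longleftrightarrow> i = j \<and> s = t \<or> s = 0 \<and> t = 0"
  by (auto simp: vec_eq_iff axis_nth' split: if_splits)

lemma uminus_units [simp]: "- a \<in> units \<longleftrightarrow> a \<in> units"
proof -
  have "- a \<in> units" if "a \<in> units" for a :: "int ^ 'n::finite"
    using that by (fastforce simp: units_def uminus_axis)
  from this[of a] this[of "- a"] show ?thesis by auto
qed

lemma l1_units: "a \<in> units \<Longrightarrow> l1 a = 1"
  by (auto simp: units_def l1_axis)

lemma zero_not_unit [simp]: "0 \<notin> units"
  using l1_units by fastforce

lemma crd_uminus [simp]: "a \<in> units \<Longrightarrow> crd (- a) = crd a"
  by (auto simp: units_def uminus_axis crd_axis)

lemma crd_eq_iff: "a \<in> units \<Longrightarrow> b \<in> units \<Longrightarrow> crd a = crd b \<longleftrightarrow> a = b \<or> a = - b"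
  by (auto simp: units_def uminus_axis crd_axis axis_eq_axis_int)

lemma l1_units2:
  assumes "a \<in> units" "b \<in> units" "a \<noteq> - b"
  shows "l1 (a + b) = 2"
proof -
  obtain i s j t where "a = axis i s" "b = axis j t" "s = 1 \<or> s = -1" "t = 1 \<or> t = -1"
    using units_axis assms(1,2) by metis
  then show ?thesis
    using assms(3) by (auto simp: l1_add_axis l1_axis axis_nth' uminus_axis axis_eq_axis_int)
qed

lemma l1_add_unit:
  assumes "d \<in> units" "\<And>i. 0 \<le> x $ i * d $ i"
  shows "l1 (x + d) = l1 x + 1"
proof -
  obtain i w where d: "d = axis i w" "w = 1 \<or> w = -1"
    using units_axis assms(1) by metis
  have "0 \<le> x $ i * w" using assms(2)[of i] d(1) by (simp add: axis_nth')
  then have "\<bar>x $ i + w\<bar> - \<bar>x $ i\<bar> = 1" using d(2) by auto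
  then show ?thesis using l1_add_axis[of x i w] d(1) by simp
qed

lemma units_same_sign:
  assumes "a \<in> units" "d \<in> units" "a \<noteq> - d"
  shows "0 \<le> a $ i * d $ i"
proof -
  obtain j s k t where "a = axis j s" "d = axis k t" "s = 1 \<or> s = -1" "t = 1 \<or> t = -1"
    using units_axis assms(1,2) by metis
  then show ?thesis
    using assms(3) by (auto simp: axis_nth' uminus_axis axis_eq_axis_int)
qed

text \<open>Units no two of which are opposite cannot cancel, so the norm counts them. Read
  backwards, a sum of units that is too short contains an opposite pair; most distance arguments
  below have this form.\<close>

lemma l1_units3:
  assumes "a \<in> units" "b \<in> units" "c \<in> units" "a \<noteq> - b" "a \<noteq> - c" "b \<noteq> - c"
  shows "l1 (a + b + c) = 3"
  using l1_add_unit[OF assms(3), of "a + b"] l1_units2[OF assms(1,2,4)]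
    units_same_sign[OF assms(1,3,5)] units_same_sign[OF assms(2,3,6)]
  by (simp add: distrib_right)

lemma l1_units4:
  assumes "a \<in> units" "b \<in> units" "c \<in> units" "d \<in> units"
    and "a \<noteq> - b" "a \<noteq> - c" "b \<noteq> - c" "a \<noteq> - d" "b \<noteq> - d" "c \<noteq> - d"
  shows "l1 (a + b + c + d) = 4"
  using l1_add_unit[OF assms(4), of "a + b + c"] l1_units3[OF assms(1-3,5-7)]
    units_same_sign[OF assms(1,4,8)] units_same_sign[OF assms(2,4,9)] units_same_sign[OF assms(3,4,10)]
  by (simp add: distrib_right)

lemma l1_le_1: "l1 x \<le> 1 \<longleftrightarrow> x = 0 \<or> x \<in> units"
proof
  assume le: "l1 x \<le> 1"
  show "x = 0 \<or> x \<in> units"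
  proof (rule disjCI)
    assume "x \<notin> units"
    show "x = 0"
    proof (rule ccontr)
      assume "x \<noteq> 0"
      then obtain i where i: "x $ i \<noteq> 0" by (auto simp: vec_eq_iff)
      have "l1 (x + axis i (- sgn (x $ i))) = l1 x - 1"
        using i by (simp add: l1_add_axis sgn_if split: if_splits)
      then have "x + axis i (- sgn (x $ i)) = 0"
        using le l1_nonneg[of "x + axis i (- sgn (x $ i))"] by (metis diff_le_0_iff_le order_antisym l1_eq_0_iff)
      then have "x = axis i (sgn (x $ i))"
        by (metis add_eq_0_iff uminus_axis minus_minus)
      moreover have "sgn (x $ i) = 1 \<or> sgn (x $ i) = -1" using i by (simp add: sgn_if)
      ultimately show False using \<open>x \<notin> units\<close> unfolding units_def by blast
    qed
  qed
qed (auto simp: l1_units)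

lemma l1_eq_2:
  assumes "l1 x = 2"
  shows "\<exists>a\<in>units. \<exists>b\<in>units. x = a + b \<and> a \<noteq> - b"
proof -
  have "x \<noteq> 0" using assms by auto
  then obtain i where i: "x $ i \<noteq> 0" by (auto simp: vec_eq_iff)
  let ?a = "axis i (sgn (x $ i))"
  have a: "?a \<in> units" using i by (auto simp: units_def sgn_if)
  have "l1 (x + - ?a) = 1"
    using i assms by (simp add: l1_add_axis uminus_axis sgn_if split: if_splits)
  then have "x - ?a \<in> units" using l1_le_1[of "x - ?a"] by auto
  moreover have "x = ?a + (x - ?a)" by simp
  moreover have "?a \<noteq> - (x - ?a)" using assms \<open>x \<noteq> 0\<close> by auto
  ultimately show ?thesis using a by blast
qed

section \<open>Closed unit balls and their intersections\<close>

definition nbh :: "int ^ 'n::finite \<Rightarrow> (int ^ 'n) set" where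
  "nbh w = {x. l1 (x - w) \<le> 1}"

lemma nbh_iff: "x \<in> nbh w \<longleftrightarrow> x = w \<or> (\<exists>a\<in>units. x = w + a)"
proof -
  have "x \<in> nbh w \<longleftrightarrow> x - w = 0 \<or> x - w \<in> units" by (simp add: nbh_def l1_le_1)
  also have "\<dots> \<longleftrightarrow> x = w \<or> (\<exists>a\<in>units. x = w + a)"
    by (metis add_diff_cancel_left' diff_add_cancel add.commute eq_iff_diff_eq_0)
  finally show ?thesis .
qed

lemma nbh_sym: "x \<in> nbh w \<longleftrightarrow> w \<in> nbh x"
  by (simp add: nbh_def l1_minus_commute)

lemma nbh_add [simp]: "v + x \<in> nbh (v + y) \<longleftrightarrow> l1 (x - y) \<le> 1"
  by (simp add: nbh_def)

lemma nbh_add0 [simp]: "v + x \<in> nbh v \<longleftrightarrow> l1 x \<le> 1" "v \<in> nbh (v + x) \<longleftrightarrow> l1 x \<le> 1" "v \<in> nbh v"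
  by (simp_all add: nbh_def)

lemma l1_triangle: "l1 (x + y) \<le> l1 x + l1 y"
  by (simp add: l1_def abs_triangle_ineq sum_mono flip: sum.distrib)

lemma nbh_diam: "x \<in> nbh w \<Longrightarrow> y \<in> nbh w \<Longrightarrow> l1 (x - y) \<le> 2"
  using l1_triangle[of "x - w" "w - y"] by (simp add: nbh_def l1_minus_commute[of w y])

text \<open>The four units in \<open>a + b - a' - b'\<close> sum to 0 instead of having norm 4, so
  two of them cancel, and then the other two cancel as well.\<close>

lemma units_add_unique:
  assumes "a \<in> units" "b \<in> units" "a' \<in> units" "b' \<in> units" "a \<noteq> - b" "a + b = a' + b'"
  shows "a = a' \<and> b = b' \<or> a = b' \<and> b = a'"
proof -
  have "l1 (a + b + (- a') + (- b')) = 0" using assms(6) by simp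
  then have "a = a' \<or> b = a' \<or> a = b' \<or> b = b' \<or> - a' = b'"
    using l1_units4[of a b "- a'" "- b'"] assms(1-5) by auto
  moreover have "a' + b' \<noteq> 0" using assms(5,6) by (metis eq_neg_iff_add_eq_0)
  ultimately show ?thesis using assms(6) by auto
qed

lemma nbh_inter0:
  assumes "x \<in> nbh v" "x \<in> nbh (v + b)" "b \<in> units"
  shows "x = v \<or> x = v + b"
proof -
  have "l1 (a - b) \<le> 1 \<longrightarrow> a = b" if "a \<in> units" for a
    using l1_units2[of a "- b"] that assms(3) by (cases "a = b") auto
  then show ?thesis using assms by (auto simp: nbh_iff[of x v])
qed

text \<open>If \<open>v + a + a'\<close> is within distance 1 of \<open>v + b\<close>, then
  \<open>a + a' - b\<close> must contain a cancellation: \<open>a'\<close> is \<open>- a\<close> or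
  \<open>b\<close>.\<close>

lemma nbh_inter:
  assumes "x \<in> nbh (v + a)" "x \<in> nbh (v + b)" "a \<in> units" "b \<in> units" "a \<noteq> b"
  shows "x = v \<or> x = v + a + b"
proof -
  have ab: "l1 (a - b) = 2" "l1 (b - a) = 2"
    using l1_units2[of a "- b"] l1_units2[of b "- a"] assms by auto
  consider "x = v + a" | a' where "a' \<in> units" "x = v + a + a'"
    using assms(1) by (auto simp: nbh_iff)
  then show ?thesis
  proof cases
    case 1
    then show ?thesis using assms(2) ab by simp
  next
    case 2
    then have le: "l1 (a + a' + (- b)) \<le> 1" using assms(2) by (simp add: add.assoc)
    have "a = - a' \<or> a = b \<or> a' = b"
      using l1_units3[of a a' "- b"] 2 assms(3,4) le by auto
    then show ?thesis using 2 assms(5) by auto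
  qed
qed

subsection \<open>A height function on the lattice\<close>

text \<open>Powers of two along an enumeration of the coordinates: a factor 2 between distinct
  weights cannot be made up by steps of size 2 and 3.\<close>

definition wt :: "'n::finite \<Rightarrow> int" where
  "wt i = 2 ^ to_nat i"

text \<open>Orders the integers as 0, 1, -1, 2, -2, ...; the gaps between neighbours are 2 or 3, so
  a coordinate of larger weight dominates.\<close>

definition zeta :: "int \<Rightarrow> int" where
  "zeta x = (if x < 0 then 1 - 2 * x else 2 * x)"

definition height :: "int ^ 'n::finite \<Rightarrow> int" where
  "height v = (\<Sum>i\<in>UNIV. wt i * zeta (v $ i))"

definition stp :: "int ^ 'n::finite \<Rightarrow> int ^ 'n \<Rightarrow> int" where
  "stp v a = zeta (v $ crd a + a $ crd a) - zeta (v $ crd a)"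

definition down :: "int ^ 'n::finite \<Rightarrow> (int ^ 'n) set" where
  "down v = {a \<in> units. height (v + a) < height v}"

abbreviation W :: "int ^ 'n::finite \<Rightarrow> int" where
  "W a \<equiv> wt (crd a)"

lemma wt_pos: "0 < wt i"
  by (simp add: wt_def)

lemma wt_less_imp: 
  assumes "wt i < wt j" shows "2 * wt i \<le> wt j"
proof -
  have "to_nat i < to_nat j"
    using assms by (simp add: wt_def)
  then have "Suc (to_nat i) \<le> to_nat j" by simp
  then have "(2::int) ^ Suc (to_nat i) \<le> 2 ^ to_nat j" by (intro power_increasing) auto
  then show ?thesis by (simp add: wt_def)
qed

lemma wt_eq_iff [simp]: "wt i = wt j \<longleftrightarrow> i = j"
  by (simp add: wt_def)

lemma zeta_nonneg: "0 \<le> zeta x"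
  by (simp add: zeta_def)

lemma zeta_inj: "zeta x = zeta y \<Longrightarrow> x = y"
  by (simp add: zeta_def split: if_splits) presburger+

lemma height_nonneg: "0 \<le> height v"
  unfolding height_def by (intro sum_nonneg mult_nonneg_nonneg zeta_nonneg) (simp add: less_imp_le wt_pos)

lemma height_eq_0_iff: "height v = 0 \<longleftrightarrow> v = 0"
proof -
  have "height v = 0 \<longleftrightarrow> (\<forall>i. wt i * zeta (v $ i) = 0)"
    unfolding height_def
    by (subst sum_nonneg_eq_0_iff) (auto intro!: mult_nonneg_nonneg zeta_nonneg simp: less_imp_le wt_pos)
  also have "\<dots> \<longleftrightarrow> v = 0"
  proof -
    have "wt i \<noteq> 0" for i :: 'a using wt_pos[of i] by linarith
    then show ?thesis by (auto simp: vec_eq_iff zeta_def split: if_splits)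
  qed
  finally show ?thesis .
qed

lemma finite_height_le: "finite {v :: int ^ 'n::finite. height v \<le> N}"
proof (rule finite_subset)
  let ?B = "Pi\<^sub>E (UNIV :: 'n set) (\<lambda>_. {-N..N})"
  show "{v :: int ^ 'n. height v \<le> N} \<subseteq> vec_lambda ` ?B"
  proof
    fix v :: "int ^ 'n" assume v: "v \<in> {v. height v \<le> N}"
    have "v $ i \<in> {-N..N}" for i
    proof -
      have "wt i * zeta (v $ i) \<le> height v"
        unfolding height_def by (rule member_le_sum) (auto intro!: mult_nonneg_nonneg zeta_nonneg simp: less_imp_le wt_pos)
      moreover have "1 * zeta (v $ i) \<le> wt i * zeta (v $ i)"
        using wt_pos[of i] by (intro mult_right_mono zeta_nonneg) linarith
      ultimately have "zeta (v $ i) \<le> N" using v by simp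
      then show ?thesis by (auto simp: zeta_def split: if_splits)
    qed
    then have "vec_nth v \<in> ?B" by auto
    moreover have "v = vec_lambda (vec_nth v)" by simp
    ultimately show "v \<in> vec_lambda ` ?B" by blast
  qed
  show "finite (vec_lambda ` ?B)" by (intro finite_imageI finite_PiE) auto
qed

lemma height_add_axis: "height (v + axis i s) = height v + wt i * (zeta (v $ i + s) - zeta (v $ i))"
proof -
  have "height (v + axis i s) = wt i * zeta (v $ i + s) + (\<Sum>j\<in>UNIV - {i}. wt j * zeta (v $ j))"
    unfolding height_def by (subst sum.remove[of _ i]) (auto simp: axis_nth' intro!: sum.cong)
  moreover have "height v = wt i * zeta (v $ i) + (\<Sum>j\<in>UNIV - {i}. wt j * zeta (v $ j))"
    unfolding height_def by (subst sum.remove[of _ i]) auto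
  ultimately show ?thesis by (simp add: algebra_simps)
qed

lemma units_decomp:
  assumes "a \<in> units" shows "a = axis (crd a) (a $ crd a)" "a $ crd a = 1 \<or> a $ crd a = -1"
  using units_crd[OF assms] by (metis axis_nth')+

lemma height_add: "a \<in> units \<Longrightarrow> height (v + a) = height v + W a * stp v a"
  using height_add_axis[of v "crd a" "a $ crd a"] units_decomp(1)[of a] by (simp add: stp_def)

lemma stp_cases: "a \<in> units \<Longrightarrow> stp v a \<in> {2, 3, -2, -3}"
  using units_decomp(2)[of a] by (auto simp: stp_def zeta_def)

lemma stp_add: "b \<in> units \<Longrightarrow> crd a \<noteq> crd b \<Longrightarrow> stp (v + b) a = stp v a"
  using units_decomp(1)[of b] axis_nth'[of "crd b" "b $ crd b" "crd a"] by (simp add: stp_def)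

lemma height_add2:
  "a \<in> units \<Longrightarrow> b \<in> units \<Longrightarrow> crd a \<noteq> crd b \<Longrightarrow> height (v + a + b) = height v + W a * stp v a + W b * stp v b"
  by (simp add: height_add stp_add)

lemma down_units: "a \<in> down v \<Longrightarrow> a \<in> units"
  by (simp add: down_def)

lemma down_iff: "a \<in> units \<Longrightarrow> a \<in> down v \<longleftrightarrow> stp v a < 0"
  using wt_pos[of "crd a"] by (auto simp: down_def height_add mult_less_0_iff)

lemma down_height: "a \<in> down v \<Longrightarrow> height (v + a) < height v"
  by (simp add: down_def)

lemma height_add_neq: "a \<in> units \<Longrightarrow> height (v + a) \<noteq> height v"
  using stp_cases[of a v] wt_pos[of "crd a"] by (auto simp: height_add)

text \<open>The step along \<open>a\<close> changes the height by at least \<open>2 * W a\<close>,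
  hence by at least \<open>4 * W b\<close>, while the step along \<open>b\<close> changes it by at
  most \<open>3 * W b\<close>.\<close>

lemma height_add2_less_iff:
  assumes "a \<in> units" "b \<in> units" "W b < W a"
  shows "height (v + a + b) < height v \<longleftrightarrow> a \<in> down v" "height (v + a + b) \<noteq> height v"
proof -
  have ne: "crd a \<noteq> crd b" using assms(3) by auto
  have "2 * W b \<le> W a" "0 < W b" using wt_less_imp[OF assms(3)] wt_pos by auto
  then show "height (v + a + b) < height v \<longleftrightarrow> a \<in> down v" "height (v + a + b) \<noteq> height v"
    using stp_cases[OF assms(1), of v] stp_cases[OF assms(2), of v]
    unfolding height_add2[OF assms(1,2) ne] down_iff[OF assms(1)] by auto
qed

lemma down_opposite: "a \<in> down v \<Longrightarrow> - a \<notin> down v"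
  using units_decomp(2)[OF down_units, of a v] down_units[of a v] down_iff[of a v] down_iff[of "- a" v]
  by (auto simp: stp_def zeta_def split: if_splits)

lemma height_add_twice_neq: "a \<in> units \<Longrightarrow> height (v + a + a) \<noteq> height v"
proof -
  assume a: "a \<in> units"
  have "a + a = axis (crd a) (2 * a $ crd a)"
    by (subst (1 2) units_decomp(1)[OF a]) (simp add: vec_eq_iff axis_nth')
  then have "height (v + a + a) = height v + W a * (zeta (v $ crd a + 2 * a $ crd a) - zeta (v $ crd a))"
    using height_add_axis[of v "crd a" "2 * a $ crd a"] by (simp add: add.assoc)
  moreover have "zeta (v $ crd a + 2 * a $ crd a) \<noteq> zeta (v $ crd a)"
    using zeta_inj units_decomp(2)[OF a] by fastforce
  moreover have "W a \<noteq> 0" using wt_pos[of "crd a"] by linarith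
  ultimately show ?thesis by simp
qed

text \<open>\<open>zeta\<close> has its only valley at 0, so a step that climbs keeps climbing in
  the same direction.\<close>

lemma up_twice: "a \<in> units \<Longrightarrow> a \<notin> down v \<Longrightarrow> a \<notin> down (v + a)"
  using units_decomp(2)[of a] by (auto simp: down_iff stp_def zeta_def split: if_splits)

lemma down_crd_neq: "a \<in> down v \<Longrightarrow> b \<in> down v \<Longrightarrow> a \<noteq> b \<Longrightarrow> crd a \<noteq> crd b"
  using crd_eq_iff[of a b] down_opposite down_units by blast

lemma down_not_opposite: "a \<in> down v \<Longrightarrow> b \<in> down v \<Longrightarrow> a \<noteq> - b"
  using down_opposite by blast

lemma down_nonempty: "v \<noteq> 0 \<Longrightarrow> down v \<noteq> {}"
proof -
  assume "v \<noteq> 0"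
  then obtain i where i: "v $ i \<noteq> 0" by (auto simp: vec_eq_iff)
  let ?a = "axis i (- sgn (v $ i))"
  have a: "?a \<in> units" using i by (auto simp: units_def sgn_if)
  moreover have "stp v ?a < 0"
    using i by (auto simp: stp_def crd_axis axis_nth' zeta_def sgn_if)
  ultimately show ?thesis using down_iff by blast
qed

lemma finite_down: "finite (down v)"
  by (rule finite_subset[OF _ finite_imageI[OF finite_height_le[of "height v"], of "\<lambda>x. x - v"]])
    (force simp: down_def image_iff intro: exI[of _ "v + _"])

text \<open>This gives every simplex of diameter at most 2 a unique highest vertex. A double step
  along one axis is handled by injectivity of \<open>zeta\<close>, a pair of perpendicular steps by
  dominance of the heavier coordinate.\<close>

lemma height_neq_of_close:
  assumes "x \<noteq> y" "l1 (x - y) \<le> 2" shows "height x \<noteq> height y"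
proof -
  have "x - y \<noteq> 0" using assms(1) by simp
  then have "l1 (x - y) = 1 \<or> l1 (x - y) = 2"
    using assms(2) l1_nonneg[of "x - y"] l1_eq_0_iff[of "x - y"] by linarith
  then show ?thesis
  proof
    assume "l1 (x - y) = 1"
    then have "x - y \<in> units" using l1_le_1[of "x - y"] \<open>x - y \<noteq> 0\<close> by simp
    then show ?thesis using height_add_neq[of "x - y" y] by simp
  next
    assume "l1 (x - y) = 2"
    then obtain a b where ab: "a \<in> units" "b \<in> units" "x - y = a + b" "a \<noteq> - b"
      using l1_eq_2 by blast
    have x: "x = y + a + b" "x = y + b + a" using ab(3) by (simp_all add: algebra_simps)
    consider "a = b" | "W b < W a" | "W a < W b"
      using crd_eq_iff[OF ab(1,2)] ab(4) wt_eq_iff[of "crd a" "crd b"] by linarith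
    then show ?thesis
    proof cases
      case 1 then show ?thesis using height_add_twice_neq[OF ab(1), of y] x by simp
    next
      case 2 then show ?thesis using height_add2_less_iff(2)[OF ab(1,2), of y] x(1) by simp
    next
      case 3 then show ?thesis using height_add2_less_iff(2)[OF ab(2,1), of y] x(2) by simp
    qed
  qed
qed

subsection \<open>The facets of the contractible subcomplex\<close>

text \<open>When \<open>v\<close> lies in the unit ball around \<open>w\<close>, this is the largest
  simplex of that ball with highest vertex \<open>v\<close>.\<close>

definition lower_nbh :: "int ^ 'n::finite \<Rightarrow> int ^ 'n \<Rightarrow> (int ^ 'n) set" where
  "lower_nbh v w = {x \<in> nbh w. x = v \<or> height x < height v}"

text \<open>Junk value when \<open>down v\<close> is empty, that is, for \<open>v = 0\<close>.\<close>

definition lead :: "int ^ 'n::finite \<Rightarrow> int ^ 'n" where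
  "lead v = (SOME a. a \<in> down v \<and> (\<forall>b\<in>down v. W b \<le> W a))"

text \<open>Vertices are bracketed as \<open>v + (a + b)\<close> so that the simplification rules
  for \<open>nbh\<close> can cancel the common summand \<open>v\<close>.\<close>

definition sq :: "int ^ 'n::finite \<Rightarrow> int ^ 'n \<Rightarrow> int ^ 'n \<Rightarrow> (int ^ 'n) set" where
  "sq v a b = {v, v + a, v + b, v + (a + b)}"

text \<open>Every second corner of the cube spanned at \<open>v\<close> by \<open>lead v\<close>,
  \<open>a\<close> and \<open>u\<close>. For ascending \<open>u\<close> the outer corner of that
  cube is \<open>v + u\<close>, which this tetrahedron avoids.\<close>

definition tet :: "int ^ 'n::finite \<Rightarrow> int ^ 'n \<Rightarrow> int ^ 'n \<Rightarrow> (int ^ 'n) set" where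
  "tet v a u = {v, v + (lead v + a), v + (lead v + u), v + (a + u)}"

text \<open>The five kinds are numbered in the order in which facets with the same top
  \<open>v\<close> are attached; each kind has its cone condition satisfied by smaller kinds. All
  indices above 4 repeat kind 4, hence the bounds \<open>s \<le> 4\<close> later on.\<close>

definition facets :: "nat \<Rightarrow> int ^ 'n::finite \<Rightarrow> (int ^ 'n) set set" where
  "facets s v =
    (if s = 0 then {lower_nbh v v}
     else if s = 1 then {sq v a b | a b. a \<in> down v \<and> b \<in> down v \<and> a \<noteq> b}
     else if s = 2 then {lower_nbh v (v + a) | a. a \<in> down v}
     else if s = 3 then {tet v a u | a u. a \<in> down v \<and> a \<noteq> lead v \<and> u \<in> units \<and> u \<notin> down v \<and> W u < W a}
     else {lower_nbh v (v + u) | u. u \<in> units \<and> u \<notin> down v})"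

lemma lead:
  assumes "down v \<noteq> {}" shows "lead v \<in> down v" "\<And>b. b \<in> down v \<Longrightarrow> W b \<le> W (lead v)"
proof -
  have "Max (W ` down v) \<in> W ` down v" using finite_down assms by (intro Max_in) auto
  then obtain a where a: "a \<in> down v" "W a = Max (W ` down v)" by auto
  then have "a \<in> down v \<and> (\<forall>b\<in>down v. W b \<le> W a)"
    using Max_ge[OF finite_imageI[OF finite_down]] by (metis imageI)
  then have "\<exists>a. a \<in> down v \<and> (\<forall>b\<in>down v. W b \<le> W a)" by blast
  then have "lead v \<in> down v \<and> (\<forall>b\<in>down v. W b \<le> W (lead v))"
    unfolding lead_def by (rule someI_ex)
  then show "lead v \<in> down v" "\<And>b. b \<in> down v \<Longrightarrow> W b \<le> W (lead v)" by blast+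
qed

lemma lead_greater: "a \<in> down v \<Longrightarrow> a \<noteq> lead v \<Longrightarrow> W a < W (lead v)"
  using lead[of v] down_crd_neq[of a v "lead v"] wt_eq_iff[of "crd a" "crd (lead v)"]
  by (metis empty_iff order_le_imp_less_or_eq)

lemma lower_add_down:
  assumes "a \<in> down v" "b \<in> down v" "a \<noteq> b" shows "height (v + (a + b)) < height v"
proof -
  have "height (v + a + b) = height v + W a * stp v a + W b * stp v b"
    using height_add2[OF down_units[OF assms(1)] down_units[OF assms(2)] down_crd_neq[OF assms]] .
  moreover have "W a * stp v a < 0" "W b * stp v b < 0"
    using assms(1,2) down_iff[OF down_units] wt_pos by (auto intro!: mult_pos_neg)
  ultimately show ?thesis by (simp add: add.assoc)
qed

lemma lower_add_up:
  assumes "a \<in> down v" "u \<in> units" "W u < W a" shows "height (v + (a + u)) < height v"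
  using height_add2_less_iff(1)[of a u v] assms down_units by (auto simp: add.assoc)

lemma mem_lower_nbh_up:
  assumes "u \<in> units" "u \<notin> down v" "x \<in> lower_nbh v (v + u)" "x \<noteq> v"
  shows "\<exists>b\<in>down v. x = v + (b + u) \<and> W u < W b"
proof -
  have x: "x \<in> nbh (v + u)" "height x < height v" using assms(3,4) by (auto simp: lower_nbh_def)
  have "x \<noteq> v + u" using x(2) assms(1,2) by (auto simp: down_def)
  then obtain b where b: "b \<in> units" "x = v + u + b" using x(1) by (auto simp: nbh_iff)
  have "height v < height (v + u)"
    using assms(1,2) height_add_neq[of u v] by (simp add: down_def)
  then have "b \<in> down (v + u)" using b x(2) by (simp add: down_def)
  then have "b \<noteq> u" using up_twice[OF assms(1,2)] by blast
  moreover have "b \<noteq> - u" using assms(4) b(2) by auto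
  ultimately have "W u < W b \<or> W b < W u"
    using crd_eq_iff[OF b(1) assms(1)] wt_eq_iff[of "crd b" "crd u"] by linarith
  moreover have "\<not> W b < W u"
    using height_add2_less_iff(1)[OF assms(1) b(1), of v] x(2) b(2) assms(2) by auto
  ultimately have Wb: "W u < W b" by blast
  moreover have "x = v + (b + u)" using b(2) by (simp add: algebra_simps)
  moreover have "b \<in> down v"
    using height_add2_less_iff(1)[OF b(1) assms(1) Wb, of v] x(2) b(2) by (simp add: algebra_simps)
  ultimately show ?thesis by blast
qed

lemma facet_cases:
  assumes "\<Delta> \<in> facets s v"
  obtains (nbh) w where "w = v \<or> (\<exists>a\<in>units. w = v + a)" "\<Delta> = lower_nbh v w"
    | (sq) a b where "a \<in> down v" "b \<in> down v" "a \<noteq> b" "\<Delta> = sq v a b"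
    | (tet) a u where "a \<in> down v" "a \<noteq> lead v" "u \<in> units" "W u < W a" "\<Delta> = tet v a u"
proof -
  have "(\<exists>w. (w = v \<or> (\<exists>a\<in>units. w = v + a)) \<and> \<Delta> = lower_nbh v w) \<or>
      (\<exists>a b. a \<in> down v \<and> b \<in> down v \<and> a \<noteq> b \<and> \<Delta> = sq v a b) \<or>
      (\<exists>a u. a \<in> down v \<and> a \<noteq> lead v \<and> u \<in> units \<and> W u < W a \<and> \<Delta> = tet v a u)"
    using assms down_units unfolding facets_def by (simp split: if_splits) blast+
  then show ?thesis using nbh sq tet by blast
qed

lemma facet_top:
  assumes "\<Delta> \<in> facets s v"
  shows "v \<in> \<Delta>" "\<And>x. x \<in> \<Delta> \<Longrightarrow> x \<noteq> v \<Longrightarrow> height x < height v"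
proof -
  show "v \<in> \<Delta>"
    using assms by (cases rule: facet_cases) (auto simp: sq_def tet_def lower_nbh_def l1_units)
  fix x assume x: "x \<in> \<Delta>" "x \<noteq> v"
  show "height x < height v"
    using assms
  proof (cases rule: facet_cases)
    case (nbh w) then show ?thesis using x by (auto simp: lower_nbh_def)
  next
    case (sq a b) then show ?thesis using x lower_add_down[of a v b] down_height by (auto simp: sq_def)
  next
    case (tet a u)
    then have "lead v \<in> down v" using lead by blast
    then show ?thesis
      using tet x lower_add_down[of "lead v" v a] lower_add_up[of _ v u] lead_greater[of a v]
      by (auto simp: tet_def)
  qed
qed

lemma facet_finite: "\<Delta> \<in> facets s v \<Longrightarrow> finite \<Delta>"
  using facet_top(2) by (intro finite_subset[OF _ finite_height_le[of "height v"]]) fastforce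

text \<open>With \<open>v\<close> the highest vertex of \<open>X\<close>, the centre
  \<open>w\<close> is \<open>v\<close> or a neighbour of \<open>v\<close>, descending or ascending;
  these are the kinds 0, 2 and 4.\<close>

lemma nbh_subset_facet:
  assumes "X \<subseteq> nbh w" "X \<noteq> {}" "finite X"
  shows "\<exists>v\<in>X. \<exists>s\<le>4. \<exists>\<Delta>\<in>facets s v. X \<subseteq> \<Delta>"
proof -
  have "Max (height ` X) \<in> height ` X" using assms by (intro Max_in) auto
  then obtain v where v: "v \<in> X" "height v = Max (height ` X)" by auto
  have "height x < height v" if "x \<in> X" "x \<noteq> v" for x
  proof -
    have "height x \<le> height v" using v(2) assms(3) that(1) by simp
    moreover have "l1 (x - v) \<le> 2" using nbh_diam assms(1) that v by blast
    ultimately show ?thesis using height_neq_of_close[OF that(2)] by simp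
  qed
  then have sub: "X \<subseteq> lower_nbh v w" using assms(1) by (auto simp: lower_nbh_def)
  have "w \<in> nbh v" using v assms(1) nbh_sym by blast
  then consider "w = v" | a where "a \<in> units" "w = v + a" by (auto simp: nbh_iff)
  then have "\<exists>s\<le>4. lower_nbh v w \<in> facets s v"
  proof cases
    case 1 then show ?thesis by (intro exI[of _ 0]) (simp add: facets_def)
  next
    case 2
    then show ?thesis
      by (cases "a \<in> down v") (auto simp: facets_def intro: exI[of _ 2] exI[of _ 4])
  qed
  then show ?thesis using sub v(1) by blast
qed

text \<open>Without its top a facet fits into a unit ball: around the opposite corner for a square,
  around the corner of the cube antipodal to \<open>v\<close> for a tetrahedron. Faces avoiding the
  top are thus covered by facets with a lower top.\<close>

lemma facet_minus_top_lower:
  assumes "\<Delta> \<in> facets s v" "X \<subseteq> \<Delta> - {v}" "X \<noteq> {}"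
  shows "\<exists>v' s'. height v' < height v \<and> s' \<le> 4 \<and> (\<exists>\<Delta>'\<in>facets s' v'. X \<subseteq> \<Delta>')"
proof -
  have "\<exists>w. \<Delta> - {v} \<subseteq> nbh w"
  proof -
    show ?thesis
      using assms(1)
    proof (cases rule: facet_cases)
      case (nbh w) then show ?thesis by (auto simp: lower_nbh_def)
    next
      case (sq a b)
      then have "l1 a = 1" "l1 b = 1" using down_units l1_units by blast+
      then have "\<Delta> - {v} \<subseteq> nbh (v + (a + b))" using sq(4) by (auto simp: sq_def)
      then show ?thesis by blast
    next
      case (tet a u)
      then have "l1 (lead v) = 1" "l1 a = 1" "l1 u = 1" using lead down_units l1_units by blast+
      then have "\<Delta> - {v} \<subseteq> nbh (v + (lead v + a + u))" using tet(5) by (auto simp: tet_def)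
      then show ?thesis by blast
    qed
  qed
  then obtain w where "X \<subseteq> nbh w" using assms(2) by blast
  moreover have "finite X" using assms(1,2) facet_finite finite_subset by blast
  ultimately obtain v' s' \<Delta>' where "v' \<in> X" "s' \<le> 4" "\<Delta>' \<in> facets s' v'" "X \<subseteq> \<Delta>'"
    using nbh_subset_facet assms(3) by metis
  moreover have "height v' < height v" using facet_top(2)[OF assms(1)] assms(2) \<open>v' \<in> X\<close> by blast
  ultimately show ?thesis by blast
qed

section \<open>Overlaps of facets with a common top\<close>

lemma l1_diff2: "a \<in> units \<Longrightarrow> b \<in> units \<Longrightarrow> a \<noteq> b \<Longrightarrow> l1 (a - b) = 2"
  using l1_units2[of a "- b"] by auto

lemma l1_diff3:
  "a \<in> units \<Longrightarrow> b \<in> units \<Longrightarrow> c \<in> units \<Longrightarrow> a \<noteq> - b \<Longrightarrow> a \<noteq> c \<Longrightarrow> b \<noteq> c \<Longrightarrow> l1 (a + b - c) = 3"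
  using l1_units3[of a b "- c"] by auto

lemma pair_in_nbh_iff:
  assumes "a \<in> units" "b \<in> units" "c \<in> units" "a \<noteq> - b"
  shows "v + (a + b) \<in> nbh (v + c) \<longleftrightarrow> c = a \<or> c = b"
  using l1_diff3[OF assms] assms by (cases "a = c"; cases "b = c") (auto simp: l1_units)

lemma lower_pair_mem:
  assumes "a \<in> down v" "b \<in> down v" "a \<noteq> b"
  shows "v + (a + b) \<in> lower_nbh v (v + a)" "v + (a + b) \<in> lower_nbh v (v + b)"
  using lower_add_down[OF assms] l1_units[OF down_units[OF assms(1)]] l1_units[OF down_units[OF assms(2)]]
  by (auto simp: lower_nbh_def)

lemma lower_nbh_simps:
  "v \<in> lower_nbh v v" "a \<in> units \<Longrightarrow> v \<in> lower_nbh v (v + a)"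
  "a \<in> down v \<Longrightarrow> v + a \<in> lower_nbh v v" "a \<in> down v \<Longrightarrow> v + a \<in> lower_nbh v (v + a)"
  using l1_units[OF down_units, of a v] by (auto simp: lower_nbh_def l1_units down_height)

lemma lower_nbh_subset: "lower_nbh v w \<subseteq> nbh w"
  by (auto simp: lower_nbh_def)

lemma down_up_neq_opposite:
  assumes "a \<in> units" "u \<in> units" "W u < W a" shows "a \<noteq> - u" "a \<noteq> u"
  using assms by auto

lemma facets_elim:
  assumes "\<Delta> \<in> facets s v" "s \<le> 4"
  obtains (base) "s = 0" "\<Delta> = lower_nbh v v"
    | (sq) a b where "s = 1" "a \<in> down v" "b \<in> down v" "a \<noteq> b" "\<Delta> = sq v a b"
    | (dn) a where "s = 2" "a \<in> down v" "\<Delta> = lower_nbh v (v + a)"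
    | (tet) a u where "s = 3" "a \<in> down v" "a \<noteq> lead v" "u \<in> units" "u \<notin> down v" "W u < W a" "\<Delta> = tet v a u"
    | (up) u where "s = 4" "u \<in> units" "u \<notin> down v" "\<Delta> = lower_nbh v (v + u)"
proof -
  consider "s = 0" | "s = 1" | "s = 2" | "s = 3" | "s = 4" using assms(2) by linarith
  then show ?thesis
  proof cases
    case 1 with assms(1) show ?thesis by (intro base) (simp_all add: facets_def)
  next
    case 2 with assms(1) sq show ?thesis by (simp add: facets_def) blast
  next
    case 3 with assms(1) dn show ?thesis by (simp add: facets_def) blast
  next
    case 4 with assms(1) tet show ?thesis by (simp add: facets_def) blast
  next
    case 5 with assms(1) up show ?thesis by (simp add: facets_def) blast
  qed
qed

text \<open>The apexes are a descending neighbour of \<open>v\<close> for kinds 0 and 1, the centre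
  for kind 2, \<open>v + (lead v + a)\<close> for kind 3 and \<open>v + (lead v + u)\<close> for
  kind 4. An apex different from \<open>v\<close> matters: joining it to a face that avoids
  \<open>v\<close> still avoids \<open>v\<close>, so lower tops can take care of such faces. Only a
  facet reduced to \<open>{v}\<close> has apex \<open>v\<close>.\<close>

lemma facet_cone_same_top:
  assumes \<Delta>: "\<Delta> \<in> facets s v" "s \<le> 4" and nz: "0 < s \<or> v \<noteq> 0"
  shows "\<exists>p\<in>\<Delta>. (p = v \<longrightarrow> \<Delta> = {v} \<and> 0 < s) \<and>
    (\<forall>s'\<le>s. \<forall>\<Delta>'\<in>facets s' v. \<Delta>' \<noteq> \<Delta> \<longrightarrow> (\<exists>s''<s. \<exists>\<Delta>''\<in>facets s'' v. insert p (\<Delta> \<inter> \<Delta>') \<subseteq> \<Delta>''))"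
proof -
  have f0: "facets 0 v = {lower_nbh v v}" by (simp add: facets_def)
  have f1: "\<Delta>' \<in> facets 1 v \<longleftrightarrow> (\<exists>a b. a \<in> down v \<and> b \<in> down v \<and> a \<noteq> b \<and> \<Delta>' = sq v a b)" for \<Delta>'
    by (auto simp: facets_def)
  have f2: "\<Delta>' \<in> facets 2 v \<longleftrightarrow> (\<exists>a. a \<in> down v \<and> \<Delta>' = lower_nbh v (v + a))" for \<Delta>'
    by (auto simp: facets_def)
  have f3: "\<Delta>' \<in> facets 3 v \<longleftrightarrow> (\<exists>a u. a \<in> down v \<and> a \<noteq> lead v \<and> u \<in> units \<and> u \<notin> down v \<and>
      W u < W a \<and> \<Delta>' = tet v a u)" for \<Delta>'
    by (auto simp: facets_def)
  note U = down_units
  have ex0: "\<exists>s''<s. \<exists>\<Delta>''\<in>facets s'' v. Y \<subseteq> \<Delta>''" if "0 < s" "Y \<subseteq> lower_nbh v v" for Y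
    using that f0 by blast
  have ex1: "\<exists>s''<s. \<exists>\<Delta>''\<in>facets s'' v. Y \<subseteq> \<Delta>''"
    if "1 < s" "Y \<subseteq> sq v a b" "a \<in> down v" "b \<in> down v" "a \<noteq> b" for Y a b
    using that f1 by blast
  have ex2: "\<exists>s''<s. \<exists>\<Delta>''\<in>facets s'' v. Y \<subseteq> \<Delta>''"
    if "2 < s" "Y \<subseteq> lower_nbh v (v + a)" "a \<in> down v" for Y a
    using that f2 by blast
  show ?thesis
    using \<Delta>
  proof (cases rule: facets_elim)
    case base
    note 1 = base(1)
    then have "v \<noteq> 0" using nz by simp
    \<comment> \<open>\<open>lower_nbh v v\<close> is the only facet of kind 0 with top
      \<open>v\<close>, so any descending neighbour can serve as apex.\<close>
    then obtain a where a: "a \<in> down v" using down_nonempty by blast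
    note D = base(2)
    have "v + a \<in> \<Delta>" using D lower_nbh_simps(3)[OF a] by simp
    moreover have "v + a \<noteq> v" using U[OF a] by auto
    moreover have "\<Delta>' = \<Delta>" if "\<Delta>' \<in> facets s' v" "s' \<le> s" for \<Delta>' s'
      using that 1 D f0 by simp
    ultimately show ?thesis by blast
  next
    case (sq a b)
    note 2 = sq(1) and ab = sq(2-5)
    have u: "a \<in> units" "b \<in> units" "a \<noteq> - b" using U ab down_not_opposite by blast+
    have key: "\<exists>s''<s. \<exists>\<Delta>''\<in>facets s'' v. insert (v + a) (\<Delta> \<inter> \<Delta>') \<subseteq> \<Delta>''"
      if "v + (a + b) \<notin> \<Delta>'" for \<Delta>'
    proof (rule ex0)
      have "insert (v + a) (\<Delta> \<inter> \<Delta>') \<subseteq> {v, v + a, v + b}" using that ab(4) by (auto simp: sq_def)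
      then show "insert (v + a) (\<Delta> \<inter> \<Delta>') \<subseteq> lower_nbh v v" using lower_nbh_simps ab by blast
    qed (simp add: 2)
    \<comment> \<open>The sum of two non-opposite units determines the pair, so no other facet of
      kind 0 or 1 reaches the far corner of this square.\<close>
    have "v + (a + b) \<notin> \<Delta>'" if D': "\<Delta>' \<in> facets s' v" "s' \<le> s" "\<Delta>' \<noteq> \<Delta>" for \<Delta>' s'
    proof -
      have "s' \<le> 4" using D'(2) 2 by simp
      with D'(1) show ?thesis
      proof (cases rule: facets_elim)
        case base
        then show ?thesis using l1_units2[OF u] by (auto simp: lower_nbh_def)
      next
        case (sq c d)
        note 2 = sq(2-5)
        have "a + b \<noteq> c + d"
          using units_add_unique[of a b c d] u U[OF 2(1)] U[OF 2(2)] D'(3) ab(4) 2(4)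
          by (auto simp: sq_def add.commute)
        moreover have "a + b \<noteq> c" "a + b \<noteq> d" "a + b \<noteq> 0"
          using l1_units2[OF u] l1_units[OF U[OF 2(1)]] l1_units[OF U[OF 2(2)]] by auto
        ultimately show ?thesis using 2(4) by (auto simp: sq_def)
      qed (use D'(2) 2 in auto)
    qed
    moreover have "v + a \<in> \<Delta>" "v + a \<noteq> v" using ab u by (auto simp: sq_def)
    ultimately show ?thesis using key by blast
  next
    case (dn a)
    note 3 = dn(1) and a = dn(2-3)
    have u: "a \<in> units" using U a by blast
    have "\<exists>s''<s. \<exists>\<Delta>''\<in>facets s'' v. insert (v + a) (\<Delta> \<inter> \<Delta>') \<subseteq> \<Delta>''"
      if D': "\<Delta>' \<in> facets s' v" "s' \<le> s" "\<Delta>' \<noteq> \<Delta>" for \<Delta>' s'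
    proof -
      have key0: ?thesis if "\<Delta> \<inter> \<Delta>' \<subseteq> {v, v + a}"
      proof (rule ex0)
        show "insert (v + a) (\<Delta> \<inter> \<Delta>') \<subseteq> lower_nbh v v" using that lower_nbh_simps(1,3) a by blast
      qed (simp add: 3)
      have "s' \<le> 4" using D'(2) 3 by simp
      with D'(1) show ?thesis
      proof (cases rule: facets_elim)
        case base
        note 1 = base(2)
        have "\<Delta> \<inter> \<Delta>' \<subseteq> {v, v + a}"
          using nbh_inter0[OF _ _ u, of _ v] 1 a(2) by (auto simp: lower_nbh_def)
        then show ?thesis by (rule key0)
      next
        case (sq c d)
        note cd = sq(2-5)
        show ?thesis
        proof (cases "a = c \<or> a = d")
          case True
          then have "v + a \<in> \<Delta>'" using cd by (auto simp: sq_def)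
          then show ?thesis by (intro ex1[OF _ _ cd(1-3)]) (use cd(4) 3 in auto)
        next
          case False
          have cu: "c \<in> units" "d \<in> units" "c \<noteq> - d" using U cd down_not_opposite by blast+
          have "v + c \<notin> nbh (v + a)" "v + d \<notin> nbh (v + a)"
            using l1_diff2[of c a] l1_diff2[of d a] cu u False by auto
          moreover have "v + (c + d) \<notin> nbh (v + a)"
            using pair_in_nbh_iff[OF cu(1,2) u cu(3)] False by blast
          ultimately have "\<Delta> \<inter> \<Delta>' \<subseteq> {v}" using a(2) cd(4) lower_nbh_subset[of v "v + a"] by (auto simp: sq_def)
          then show ?thesis by (intro key0) blast
        qed
      next
        case (dn b)
        note b = dn(2-3)
        have ne: "a \<noteq> b" using D'(3) a(2) b(2) by blast
        have "\<Delta> \<inter> \<Delta>' \<subseteq> {v, v + (a + b)}"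
          using nbh_inter[OF _ _ u U[OF b(1)] ne, of _ v] b(2) a(2) by (auto simp: lower_nbh_def add.assoc)
        then have "insert (v + a) (\<Delta> \<inter> \<Delta>') \<subseteq> sq v a b" by (auto simp: sq_def)
        then show ?thesis by (intro ex1[OF _ _ a(1) b(1) ne]) (simp add: 3)
      qed (use D'(2) 3 in auto)
    qed
    moreover have "v + a \<in> \<Delta>" "v + a \<noteq> v" using a u lower_nbh_simps by auto
    ultimately show ?thesis by blast
  next
    case (tet a u)
    note 4 = tet(1) and au = tet(2-7)
    define m where "m = lead v"
    have m: "m \<in> down v" "W a < W m" "m \<noteq> a" using lead(1)[of v] lead_greater au by (auto simp: m_def)
    have D: "\<Delta> = {v, v + (m + a), v + (m + u), v + (a + u)}" using au(6) by (simp add: tet_def m_def)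
    have un: "a \<in> units" "m \<in> units" "u \<in> units" using U au m by blast+
    have opp: "m \<noteq> - a" "m \<noteq> - u" "a \<noteq> - u" "m \<noteq> u" "a \<noteq> u"
      using down_not_opposite m au un down_up_neq_opposite[of m u] down_up_neq_opposite[of a u] by auto
    \<comment> \<open>With this apex the face opposite to it, on \<open>v\<close>,
      \<open>v + (m + u)\<close> and \<open>v + (a + u)\<close>, stays free; it lies in the
      ascending ball around \<open>v + u\<close>, which is attached later.\<close>
    let ?p = "v + (m + a)"
    have l2: "l1 (m + a) = 2" "l1 (m + u) = 2" "l1 (a + u) = 2" using l1_units2 un opp by auto
    have "\<exists>s''<s. \<exists>\<Delta>''\<in>facets s'' v. insert ?p (\<Delta> \<inter> \<Delta>') \<subseteq> \<Delta>''"
      if D': "\<Delta>' \<in> facets s' v" "s' \<le> s" "\<Delta>' \<noteq> \<Delta>" for \<Delta>' s'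
    proof -
      have key1: ?thesis if "\<Delta> \<inter> \<Delta>' \<subseteq> {v, ?p}"
        by (rule ex1[OF _ _ m(1) au(1) m(3)]) (use that 4 in \<open>auto simp: sq_def\<close>)
      have "s' \<le> 4" using D'(2) 4 by simp
      with D'(1) show ?thesis
      proof (cases rule: facets_elim)
        case base
        note 1 = base(2)
        have "\<Delta> \<inter> \<Delta>' \<subseteq> {v}" using 1 D l2 by (auto simp: lower_nbh_def)
        then show ?thesis by (intro key1) blast
      next
        case (sq c d)
        note cd = sq(2-5)
        have cu: "c \<in> units" "d \<in> units" "c \<noteq> - d" using U cd down_not_opposite by blast+
        have "v + (m + u) \<notin> \<Delta>'" "v + (a + u) \<notin> \<Delta>'"
        proof -
          have "v + (x + u) \<notin> \<Delta>'" if x: "x \<in> units" "l1 (x + u) = 2" "x \<noteq> - u" for x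
          proof -
            have "x + u \<noteq> c" "x + u \<noteq> d" "x + u \<noteq> 0" using x(2) l1_units[OF cu(1)] l1_units[OF cu(2)] by auto
            moreover have "x + u \<noteq> c + d"
              using units_add_unique[OF x(1) un(3) cu(1,2) x(3)] cd au(4) by blast
            ultimately show ?thesis using cd(4) by (auto simp: sq_def)
          qed
          then show "v + (m + u) \<notin> \<Delta>'" "v + (a + u) \<notin> \<Delta>'" using un l2 opp by blast+
        qed
        then show ?thesis using D by (intro key1) auto
      next
        case (dn b)
        note b = dn(2-3)
        show ?thesis
        proof (cases "b = m \<or> b = a")
          case True
          then have "?p \<in> \<Delta>'" using lower_pair_mem[OF m(1) au(1) m(3)] b(2) by auto
          then show ?thesis by (intro ex2[OF _ _ b(1)]) (use b(2) 4 in auto)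
        next
          case False
          have bu: "b \<in> units" "b \<noteq> u" using U b(1) au(4) by blast+
          have "\<Delta> \<inter> \<Delta>' \<subseteq> {v}"
            using D b(2) lower_nbh_subset[of v "v + b"] False bu
              pair_in_nbh_iff[OF un(2,1) bu(1) opp(1), of v] pair_in_nbh_iff[OF un(2,3) bu(1) opp(2), of v]
              pair_in_nbh_iff[OF un(1,3) bu(1) opp(3), of v] by auto
          then show ?thesis by (intro key1) blast
        qed
      next
        case (tet b w)
        note bw = tet(2-7)
        have bu: "b \<in> units" using U bw by blast
        \<comment> \<open>Since every tetrahedron at \<open>v\<close> shares the direction
          \<open>m\<close>, the sum \<open>a + u\<close> identifies this one. What remains of the
          overlap, with the apex, lies in the descending ball around \<open>v + m\<close>.\<close>
        have "v + (a + u) \<notin> \<Delta>'"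
        proof
          assume "v + (a + u) \<in> \<Delta>'"
          then have "a + u = 0 \<or> a + u = m + b \<or> a + u = m + w \<or> a + u = b + w"
            using bw(6) by (auto simp: tet_def m_def)
          moreover have "a + u \<noteq> 0" using l2 by auto
          moreover have "a + u \<noteq> m + b"
            using units_add_unique[OF un(1,3,2) bu opp(3)] m au bw by blast
          moreover have "a + u \<noteq> m + w"
            using units_add_unique[OF un(1,3,2) bw(3) opp(3)] m au bw by blast
          ultimately have "a = b \<and> u = w"
            using units_add_unique[OF un(1,3) bu bw(3) opp(3)] au bw by blast
          then show False using D'(3) bw(6) au(6) by simp
        qed
        then have "insert ?p (\<Delta> \<inter> \<Delta>') \<subseteq> {v, ?p, v + (m + u)}" using D by auto
        also have "\<dots> \<subseteq> lower_nbh v (v + m)"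
          using lower_pair_mem[OF m(1) au(1) m(3)] lower_nbh_simps(2)[OF un(2)] lower_add_up[OF m(1) un(3)] m au un
          by (auto simp: lower_nbh_def l1_units)
        finally show ?thesis by (intro ex2[OF _ _ m(1)]) (simp add: 4)
      qed (use D'(2) 4 in auto)
    qed
    moreover have "?p \<in> \<Delta>" "?p \<noteq> v" using D l2 by auto
    ultimately show ?thesis by blast
  next
    case (up u)
    note 5 = up(1) and u = up(2-4)
    show ?thesis
    proof (cases "\<Delta> = {v}")
      case True
      have "\<exists>s''<s. \<exists>\<Delta>''\<in>facets s'' v. insert v (\<Delta> \<inter> \<Delta>') \<subseteq> \<Delta>''" for \<Delta>'
      proof (rule ex0)
        show "insert v (\<Delta> \<inter> \<Delta>') \<subseteq> lower_nbh v v" using True lower_nbh_simps(1) by blast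
      qed (simp add: 5)
      moreover have "v \<in> \<Delta>" "0 < s" using True 5 by simp_all
      ultimately show ?thesis using True by blast
    next
      case False
      then obtain x where "x \<in> \<Delta>" "x \<noteq> v" using facet_top(1)[OF \<Delta>(1)] by blast
      \<comment> \<open>A second vertex forces a descending unit heavier than \<open>u\<close>; then
        \<open>lead v\<close> is heavier than \<open>u\<close> too, which puts the intended apex
        below \<open>v\<close>.\<close>
      then obtain b0 where b0: "b0 \<in> down v" "W u < W b0"
        using mem_lower_nbh_up u by blast
      define m where "m = lead v"
      have m: "m \<in> down v" "W u < W m"
        using lead(1)[of v] lead(2)[of v, OF _ b0(1)] b0 by (fastforce simp: m_def)+
      have um: "m \<in> units" "m \<noteq> u" "m \<noteq> - u" using U m u down_up_neq_opposite by blast+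
      let ?p = "v + (m + u)"
      have pD: "?p \<in> \<Delta>" using u lower_add_up[OF m(1) u(1) m(2)] um by (auto simp: lower_nbh_def l1_units)
      have pm: "{v, ?p} \<subseteq> lower_nbh v (v + m)"
        using u lower_add_up[OF m(1) u(1) m(2)] um by (auto simp: lower_nbh_def l1_units)
      have \<Delta>x: "\<exists>b\<in>down v. x = v + (b + u) \<and> W u < W b" if "x \<in> \<Delta>" "x \<noteq> v" for x
        using mem_lower_nbh_up that u by blast
      have "\<exists>s''<s. \<exists>\<Delta>''\<in>facets s'' v. insert ?p (\<Delta> \<inter> \<Delta>') \<subseteq> \<Delta>''"
        if D': "\<Delta>' \<in> facets s' v" "s' \<le> s" "\<Delta>' \<noteq> \<Delta>" for \<Delta>' s'
      proof -
        have key: ?thesis if "\<Delta> \<inter> \<Delta>' \<subseteq> {v, ?p}"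
          by (rule ex2[OF _ _ m(1)]) (use that 5 pm in auto)
        have "s' \<le> 4" using D'(2) 5 by simp
        with D'(1) show ?thesis
        proof (cases rule: facets_elim)
          case base
          note 1 = base(2)
          have "x = v" if x: "x \<in> \<Delta> \<inter> \<Delta>'" for x
          proof (rule ccontr)
            assume "x \<noteq> v"
            then obtain b where b: "b \<in> down v" "x = v + (b + u)" "W u < W b" using \<Delta>x x by blast
            then have "l1 (b + u) = 2" using l1_units2[of b u] U u down_up_neq_opposite[of b u] by blast
            then show False using x 1 b by (auto simp: lower_nbh_def)
          qed
          then show ?thesis by (intro key) blast
        next
          case (sq c d)
          note cd = sq(2-5)
          have cu: "c \<in> units" "d \<in> units" "c \<noteq> - d" "c \<noteq> u" "d \<noteq> u"
            using U cd down_not_opposite u by blast+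
          have "v + c \<notin> nbh (v + u)" "v + d \<notin> nbh (v + u)"
            using l1_diff2[of c u] l1_diff2[of d u] cu u by auto
          moreover have "v + (c + d) \<notin> nbh (v + u)"
            using pair_in_nbh_iff[OF cu(1,2) u(1) cu(3)] cu by blast
          ultimately have "\<Delta> \<inter> \<Delta>' \<subseteq> {v}" using u(3) cd(4) lower_nbh_subset[of v "v + u"] by (auto simp: sq_def)
          then show ?thesis by (intro key) blast
        next
          case (dn b)
          note b = dn(2-3)
          have ub: "b \<in> units" "u \<noteq> b" using U b u by blast+
          have sub: "\<Delta> \<inter> \<Delta>' \<subseteq> {v, v + (b + u)}"
            using nbh_inter[OF _ _ u(1) ub, of _ v] b(2) u(3) by (auto simp: lower_nbh_def add.assoc add.commute[of u b])
          show ?thesis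
          proof (cases "b = m \<or> b = - u \<or> v + (b + u) \<notin> \<Delta>")
            case True
            then have "\<Delta> \<inter> \<Delta>' \<subseteq> {v, ?p}" using sub by auto
            then show ?thesis by (rule key)
          next
            case False
            then have "v + (b + u) \<noteq> v"
              by (simp add: eq_neg_iff_add_eq_0)
            then obtain b' where "b' \<in> down v" "v + (b + u) = v + (b' + u)" "W u < W b'"
              using \<Delta>x False by blast
            then have Wb: "W u < W b" by simp
            \<comment> \<open>This overlap is the reason for attaching the tetrahedra before the
              ascending balls.\<close>
            have "tet v b u \<in> facets 3 v" using f3 b False u Wb by (auto simp: m_def)
            moreover have "insert ?p (\<Delta> \<inter> \<Delta>') \<subseteq> tet v b u" using sub by (auto simp: tet_def m_def)
            ultimately show ?thesis using 5 by (intro exI[of _ 3]) auto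
          qed
        next
          case (tet b w)
          note bw = tet(2-7)
          have bu: "b \<in> units" "b \<noteq> u" using U bw u by blast+
          have opp: "m \<noteq> - b" "m \<noteq> - w" "b \<noteq> - w" "W b < W m"
            using down_not_opposite m bw um bu lead_greater[OF bw(1,2)] down_up_neq_opposite[of m w] down_up_neq_opposite[of b w]
            by (auto simp: m_def)
          show ?thesis
          proof (cases "w = u")
            case True
            then have "insert ?p (\<Delta> \<inter> \<Delta>') \<subseteq> \<Delta>'" using bw(6) by (auto simp: tet_def m_def)
            then show ?thesis using 5 bw f3 by (intro exI[of _ 3]) auto
          next
            case False
            have "\<Delta> \<inter> \<Delta>' \<subseteq> {v}"
              using bw(6) u(3) lower_nbh_subset[of v "v + u"] False bu um
                pair_in_nbh_iff[OF um(1) bu(1) u(1) opp(1), of v] pair_in_nbh_iff[OF um(1) bw(3) u(1) opp(2), of v]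
                pair_in_nbh_iff[OF bu(1) bw(3) u(1) opp(3), of v] by (auto simp: tet_def m_def)
            then show ?thesis by (intro key) blast
          qed
        next
          case (up w)
          note w = up(2-4)
          then have "u \<noteq> w" using D'(3) u(3) by blast
          have "x = v" if x: "x \<in> \<Delta> \<inter> \<Delta>'" for x
          proof (rule ccontr)
            assume "x \<noteq> v"
            then obtain b where b: "b \<in> down v" "x = v + (b + u)" using \<Delta>x x by blast
            have "x = v + u + w"
              using nbh_inter[OF _ _ u(1) w(1) \<open>u \<noteq> w\<close>, of x v] x \<open>x \<noteq> v\<close> u(3) w(3) lower_nbh_subset by blast
            then have "b = w" using b(2) by (simp add: algebra_simps)
            then show False using b(1) w(2) by simp
          qed
          then show ?thesis by (intro key) blast
        qed
      qed
      moreover have "?p \<noteq> v" using um by (simp add: eq_neg_iff_add_eq_0)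
      ultimately show ?thesis using pD by blast
    qed
  qed
qed

text \<open>Lexicographic order by height of the top, then by kind, coded as
  \<open>5 * height + kind\<close>. Tops of equal height share a stage.\<close>

definition stage :: "nat \<Rightarrow> (int ^ 'n::finite) set set" where
  "stage r = (\<Union>v \<in> {v. nat (height v) = r div 5}. facets (r mod 5) v)"

text \<open>Overlaps through the top \<open>v\<close> are settled among facets with top
  \<open>v\<close>; overlaps avoiding \<open>v\<close> are joined with an apex different from
  \<open>v\<close> and fall under a strictly lower top.\<close>

lemma stage_shelling:
  assumes "\<Delta> \<in> stage r" "0 < r"
  shows "\<exists>p\<in>\<Delta>. \<forall>s\<le>r. \<forall>\<Delta>'\<in>stage s. \<Delta>' \<noteq> \<Delta> \<longrightarrow> (\<exists>s'<r. \<exists>\<Delta>''\<in>stage s'. insert p (\<Delta> \<inter> \<Delta>') \<subseteq> \<Delta>'')"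
proof -
  have stageI: "\<Delta>' \<in> stage (5 * nat (height v) + s)" if "\<Delta>' \<in> facets s v" "s \<le> 4" for \<Delta>' s v
    using that by (auto simp: stage_def)
  obtain v where v: "nat (height v) = r div 5" "\<Delta> \<in> facets (r mod 5) v"
    using assms(1) by (auto simp: stage_def)
  have r: "r = 5 * nat (height v) + r mod 5" using v(1) by simp
  have "0 < r mod 5 \<or> v \<noteq> 0"
    using assms(2) r height_eq_0_iff[of v] by (cases "v = 0") auto
  then obtain p where p: "p \<in> \<Delta>" "p = v \<longrightarrow> \<Delta> = {v} \<and> 0 < r mod 5"
    and same: "\<And>s' \<Delta>'. s' \<le> r mod 5 \<Longrightarrow> \<Delta>' \<in> facets s' v \<Longrightarrow> \<Delta>' \<noteq> \<Delta> \<Longrightarrow>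
      \<exists>s''<r mod 5. \<exists>\<Delta>''\<in>facets s'' v. insert p (\<Delta> \<inter> \<Delta>') \<subseteq> \<Delta>''"
    using facet_cone_same_top[OF v(2)] by fastforce
  have "\<exists>s'<r. \<exists>\<Delta>''\<in>stage s'. insert p (\<Delta> \<inter> \<Delta>') \<subseteq> \<Delta>''"
    if s: "s \<le> r" and \<Delta>': "\<Delta>' \<in> stage s" "\<Delta>' \<noteq> \<Delta>" for s \<Delta>'
  proof -
    obtain v' where v': "nat (height v') = s div 5" "\<Delta>' \<in> facets (s mod 5) v'"
      using \<Delta>'(1) by (auto simp: stage_def)
    have le: "height v' \<le> height v"
      using v(1) v'(1) div_le_mono[OF s, of 5] height_nonneg[of v] height_nonneg[of v'] by linarith
    show ?thesis
    \<comment> \<open>If \<open>\<Delta>'\<close> contains \<open>v\<close>, its own top cannot be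
      lower than \<open>v\<close>; as it is not higher either, and tops are strictly highest, the
      two tops coincide.\<close>
    proof (cases "v \<in> \<Delta>'")
      case True
      then have vv: "v' = v" using facet_top(2)[OF v'(2), of v] le by fastforce
      have "s mod 5 \<le> r mod 5"
        using s v(1) v'(1) vv by (metis div_mult_mod_eq nat_add_left_cancel_le)
      then obtain s'' \<Delta>'' where "s'' < r mod 5" "\<Delta>'' \<in> facets s'' v" "insert p (\<Delta> \<inter> \<Delta>') \<subseteq> \<Delta>''"
        using same v'(2) \<Delta>'(2) vv by blast
      then show ?thesis using stageI[of \<Delta>'' s'' v] r
        by (intro exI[of _ "5 * nat (height v) + s''"]) (auto intro: order.strict_trans)
    next
      case False
      show ?thesis
      \<comment> \<open>An apex \<open>v\<close> occurs only for \<open>\<Delta> = {v}\<close> of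
        positive kind, and this vertex lies in the earlier facet
        \<open>lower_nbh v v\<close>.\<close>
      proof (cases "p = v")
        case True
        then have "insert p (\<Delta> \<inter> \<Delta>') \<subseteq> lower_nbh v v" "0 < r mod 5"
          using p(2) lower_nbh_simps(1) by auto
        moreover have "lower_nbh v v \<in> stage (5 * nat (height v) + 0)"
          by (rule stageI) (auto simp: facets_def)
        ultimately show ?thesis using r by (intro exI[of _ "5 * nat (height v)"]) auto
      next
        case pv: False
        then have "insert p (\<Delta> \<inter> \<Delta>') \<subseteq> \<Delta> - {v}" using p(1) False by blast
        then obtain v'' s'' \<Delta>'' where h: "height v'' < height v" "s'' \<le> 4" "\<Delta>'' \<in> facets s'' v''"
          "insert p (\<Delta> \<inter> \<Delta>') \<subseteq> \<Delta>''"
          using facet_minus_top_lower[OF v(2)] by (metis insert_not_empty)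
        have "5 * nat (height v'') + s'' < r"
          using h(1,2) r height_nonneg[of v''] by linarith
        then show ?thesis using stageI[OF h(3,2)] h(4) by blast
      qed
    qed
  qed
  then show ?thesis using p(1) by blast
qed

lemma stage_0: "stage 0 = {{0 :: int ^ 'n::finite}}"
proof -
  have "nat (height v) = 0 \<longleftrightarrow> v = 0" for v :: "int ^ 'n"
    using height_eq_0_iff[of v] height_nonneg[of v] by simp
  then have "{v :: int ^ 'n. nat (height v) = 0} = {0}" by simp
  moreover have "lower_nbh 0 0 = {0 :: int ^ 'n}"
    using height_nonneg height_eq_0_iff[of "0 :: int ^ 'n"] by (auto simp: lower_nbh_def nbh_def not_less[symmetric])
  ultimately show ?thesis by (simp add: stage_def facets_def)
qed

lemma finite_stage: "finite (stage r :: (int ^ 'n::finite) set set)"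
proof (rule finite_subset)
  let ?V = "{v :: int ^ 'n. height v \<le> int (r div 5)}"
  show "stage r \<subseteq> Pow ?V"
  proof clarify
    fix \<Delta> x assume "\<Delta> \<in> stage r" "x \<in> \<Delta>"
    then obtain v where "nat (height v) = r div 5" "\<Delta> \<in> facets (r mod 5) v" by (auto simp: stage_def)
    then show "height x \<le> int (r div 5)"
      using facet_top(2)[of \<Delta> "r mod 5" v x] \<open>x \<in> \<Delta>\<close> height_nonneg[of v] by (cases "x = v") auto
  qed
  show "finite (Pow ?V)" using finite_height_le by simp
qed

subsection \<open>Simplices outside the contractible subcomplex\<close>

abbreviation lattice_VR :: "(int ^ 'n::finite) set set" where
  "lattice_VR \<equiv> VR_complex manhattan UNIV 2"

definition core :: "(int ^ 'n::finite) set set" where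
  "core = faces (\<Union>r. stage r)"

lemma lattice_VR_iff:
  "\<sigma> \<in> lattice_VR \<longleftrightarrow> finite \<sigma> \<and> \<sigma> \<noteq> {} \<and> (\<forall>x\<in>\<sigma>. \<forall>y\<in>\<sigma>. l1 (x - y) \<le> 2)"
proof -
  have "real_of_int k \<le> 2 \<longleftrightarrow> k \<le> 2" for k by linarith
  then show ?thesis by (simp add: VR_complex_def manhattan_l1)
qed

lemma simplicial_complex_lattice_VR: "simplicial_complex (lattice_VR :: (int ^ 'n::finite) set set)"
proof -
  have "\<tau> \<in> lattice_VR" if "\<sigma> \<in> lattice_VR" "\<tau> \<subseteq> \<sigma>" "\<tau> \<noteq> {}" for \<sigma> \<tau> :: "(int ^ 'n) set"
    using that finite_subset[OF that(2)] subsetD[OF that(2)] by (simp add: lattice_VR_iff)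
  moreover have "finite \<sigma> \<and> \<sigma> \<noteq> {}" if "\<sigma> \<in> lattice_VR" for \<sigma> :: "(int ^ 'n) set"
    using that by (simp add: lattice_VR_iff)
  ultimately show ?thesis unfolding simplicial_complex_def by blast
qed

lemma stage_finite: "\<Delta> \<in> stage r \<Longrightarrow> finite \<Delta>"
  using facet_finite by (auto simp: stage_def)

lemma simplicial_complex_core: "simplicial_complex core"
  unfolding core_def using stage_finite by (intro simplicial_complex_faces) auto

lemma coreI:
  assumes "\<Delta> \<in> facets s v" "s \<le> 4" "X \<subseteq> \<Delta>" "X \<noteq> {}" shows "X \<in> core"
proof -
  have "\<Delta> \<in> stage (5 * nat (height v) + s)" using assms(1,2) by (auto simp: stage_def)
  then show ?thesis using assms(3,4) by (auto simp: core_def faces_def)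
qed

lemma coreE:
  assumes "X \<in> core" obtains \<Delta> s v where "\<Delta> \<in> facets s v" "s \<le> 4" "X \<subseteq> \<Delta>"
proof -
  obtain r \<Delta> where "\<Delta> \<in> stage r" "X \<subseteq> \<Delta>" using assms by (auto simp: core_def faces_def)
  then obtain v where "\<Delta> \<in> facets (r mod 5) v" by (auto simp: stage_def)
  moreover have "r mod 5 \<le> 4" by simp
  ultimately show ?thesis using that \<open>X \<subseteq> \<Delta>\<close> by blast
qed

lemma facet_diam:
  assumes "\<Delta> \<in> facets s v" "x \<in> \<Delta>" "y \<in> \<Delta>" shows "l1 (x - y) \<le> 2"
proof -
  have two: "l1 (a + b) \<le> 2" "l1 (a - b) \<le> 2" if "l1 a = 1" "l1 b = 1" for a b :: "int ^ 'a"
    using l1_triangle[of a b] l1_triangle[of a "- b"] that by auto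
  have neg: "l1 (- a - b) = l1 (a + b)" for a b :: "int ^ 'a"
    using l1_uminus[of "a + b"] by simp
  show ?thesis
    using assms(1)
  proof (cases rule: facet_cases)
    case (nbh w) then show ?thesis using nbh_diam[of x w y] assms(2,3) by (auto simp: lower_nbh_def)
  next
    case (sq a b)
    then have "l1 a = 1" "l1 b = 1" using down_units l1_units by blast+
    then show ?thesis
      using assms(2,3) two[of a b] two[of b a] by (auto simp: sq(4) sq_def neg)
  next
    case (tet a u)
    then have "l1 (lead v) = 1" "l1 a = 1" "l1 u = 1" using lead down_units l1_units by blast+
    then show ?thesis
      using assms(2,3) two[of "lead v" a] two[of a "lead v"] two[of u a] two[of a u] two[of "lead v" u] two[of u "lead v"]
      by (auto simp: tet(5) tet_def neg)
  qed
qed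

lemma core_subset: "core \<subseteq> lattice_VR"
proof
  fix X :: "(int ^ 'n) set" assume X: "X \<in> core"
  then obtain \<Delta> s v where \<Delta>: "\<Delta> \<in> facets s v" "X \<subseteq> \<Delta>" by (rule coreE)
  have "finite X" "X \<noteq> {}" using X simplicial_complex_core by (auto simp: simplicial_complex_def)
  then show "X \<in> lattice_VR" using facet_diam[OF \<Delta>(1)] \<Delta>(2) unfolding lattice_VR_iff by blast
qed

lemma nbh_subset_core: "X \<subseteq> nbh w \<Longrightarrow> X \<noteq> {} \<Longrightarrow> finite X \<Longrightarrow> X \<in> core"
  using nbh_subset_facet coreI by metis

text \<open>The witness is the coordinatewise median.\<close>

lemma triple_in_nbh:
  assumes "x \<noteq> y" "x \<noteq> z" "y \<noteq> z" "l1 (x - y) \<le> 2" "l1 (x - z) \<le> 2" "l1 (y - z) \<le> 2"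
  shows "\<exists>w. {x, y, z} \<subseteq> nbh w"
proof -
  define md :: "int \<Rightarrow> int \<Rightarrow> int \<Rightarrow> int" where
    "md = (\<lambda>a b c. a + b + c - max a (max b c) - min a (min b c))"
  have md: "\<bar>a - md a b c\<bar> + \<bar>b - md a b c\<bar> = \<bar>a - b\<bar>" "\<bar>a - md a b c\<bar> + \<bar>c - md a b c\<bar> = \<bar>a - c\<bar>"
    "\<bar>b - md a b c\<bar> + \<bar>c - md a b c\<bar> = \<bar>b - c\<bar>" for a b c
    by (cases "a \<le> b"; cases "b \<le> c"; cases "a \<le> c"; simp add: md_def max_def min_def)+
  define w where "w = (\<chi> i. md (x $ i) (y $ i) (z $ i))"
  have *: "l1 (x - w) + l1 (y - w) = l1 (x - y)" "l1 (x - w) + l1 (z - w) = l1 (x - z)"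
    "l1 (y - w) + l1 (z - w) = l1 (y - z)"
    by (simp_all add: l1_def w_def md flip: sum.distrib)
  have "\<not> (l1 (x - w) = 0 \<and> l1 (y - w) = 0)" "\<not> (l1 (x - w) = 0 \<and> l1 (z - w) = 0)"
    "\<not> (l1 (y - w) = 0 \<and> l1 (z - w) = 0)"
    using assms(1-3) by auto
  then have "l1 (x - w) \<le> 1" "l1 (y - w) \<le> 1" "l1 (z - w) \<le> 1"
    using * assms(4-6) l1_nonneg[of "x - w"] l1_nonneg[of "y - w"] l1_nonneg[of "z - w"] by linarith+
  then show ?thesis by (auto simp: nbh_def intro!: exI[of _ w])
qed

lemma pair_in_nbh:
  assumes "l1 (x - y) \<le> 2" shows "\<exists>w. {x, y} \<subseteq> nbh w"
proof (cases "l1 (x - y) \<le> 1")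
  case True then show ?thesis by (auto simp: nbh_def intro!: exI[of _ y])
next
  case False
  then obtain a b where ab: "a \<in> units" "b \<in> units" "x - y = a + b" using l1_eq_2[of "x - y"] assms by auto
  then have "x = y + a + b" by (simp add: algebra_simps)
  then have "{x, y} \<subseteq> nbh (y + a)" using l1_units[OF ab(1)] l1_units[OF ab(2)] by (auto simp: nbh_def)
  then show ?thesis by blast
qed

lemma card_le_3_in_core:
  assumes "\<sigma> \<in> lattice_VR" "card \<sigma> \<le> 3" shows "\<sigma> \<in> core"
proof -
  have f: "finite \<sigma>" "\<sigma> \<noteq> {}" and d: "\<And>x y. x \<in> \<sigma> \<Longrightarrow> y \<in> \<sigma> \<Longrightarrow> l1 (x - y) \<le> 2"
    using assms(1) by (auto simp: lattice_VR_iff)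
  then have "card \<sigma> \<noteq> 0" by simp
  then consider "card \<sigma> = 1" | "card \<sigma> = 2" | "card \<sigma> = 3" using assms(2) by linarith
  then have "\<exists>w. \<sigma> \<subseteq> nbh w"
  proof cases
    case 1 then obtain x where "\<sigma> = {x}" by (auto simp: card_1_singleton_iff)
    then show ?thesis by (auto intro: exI[of _ x])
  next
    case 2 then obtain x y where "\<sigma> = {x, y}" by (auto simp: card_2_iff)
    then show ?thesis using pair_in_nbh[of x y] d by auto
  next
    case 3 then obtain x y z where "\<sigma> = {x, y, z}" "x \<noteq> y" "x \<noteq> z" "y \<noteq> z" by (auto simp: card_3_iff)
    then show ?thesis using triple_in_nbh[of x y z] d by auto
  qed
  then show ?thesis using nbh_subset_core f by blast
qed

text \<open>At distance 1 the common points are \<open>x\<close> and \<open>y\<close> themselves; at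
  distance 2 they are the intermediate points \<open>x + a\<close> and \<open>x + b\<close>. These
  coincide for a double step along one axis, so \<open>p = q\<close> is possible.\<close>

lemma common_nbh:
  assumes "x \<noteq> y" "l1 (x - y) \<le> 2"
  shows "\<exists>p q. nbh x \<inter> nbh y = {p, q}"
proof (cases "l1 (y - x) \<le> 1")
  case True
  then have u: "y - x \<in> units" using assms(1) l1_le_1[of "y - x"] by auto
  then have "nbh x \<inter> nbh y = {x, y}"
    using nbh_inter0[of _ x "y - x"] l1_units[OF u] by (auto simp: nbh_def l1_minus_commute[of x y])
  then show ?thesis by blast
next
  case False
  then obtain a b where ab: "a \<in> units" "b \<in> units" "y - x = a + b" "a \<noteq> - b"
    using l1_eq_2[of "y - x"] assms(2) by (auto simp: l1_minus_commute[of x y])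
  have y: "y = x + (a + b)" using ab(3) by (simp add: algebra_simps)
  have "p = x + a \<or> p = x + b" if p: "p \<in> nbh x" "p \<in> nbh y" for p
  proof -
    have "x \<notin> nbh y" using False by (simp add: nbh_def l1_minus_commute)
    then obtain e where e: "e \<in> units" "p = x + e" using p by (auto simp: nbh_iff[of p x])
    then have "e = a \<or> e = b" using pair_in_nbh_iff[OF ab(1,2) e(1) ab(4), of x] p(2) y nbh_sym by blast
    then show ?thesis using e(2) by blast
  qed
  moreover have "x + a \<in> nbh y" "x + b \<in> nbh y" "x + a \<in> nbh x" "x + b \<in> nbh x"
    using l1_units[OF ab(1)] l1_units[OF ab(2)] by (auto simp: y)
  ultimately have "nbh x \<inter> nbh y = {x + a, x + b}" by blast
  then show ?thesis by blast
qed

text \<open>Put \<open>a = t - p\<close> and \<open>b = z - q\<close>, each zero or a unit. In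
  \<open>z - t = (q - p) + b - a\<close> the hypotheses on \<open>z\<close> and \<open>t\<close>
  forbid that \<open>b\<close> or \<open>- a\<close> cancels against \<open>q - p\<close>, so for
  \<open>a \<noteq> b\<close> the norm is at least 3.\<close>

lemma nbh_translate_unique:
  assumes pq: "p \<noteq> q" "l1 (q - p) \<le> 2"
    and z: "z \<in> nbh q" "z \<notin> nbh p" and t: "t \<in> nbh p" "t \<notin> nbh q" and zt: "l1 (z - t) \<le> 2"
  shows "t = p + (z - q)"
proof -
  obtain b where b: "z = q + b" "b = 0 \<or> b \<in> units" using z(1) unfolding nbh_iff by force
  obtain a where a: "t = p + a" "a = 0 \<or> a \<in> units" using t(1) unfolding nbh_iff by force
  have "q - p \<noteq> 0" using pq(1) by simp
  then consider "q - p \<in> units" | e f where "e \<in> units" "f \<in> units" "q - p = e + f" "e \<noteq> - f"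
    using l1_le_1[of "q - p"] l1_eq_2[of "q - p"] pq(2) l1_nonneg[of "q - p"]
    by (metis zle_add1_eq_le one_add_one order_le_less)
  then have "a = b"
  proof cases
    case 1
    define e where "e = q - p"
    have e: "e \<in> units" "q = p + e" using 1 by (auto simp: e_def)
    have "b \<noteq> 0" using z(2) b e l1_units[OF e(1)] by auto
    moreover have "b \<noteq> - e" using z(2) b e by auto
    moreover have "a \<noteq> 0" using t(2) a e l1_units[OF e(1)] by auto
    moreover have "a \<noteq> e" using t(2) a e by auto
    moreover have "l1 (e + b + (- a)) \<le> 2" using zt a b e by (simp add: algebra_simps)
    ultimately show ?thesis using l1_units3[of e b "- a"] e(1) a(2) b(2) equation_minus_iff[of e b] by auto
  next
    case (2 e f)
    then have q: "q = p + (e + f)" by (simp add: algebra_simps)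
    have b': "b \<noteq> - e" "b \<noteq> - f"
      using z(2) b(1) l1_units[OF 2(1)] l1_units[OF 2(2)] by (auto simp: q)
    have a': "a \<noteq> e" "a \<noteq> f"
      using t(2) a(1) l1_units[OF 2(1)] l1_units[OF 2(2)] by (auto simp: q)
    have le: "l1 (e + f + b - a) \<le> 2" using zt a b q by (simp add: algebra_simps)
    show ?thesis
    proof (rule ccontr)
      assume "a \<noteq> b"
      then consider "a = 0" "b \<in> units" | "b = 0" "a \<in> units" | "a \<in> units" "b \<in> units" using a(2) b(2) by blast
      then show False
      proof cases
        case 1 then show False using le l1_units3[of e f b] 2 b' equation_minus_iff[of e b] equation_minus_iff[of f b] by auto
      next
        case b0: 2 then show False using le l1_units3[of e f "- a"] 2 a' by auto
      next
        case 3 then show False using le l1_units4[of e f b "- a"] 2 a' b' \<open>a \<noteq> b\<close> equation_minus_iff[of e b] equation_minus_iff[of f b] by auto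
      qed
    qed
  qed
  then show ?thesis using a(1) b(1) by simp
qed

text \<open>By the triple lemma every vertex is within 1 of one of the two centres \<open>p\<close>,
  \<open>q\<close> common to \<open>x\<close> and \<open>y\<close>. If neither ball contains
  \<open>\<sigma>\<close>, both have a private vertex, and each private vertex on one side is the
  translate of one on the other side. So each side has only one, leaving no room for a fifth
  vertex.\<close>

lemma card_ge_5_in_nbh:
  assumes \<sigma>: "\<sigma> \<in> lattice_VR" "5 \<le> card \<sigma>" shows "\<exists>w. \<sigma> \<subseteq> nbh w"
proof (rule ccontr)
  assume no: "\<nexists>w. \<sigma> \<subseteq> nbh w"
  have fin: "finite \<sigma>" and d: "\<And>x y. x \<in> \<sigma> \<Longrightarrow> y \<in> \<sigma> \<Longrightarrow> l1 (x - y) \<le> 2"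
    using \<sigma>(1) by (auto simp: lattice_VR_iff)
  have "\<exists>x\<in>\<sigma>. x \<notin> F" if "finite F" "card F \<le> 4" for F
  proof (rule ccontr)
    assume "\<not> ?thesis"
    then have "card \<sigma> \<le> card F" using that(1) by (intro card_mono) auto
    then show False using \<sigma>(2) that(2) by simp
  qed
  moreover have "card {a, b, c, d} \<le> 4" for a b c d :: "int ^ 'a"
    by (simp add: card_insert_if)
  ultimately have pick: "\<exists>x\<in>\<sigma>. x \<notin> {a, b, c, d}" for a b c d
    by (meson finite.intros)
  obtain x where x: "x \<in> \<sigma>" using pick by blast
  obtain y where y: "y \<in> \<sigma>" "y \<noteq> x" using pick[of x x x x] by blast
  obtain p q where pq: "nbh x \<inter> nbh y = {p, q}" using common_nbh[of x y] d x y by blast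
  have near: "z \<in> nbh p \<or> z \<in> nbh q" if zs: "z \<in> \<sigma>" for z
  proof (cases "z = x \<or> z = y")
    case True then show ?thesis using pq nbh_sym by blast
  next
    case False
    then obtain w where "{x, y, z} \<subseteq> nbh w"
      using triple_in_nbh[of x y z] d[OF x y(1)] d[OF x zs] d[OF y(1) zs] y(2) by auto
    then have "w \<in> nbh x \<inter> nbh y" "w \<in> nbh z" using nbh_sym by blast+
    then show ?thesis using pq nbh_sym by auto
  qed
  have xy: "x \<in> nbh p \<inter> nbh q" "y \<in> nbh p \<inter> nbh q" using pq nbh_sym by blast+
  obtain z1 where z1: "z1 \<in> \<sigma>" "z1 \<notin> nbh q" using no by blast
  obtain z2 where z2: "z2 \<in> \<sigma>" "z2 \<notin> nbh p" using no by blast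
  have ne: "p \<noteq> q" using near z1 by blast
  have dpq: "l1 (q - p) \<le> 2" using nbh_diam[of q x p] pq by blast
  then obtain p' q' where "nbh p \<inter> nbh q = {p', q'}"
    using common_nbh[of p q] ne by (auto simp: l1_minus_commute)
  then have only: "nbh p \<inter> nbh q = {x, y}" using xy y(2) by auto
  obtain z3 where z3: "z3 \<in> \<sigma>" "z3 \<notin> {x, y, z1, z2}" using pick by blast
  have t1: "z1 \<in> nbh p" and t2: "z2 \<in> nbh q" using near z1 z2 by blast+
  show False
  proof (cases "z3 \<in> nbh p")
    case True
    then have "z3 \<notin> nbh q" using only z3 by blast
    then have "z3 = p + (z2 - q)"
      using nbh_translate_unique[OF ne dpq t2 z2(2) True] d z2 z3 by blast
    moreover have "z1 = p + (z2 - q)"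
      using nbh_translate_unique[OF ne dpq t2 z2(2) t1 z1(2)] d z1 z2 by blast
    ultimately show False using z3 by blast
  next
    case False
    then have "z3 \<in> nbh q" using near z3 by blast
    then have "z3 = q + (z1 - p)"
      using nbh_translate_unique[OF ne[symmetric] _ t1 z1(2) _ False] dpq d z1 z3 by (simp add: l1_minus_commute)
    moreover have "z2 = q + (z1 - p)"
      using nbh_translate_unique[OF ne[symmetric] _ t1 z1(2) t2 z2(2)] dpq d z1 z2 by (simp add: l1_minus_commute)
    ultimately show False using z3 by blast
  qed
qed

lemma not_core:
  assumes "\<sigma> \<in> lattice_VR" "\<sigma> \<notin> core"
  shows "card \<sigma> = 4" "\<And>\<tau>. \<tau> \<subset> \<sigma> \<Longrightarrow> \<tau> \<noteq> {} \<Longrightarrow> \<tau> \<in> core"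
proof -
  have f: "finite \<sigma>" "\<sigma> \<noteq> {}" using assms(1) by (auto simp: lattice_VR_iff)
  have "\<not> 5 \<le> card \<sigma>" using card_ge_5_in_nbh[OF assms(1)] nbh_subset_core f assms(2) by blast
  moreover have "\<not> card \<sigma> \<le> 3" using card_le_3_in_core[OF assms(1)] assms(2) by blast
  ultimately show c: "card \<sigma> = 4" by linarith
  fix \<tau> assume \<tau>: "\<tau> \<subset> \<sigma>" "\<tau> \<noteq> {}"
  then have "\<tau> \<in> lattice_VR" using simplicial_complex_lattice_VR assms(1) unfolding simplicial_complex_def by blast
  moreover have "card \<tau> \<le> 3" using psubset_card_mono[OF f(1) \<tau>(1)] c by simp
  ultimately show "\<tau> \<in> core" by (rule card_le_3_in_core)
qed

text \<open>The inscribed tetrahedron through the outer corner \<open>v\<close> of a cube. It fits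
  into no unit ball; it is no square, as all its distances are 2; and a tetrahedron of
  \<open>facets\<close> with the same top involves an ascending unit, which the uniqueness of sums
  of two units excludes.\<close>

lemma corner_tetrahedron:
  assumes abc: "a \<in> down v" "b \<in> down v" "c \<in> down v" "a \<noteq> b" "a \<noteq> c" "b \<noteq> c"
  defines "E \<equiv> {v, v + (a + b), v + (a + c), v + (b + c)}"
  shows "E \<in> lattice_VR" "E \<notin> core" "\<And>x. x \<in> E \<Longrightarrow> x \<noteq> v \<Longrightarrow> height x < height v"
proof -
  have u: "a \<in> units" "b \<in> units" "c \<in> units" using abc down_units by blast+
  have opp: "a \<noteq> - b" "a \<noteq> - c" "b \<noteq> - c" "b \<noteq> - a" "c \<noteq> - a" "c \<noteq> - b" using abc down_not_opposite by blast+
  have l: "l1 (a + b) = 2" "l1 (a + c) = 2" "l1 (b + c) = 2" "l1 (a - b) = 2" "l1 (a - c) = 2" "l1 (b - c) = 2"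
    "l1 (b - a) = 2" "l1 (c - a) = 2" "l1 (c - b) = 2"
    using l1_units2 l1_diff2 u opp abc by auto
  have neg: "l1 (- a - b) = l1 (a + b)" for a b :: "int ^ 'a"
    using l1_uminus[of "a + b"] by simp
  have dist: "l1 (x - y) = 2" if "x \<in> E" "y \<in> E" "x \<noteq> y" for x y
    using that l by (auto simp: E_def neg)
  show "E \<in> lattice_VR"
    unfolding lattice_VR_iff
  proof (intro conjI ballI)
    fix x y assume "x \<in> E" "y \<in> E"
    then show "l1 (x - y) \<le> 2" using dist[of x y] by (cases "x = y") auto
  qed (auto simp: E_def)
  have cE: "card E = 4"
    using l abc by (auto simp: E_def card_insert_if)
  show low: "height x < height v" if "x \<in> E" "x \<noteq> v" for x
    using that lower_add_down abc by (auto simp: E_def)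
  show "E \<notin> core"
  proof
    assume "E \<in> core"
    then obtain \<Delta> s w where \<Delta>: "\<Delta> \<in> facets s w" "s \<le> 4" "E \<subseteq> \<Delta>" by (rule coreE)
    have not_nbh: "\<not> E \<subseteq> nbh z" for z
    proof
      assume E: "E \<subseteq> nbh z"
      then have "z \<in> nbh v" using nbh_sym by (auto simp: E_def)
      moreover have "z \<noteq> v" using E l by (auto simp: E_def)
      ultimately obtain e where e: "e \<in> units" "z = v + e" by (auto simp: nbh_iff)
      have "e = a \<or> e = b" "e = a \<or> e = c" "e = b \<or> e = c"
        using E e(2) pair_in_nbh_iff[OF u(1,2) e(1) opp(1), of v] pair_in_nbh_iff[OF u(1,3) e(1) opp(2), of v]
          pair_in_nbh_iff[OF u(2,3) e(1) opp(3), of v] by (auto simp: E_def)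
      then show False using abc by auto
    qed
    have E_eq: "E = \<Delta>" if "finite \<Delta>" "card \<Delta> \<le> 4"
      using that \<Delta>(3) cE card_mono[OF that(1) \<Delta>(3)] by (intro card_subset_eq) auto
    from \<Delta>(1,2) show False
    proof (cases rule: facets_elim)
      case (sq d e)
      then have de: "l1 d = 1" "l1 e = 1" using down_units l1_units by blast+
      have "E = sq w d e" using E_eq sq(5) by (simp add: sq_def card_insert_if)
      then have "w \<in> E" "w + d \<in> E" by (auto simp: sq_def)
      moreover have "d \<noteq> 0" using de(1) by auto
      ultimately show False using dist[of "w + d" w] de by auto
    next
      case (tet d e)
      have E: "E = tet w d e" using E_eq tet(7) by (simp add: tet_def card_insert_if)
      have "v \<in> \<Delta>" "w \<in> E" using E tet(7) by (auto simp: E_def tet_def)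
      then have wv: "w = v" using facet_top(2)[OF \<Delta>(1), of v] low[of w] by fastforce
      have ld: "lead v \<in> down v" "W e < W (lead v)"
        using lead(1)[of v] lead_greater[of d v] tet abc wv by force+
      then have lu: "lead v \<in> units" "lead v \<noteq> - e"
        using down_units down_up_neq_opposite[of "lead v" e] tet(4) by blast+
      have "v + (lead v + e) \<in> E" using E wv by (simp add: tet_def)
      then consider "lead v + e = 0" | "lead v + e = a + b" | "lead v + e = a + c" | "lead v + e = b + c"
        by (auto simp: E_def)
      then have "e \<in> {a, b, c}"
        using units_add_unique[OF lu(1) tet(4) _ _ lu(2)] u lu(2) by cases (auto simp: eq_neg_iff_add_eq_0)
      then show False using abc tet(5) wv by blast
    qed (use not_nbh \<Delta>(3) lower_nbh_subset in blast)+
  qed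
qed

subsection \<open>Collapsing the boundary of a 3-simplex\<close>

definition min4 :: "(nat \<Rightarrow> real) \<Rightarrow> real" where
  "min4 \<xi> = min (min (\<xi> 0) (\<xi> 1)) (min (\<xi> 2) (\<xi> 3))"

definition spread :: "(nat \<Rightarrow> real) \<Rightarrow> real" where
  "spread \<xi> = (\<xi> 1 - \<xi> 0)\<^sup>2 + (\<xi> 2 - \<xi> 0)\<^sup>2 + (\<xi> 3 - \<xi> 0)\<^sup>2"

text \<open>Inverse stereographic projection of \<open>(\<xi> j - \<xi> 0) / min4 \<xi>\<close>, which identifies the
  open simplex with three-space, with denominators cleared so that it extends to the boundary.\<close>

definition simplex_to_sphere :: "(nat \<Rightarrow> real) \<Rightarrow> nat \<Rightarrow> real" where
  "simplex_to_sphere \<xi> = (\<lambda>j.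
     if j = 0 then (spread \<xi> - (min4 \<xi>)\<^sup>2) / (spread \<xi> + (min4 \<xi>)\<^sup>2)
     else if j < 4 then 2 * min4 \<xi> * (\<xi> j - \<xi> 0) / (spread \<xi> + (min4 \<xi>)\<^sup>2) else 0)"

text \<open>Only the first four coordinates are constrained, because points are read through an
  enumeration of the vertices whose values beyond index 3 are arbitrary.\<close>

definition std3 :: "(nat \<Rightarrow> real) set" where
  "std3 = {\<xi>. 0 \<le> \<xi> 0 \<and> 0 \<le> \<xi> 1 \<and> 0 \<le> \<xi> 2 \<and> 0 \<le> \<xi> 3 \<and> \<xi> 0 + \<xi> 1 + \<xi> 2 + \<xi> 3 = 1}"

lemma simplex_to_sphere_cong:
  assumes "\<And>j. j < 4 \<Longrightarrow> \<xi> j = \<eta> j" shows "simplex_to_sphere \<xi> = simplex_to_sphere \<eta>"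
proof -
  have "\<xi> 0 = \<eta> 0" "\<xi> 1 = \<eta> 1" "\<xi> 2 = \<eta> 2" "\<xi> 3 = \<eta> 3" using assms by simp_all
  then have "spread \<xi> = spread \<eta>" "min4 \<xi> = min4 \<eta>" by (simp_all only: spread_def min4_def)
  then show ?thesis using assms by (auto simp: simplex_to_sphere_def fun_eq_iff)
qed

lemma denominator_pos:
  assumes "\<xi> \<in> std3" shows "0 < spread \<xi> + (min4 \<xi>)\<^sup>2"
proof (rule ccontr)
  assume "\<not> ?thesis"
  then have "(\<xi> 1 - \<xi> 0)\<^sup>2 + (\<xi> 2 - \<xi> 0)\<^sup>2 + (\<xi> 3 - \<xi> 0)\<^sup>2 + (min4 \<xi>)\<^sup>2 \<le> 0"
    by (simp add: spread_def)
  then have "(\<xi> 1 - \<xi> 0)\<^sup>2 = 0" "(\<xi> 2 - \<xi> 0)\<^sup>2 = 0" "(\<xi> 3 - \<xi> 0)\<^sup>2 = 0" "(min4 \<xi>)\<^sup>2 = 0"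
    using zero_le_power2[of "\<xi> 1 - \<xi> 0"] zero_le_power2[of "\<xi> 2 - \<xi> 0"]
      zero_le_power2[of "\<xi> 3 - \<xi> 0"] zero_le_power2[of "min4 \<xi>"] by linarith+
  then show False using assms by (simp add: min4_def std3_def)
qed

lemma topspace_nsphere3:
  "s \<in> topspace (nsphere 3) \<longleftrightarrow> (s 0)\<^sup>2 + (s 1)\<^sup>2 + (s 2)\<^sup>2 + (s 3)\<^sup>2 = 1 \<and> (\<forall>i\<ge>4. s i = 0)"
proof -
  have "(\<Sum>i\<le>3. (s i)\<^sup>2) = (s 0)\<^sup>2 + (s 1)\<^sup>2 + (s 2)\<^sup>2 + (s 3)\<^sup>2"
    by (simp add: numeral_3_eq_3 numeral_2_eq_2)
  moreover have "(\<forall>i>3. s i = 0) \<longleftrightarrow> (\<forall>i\<ge>4. s i = 0)"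
    by (metis Suc_le_eq eval_nat_numeral(2) semiring_norm(26,27) eval_nat_numeral(3))
  ultimately show ?thesis by (simp add: nsphere)
qed

lemma simplex_to_sphere_in:
  assumes "\<xi> \<in> std3" shows "simplex_to_sphere \<xi> \<in> topspace (nsphere 3)"
proof -
  define D where "D = spread \<xi> + (min4 \<xi>)\<^sup>2"
  have D: "D \<noteq> 0" using denominator_pos[OF assms] by (simp add: D_def)
  have "(spread \<xi> - (min4 \<xi>)\<^sup>2)\<^sup>2 + (2 * min4 \<xi> * (\<xi> 1 - \<xi> 0))\<^sup>2 + (2 * min4 \<xi> * (\<xi> 2 - \<xi> 0))\<^sup>2 +
      (2 * min4 \<xi> * (\<xi> 3 - \<xi> 0))\<^sup>2 = D\<^sup>2"
    unfolding D_def spread_def by algebra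
  then have "((spread \<xi> - (min4 \<xi>)\<^sup>2) / D)\<^sup>2 + (2 * min4 \<xi> * (\<xi> 1 - \<xi> 0) / D)\<^sup>2 +
      (2 * min4 \<xi> * (\<xi> 2 - \<xi> 0) / D)\<^sup>2 + (2 * min4 \<xi> * (\<xi> 3 - \<xi> 0) / D)\<^sup>2 = 1"
    using D by (simp add: power_divide flip: add_divide_distrib)
  then show ?thesis unfolding topspace_nsphere3 by (simp add: simplex_to_sphere_def D_def)
qed

lemma simplex_to_sphere_base_iff:
  assumes "\<xi> \<in> std3" shows "simplex_to_sphere \<xi> = sphere_base \<longleftrightarrow> min4 \<xi> = 0"
proof
  assume "simplex_to_sphere \<xi> = sphere_base"
  then have "(spread \<xi> - (min4 \<xi>)\<^sup>2) / (spread \<xi> + (min4 \<xi>)\<^sup>2) = 1"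
    by (metis (mono_tags, lifting) simplex_to_sphere_def sphere_base_def)
  then show "min4 \<xi> = 0" using denominator_pos[OF assms] by (simp add: field_simps)
next
  assume "min4 \<xi> = 0"
  then show "simplex_to_sphere \<xi> = sphere_base"
    using denominator_pos[OF assms] by (auto simp: simplex_to_sphere_def sphere_base_def)
qed

text \<open>Stereographic projection recovers the ratios
  \<open>(\<xi> k - \<xi> 0) / min4 \<xi>\<close> from the image. They fix \<open>\<xi>\<close> up
  to the scale \<open>min4 \<xi>\<close>, and the scale follows from the coordinate sum 1.\<close>

lemma simplex_to_sphere_inj:
  assumes \<xi>: "\<xi> \<in> std3" "0 < min4 \<xi>" and \<eta>: "\<eta> \<in> std3" "0 < min4 \<eta>"
    and eq: "simplex_to_sphere \<xi> = simplex_to_sphere \<eta>" and j: "j < 4"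
  shows "\<xi> j = \<eta> j"
proof -
  have ratio: "(\<zeta> k - \<zeta> 0) / min4 \<zeta> = simplex_to_sphere \<zeta> k / (1 - simplex_to_sphere \<zeta> 0)"
    if "\<zeta> \<in> std3" "0 < min4 \<zeta>" "k \<in> {1, 2, 3}" for \<zeta> k
  proof -
    define D where "D = spread \<zeta> + (min4 \<zeta>)\<^sup>2"
    have D: "0 < D" using denominator_pos[OF that(1)] by (simp add: D_def)
    have "1 - simplex_to_sphere \<zeta> 0 = 2 * (min4 \<zeta>)\<^sup>2 / D"
      using D by (simp add: simplex_to_sphere_def field_simps flip: D_def)
    moreover have "simplex_to_sphere \<zeta> k = 2 * min4 \<zeta> * (\<zeta> k - \<zeta> 0) / D"
      using that(3) by (auto simp: simplex_to_sphere_def D_def)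
    ultimately show ?thesis
      by (simp only:) (use D that(2) in \<open>simp add: power2_eq_square\<close>)
  qed
  define y where "y = (\<lambda>k. (\<xi> k - \<xi> 0) / min4 \<xi>)"
  have y: "\<zeta> k = \<zeta> 0 + min4 \<zeta> * y k" if "\<zeta> = \<xi> \<or> \<zeta> = \<eta>" "k \<in> {1, 2, 3}" for \<zeta> k
  proof -
    have "(\<zeta> k - \<zeta> 0) / min4 \<zeta> = y k"
      using that ratio[OF \<xi> that(2)] ratio[OF \<eta> that(2)] eq by (auto simp: y_def)
    moreover have "min4 \<zeta> \<noteq> 0" using that(1) \<xi> \<eta> by auto
    ultimately show ?thesis by (simp add: field_simps)
  qed
  \<comment> \<open>Dividing \<open>min4 \<zeta> = min (\<zeta> 0) ...\<close> by
    \<open>min4 \<zeta>\<close> shows that \<open>c\<close> is the ratio of \<open>\<zeta> 0\<close>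
    to \<open>min4 \<zeta>\<close>.\<close>
  define c where "c = 1 - min (min 0 (y 1)) (min (y 2) (y 3))"
  have z0: "\<zeta> 0 = min4 \<zeta> * c" if \<zeta>: "\<zeta> = \<xi> \<or> \<zeta> = \<eta>" for \<zeta>
  proof -
    have m: "0 < min4 \<zeta>" using \<zeta> \<xi> \<eta> by auto
    have "min4 \<zeta> = \<zeta> 0 + min4 \<zeta> * min (min 0 (y 1)) (min (y 2) (y 3))"
      by (subst min4_def) (use m y[OF \<zeta>] in \<open>simp add: min_add_distrib_right min_mult_distrib_left\<close>)
    then show ?thesis by (simp add: c_def algebra_simps)
  qed
  have sum1: "min4 \<zeta> * (4 * c + y 1 + y 2 + y 3) = 1" if \<zeta>: "\<zeta> = \<xi> \<or> \<zeta> = \<eta>" for \<zeta>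
  proof -
    have "\<zeta> 0 + \<zeta> 1 + \<zeta> 2 + \<zeta> 3 = 1" using \<zeta> \<xi> \<eta> by (auto simp: std3_def)
    then show ?thesis
      using y[OF \<zeta>, of 1] y[OF \<zeta>, of 2] y[OF \<zeta>, of 3] z0[OF \<zeta>] by (simp add: algebra_simps)
  qed
  then have "min4 \<xi> * (4 * c + y 1 + y 2 + y 3) = min4 \<eta> * (4 * c + y 1 + y 2 + y 3)"
    "4 * c + y 1 + y 2 + y 3 \<noteq> 0" by force+
  then have m: "min4 \<xi> = min4 \<eta>" by simp
  then have "\<xi> 0 = \<eta> 0" using z0[of \<xi>] z0[of \<eta>] by simp
  moreover have "j = 0 \<or> j \<in> {1, 2, 3}" using j by auto
  ultimately show ?thesis using y[of \<xi> j] y[of \<eta> j] m by auto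
qed

text \<open>Away from the base point, \<open>y\<close> holds the stereographic coordinates with a
  zero in place 0, \<open>w\<close> shifts them to have minimum 1, and division by \<open>t\<close>
  makes the sum 1. The base point comes from a vertex.\<close>

lemma simplex_to_sphere_surj:
  assumes s: "s \<in> topspace (nsphere 3)"
  shows "\<exists>\<xi>\<in>std3. simplex_to_sphere \<xi> = s"
proof (cases "s = sphere_base")
  case True
  let ?\<xi> = "\<lambda>j::nat. if j = 0 then 1 else 0 :: real"
  have "?\<xi> \<in> std3" "min4 ?\<xi> = 0" by (auto simp: std3_def min4_def)
  then show ?thesis using simplex_to_sphere_base_iff True by blast
next
  case False
  have s1: "(s 0)\<^sup>2 + (s 1)\<^sup>2 + (s 2)\<^sup>2 + (s 3)\<^sup>2 = 1" and s4: "\<And>i. 4 \<le> i \<Longrightarrow> s i = 0"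
    using s by (auto simp: topspace_nsphere3)
  have "s 0 \<noteq> 1"
  proof
    assume s0: "s 0 = 1"
    then have "(s 1)\<^sup>2 = 0" "(s 2)\<^sup>2 = 0" "(s 3)\<^sup>2 = 0"
      using s1 zero_le_power2[of "s 1"] zero_le_power2[of "s 2"] zero_le_power2[of "s 3"] by (smt (verit) one_power2)+
    then have "s 1 = 0" "s 2 = 0" "s 3 = 0" by simp_all
    have "s j = sphere_base j" for j
    proof -
      have "j = 0 \<or> j = 1 \<or> j = 2 \<or> j = 3 \<or> 4 \<le> j" by auto
      then show ?thesis using s0 s4[of j] \<open>s 1 = 0\<close> \<open>s 2 = 0\<close> \<open>s 3 = 0\<close> by (auto simp: sphere_base_def)
    qed
    then show False using False by blast
  qed
  define u where "u = 1 - s 0"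
  have u: "u \<noteq> 0" using \<open>s 0 \<noteq> 1\<close> by (simp add: u_def)
  define y where "y = (\<lambda>j::nat. if j = 0 then 0 else s j / u)"
  define mn where "mn = min (min (y 0) (y 1)) (min (y 2) (y 3))"
  define w where "w = (\<lambda>j. 1 + y j - mn)"
  have w: "1 \<le> w 0" "1 \<le> w 1" "1 \<le> w 2" "1 \<le> w 3" by (auto simp: w_def mn_def)
  define t where "t = w 0 + w 1 + w 2 + w 3"
  have t: "0 < t" using w by (simp add: t_def)
  define \<xi> where "\<xi> = (\<lambda>j. w j / t)"
  have in_std: "\<xi> \<in> std3"
    using w t by (simp add: std3_def \<xi>_def flip: add_divide_distrib) (simp add: t_def)
  have "min (min (w 0) (w 1)) (min (w 2) (w 3)) = 1"
    unfolding w_def mn_def by (auto simp: min_def)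
  moreover have "min4 \<xi> = min (min (w 0) (w 1)) (min (w 2) (w 3)) / t"
    using t by (simp add: min4_def \<xi>_def min_divide_distrib_right)
  ultimately have m: "min4 \<xi> = 1 / t" by simp
  have d: "\<xi> j - \<xi> 0 = y j / t" for j
    by (simp add: \<xi>_def w_def y_def flip: diff_divide_distrib)
  define Y where "Y = (y 1)\<^sup>2 + (y 2)\<^sup>2 + (y 3)\<^sup>2"
  have sp: "spread \<xi> = Y / t\<^sup>2"
    by (simp add: spread_def d Y_def power_divide add_divide_distrib)
  have "Y = ((s 1)\<^sup>2 + (s 2)\<^sup>2 + (s 3)\<^sup>2) / u\<^sup>2"
    by (simp add: Y_def y_def power_divide add_divide_distrib)
  also have "(s 1)\<^sup>2 + (s 2)\<^sup>2 + (s 3)\<^sup>2 = u * (2 - u)"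
    using s1 by (simp add: u_def power2_eq_square algebra_simps)
  finally have Y: "Y = (2 - u) / u" using u by (simp add: power2_eq_square)
  then have Y1: "Y + 1 = 2 / u" using u by (simp add: field_simps)
  have den: "spread \<xi> + (min4 \<xi>)\<^sup>2 = 2 / (u * t\<^sup>2)"
    using Y1 by (simp add: sp m power_divide flip: add_divide_distrib)
  have num: "spread \<xi> - (min4 \<xi>)\<^sup>2 = (2 - 2 * u) / (u * t\<^sup>2)"
    using u t by (simp add: sp m power_divide Y field_simps)
  have "simplex_to_sphere \<xi> j = s j" for j
  proof -
    have "simplex_to_sphere \<xi> 0 = s 0"
      using u t by (simp add: simplex_to_sphere_def num den) (simp add: u_def field_simps)
    moreover have "simplex_to_sphere \<xi> j = s j" if "j \<noteq> 0" "j < 4"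
    proof -
      have "simplex_to_sphere \<xi> j = 2 * min4 \<xi> * (\<xi> j - \<xi> 0) / (2 / (u * t\<^sup>2))"
        using that unfolding simplex_to_sphere_def den by simp
      also have "\<dots> = s j"
        unfolding m d using that u t by (simp add: y_def power2_eq_square)
      finally show ?thesis .
    qed
    moreover have "simplex_to_sphere \<xi> j = s j" if "4 \<le> j"
      using that s4 by (simp add: simplex_to_sphere_def)
    ultimately show ?thesis by (cases "j = 0"; cases "j < 4") auto
  qed
  then show ?thesis using in_std by blast
qed

lemma continuous_on_simplex_to_sphere:
  fixes X :: "'b::topological_space \<Rightarrow> nat \<Rightarrow> real"
  assumes "\<And>j. continuous_on S (\<lambda>x. X x j)" "\<And>x. x \<in> S \<Longrightarrow> X x \<in> std3"
  shows "continuous_on S (\<lambda>x. simplex_to_sphere (X x))"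
proof (rule continuous_on_coordinatewise_then_product)
  fix j :: nat
  have m: "continuous_on S (\<lambda>x. min4 (X x))" and sp: "continuous_on S (\<lambda>x. spread (X x))"
    unfolding min4_def spread_def by (intro continuous_intros assms(1))+
  have nz: "\<forall>x\<in>S. spread (X x) + (min4 (X x))\<^sup>2 \<noteq> 0" using denominator_pos assms(2) by fastforce
  consider "j = 0" | "j \<noteq> 0" "j < 4" | "\<not> j < 4" by linarith
  then show "continuous_on S (\<lambda>x. simplex_to_sphere (X x) j)"
  proof cases
    case 1 then show ?thesis unfolding simplex_to_sphere_def using nz by (simp, intro continuous_intros m sp)
  next
    case 2 then show ?thesis unfolding simplex_to_sphere_def using nz by (simp, intro continuous_intros m sp assms(1))
  next
    case 3 then show ?thesis by (simp add: simplex_to_sphere_def)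
  qed
qed

subsection \<open>The wedge of spheres\<close>

lemma istopology_wedge:
  "istopology (\<lambda>U. U \<subseteq> (\<Union>i. wedge_incl i ` topspace (nsphere 3)) \<and>
      (\<forall>i. openin (nsphere 3) {x \<in> topspace (nsphere 3). wedge_incl i x \<in> U}))"
  unfolding istopology_def
proof (intro conjI allI impI)
  fix U V :: "(nat \<times> (nat \<Rightarrow> real)) set" and i
  assume "U \<subseteq> (\<Union>i. wedge_incl i ` topspace (nsphere 3)) \<and>
      (\<forall>i. openin (nsphere 3) {x \<in> topspace (nsphere 3). wedge_incl i x \<in> U})"
    "V \<subseteq> (\<Union>i. wedge_incl i ` topspace (nsphere 3)) \<and>
      (\<forall>i. openin (nsphere 3) {x \<in> topspace (nsphere 3). wedge_incl i x \<in> V})"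
  then have "openin (nsphere 3)
      ({x \<in> topspace (nsphere 3). wedge_incl i x \<in> U} \<inter> {x \<in> topspace (nsphere 3). wedge_incl i x \<in> V})"
    by (intro openin_Int) blast+
  moreover have "{x \<in> topspace (nsphere 3). wedge_incl i x \<in> U} \<inter> {x \<in> topspace (nsphere 3). wedge_incl i x \<in> V}
      = {x \<in> topspace (nsphere 3). wedge_incl i x \<in> U \<inter> V}" by blast
  ultimately show "openin (nsphere 3) {x \<in> topspace (nsphere 3). wedge_incl i x \<in> U \<inter> V}"
    by simp
next
  fix \<U> :: "(nat \<times> (nat \<Rightarrow> real)) set set" and i
  assume "\<forall>U\<in>\<U>. U \<subseteq> (\<Union>i. wedge_incl i ` topspace (nsphere 3)) \<and>
      (\<forall>i. openin (nsphere 3) {x \<in> topspace (nsphere 3). wedge_incl i x \<in> U})"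
  then have "openin (nsphere 3) (\<Union>((\<lambda>U. {x \<in> topspace (nsphere 3). wedge_incl i x \<in> U}) ` \<U>))"
    by (intro openin_Union) blast
  moreover have "{x \<in> topspace (nsphere 3). wedge_incl i x \<in> \<Union>\<U>} =
      \<Union>((\<lambda>U. {x \<in> topspace (nsphere 3). wedge_incl i x \<in> U}) ` \<U>)" by blast
  ultimately show "openin (nsphere 3) {x \<in> topspace (nsphere 3). wedge_incl i x \<in> \<Union>\<U>}" by simp
qed blast+

lemma openin_wedge:
  "openin wedge_S3_nat U \<longleftrightarrow> U \<subseteq> (\<Union>i. wedge_incl i ` topspace (nsphere 3)) \<and>
      (\<forall>i. openin (nsphere 3) {x \<in> topspace (nsphere 3). wedge_incl i x \<in> U})"
  unfolding wedge_S3_nat_def by (subst topology_inverse'[OF istopology_wedge]) (rule refl)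

lemma topspace_wedge: "topspace wedge_S3_nat = (\<Union>i. wedge_incl i ` topspace (nsphere 3))"
proof -
  have "{x \<in> topspace (nsphere 3). wedge_incl i x \<in> (\<Union>i. wedge_incl i ` topspace (nsphere 3))} =
      topspace (nsphere 3)" for i by blast
  then have "openin wedge_S3_nat (\<Union>i. wedge_incl i ` topspace (nsphere 3))"
    unfolding openin_wedge by simp
  moreover have "topspace wedge_S3_nat \<subseteq> (\<Union>i. wedge_incl i ` topspace (nsphere 3))"
    using openin_topspace[of wedge_S3_nat] unfolding openin_wedge by (rule conjunct1)
  ultimately show ?thesis by (simp add: openin_subset subset_antisym)
qed

lemma final_topology_wedge: "final_topology UNIV (\<lambda>_. nsphere 3) wedge_incl wedge_S3_nat"
  by (simp add: final_topology_def topspace_wedge openin_wedge)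

lemma wedge_incl_base: "wedge_incl i sphere_base = (0, sphere_base)"
  by (simp add: wedge_incl_def)

lemma sphere_base_in: "sphere_base \<in> topspace (nsphere 3)"
  by (simp add: sphere_base_def in_topspace_nsphere)

lemma Hausdorff_nsphere: "Hausdorff_space (nsphere n)"
  unfolding nsphere_def by (intro Hausdorff_space_subtopology Hausdorff_Euclidean_space)

subsection \<open>Complexes that are contractible up to tetrahedra\<close>

text \<open>Isolates what the final collapse uses: a contraction of \<open>T\<close>, and a sequence
  of tetrahedra outside \<open>T\<close> with boundary in \<open>T\<close>. The lattice no longer
  appears.\<close>

locale tetrahedra_over_contractible =
  fixes K T :: "'a set set" and \<sigma> :: "nat \<Rightarrow> 'a set" and C :: "real \<times> ('a \<Rightarrow> real) \<Rightarrow> 'a \<Rightarrow> real" and b :: "'a \<Rightarrow> real"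
  assumes K: "simplicial_complex K" and T: "simplicial_complex T" "T \<subseteq> K"
    and \<sigma>: "bij_betw \<sigma> UNIV (K - T)"
    and card_\<sigma>: "\<And>i. card (\<sigma> i) = 4"
    and face_\<sigma>: "\<And>i \<tau>. \<tau> \<subset> \<sigma> i \<Longrightarrow> \<tau> \<noteq> {} \<Longrightarrow> \<tau> \<in> T"
    and C: "continuous_map (prod_topology unit_interval (geom_realization T)) (geom_realization T) C"
    and C0: "\<And>x. x \<in> realization_set T \<Longrightarrow> C (0, x) = x"
    and C1: "\<And>x. x \<in> realization_set T \<Longrightarrow> C (1, x) = b"
begin

definition \<mu> :: "nat \<Rightarrow> ('a \<Rightarrow> real) \<Rightarrow> real" where
  "\<mu> i x = Min (x ` \<sigma> i)"

definition vx :: "nat \<Rightarrow> nat \<Rightarrow> 'a" where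
  "vx i = (SOME e. bij_betw e {..<4} (\<sigma> i))"

definition q :: "nat \<Rightarrow> ('a \<Rightarrow> real) \<Rightarrow> nat \<Rightarrow> real" where
  "q i x = simplex_to_sphere (\<lambda>j. x (vx i j))"

text \<open>Meaningful only for points in the interior of a tetrahedron outside \<open>T\<close>,
  where the index is unique.\<close>

definition cell :: "('a \<Rightarrow> real) \<Rightarrow> nat" where
  "cell x = (SOME i. x \<in> geom_simplex (\<sigma> i))"

definition f :: "('a \<Rightarrow> real) \<Rightarrow> nat \<times> (nat \<Rightarrow> real)" where
  "f x = (if x \<in> realization_set T then (0, sphere_base) else wedge_incl (cell x) (q (cell x) x))"

lemma \<sigma>_props: "\<sigma> i \<in> K" "\<sigma> i \<notin> T" "finite (\<sigma> i)" "\<sigma> i \<noteq> {}"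
proof -
  show "\<sigma> i \<in> K" "\<sigma> i \<notin> T" using \<sigma> by (auto simp: bij_betw_def)
  then show "finite (\<sigma> i)" "\<sigma> i \<noteq> {}" using K by (auto simp: simplicial_complex_def)
qed

lemma \<sigma>_inj: "\<sigma> i = \<sigma> j \<Longrightarrow> i = j"
  using \<sigma> by (auto simp: bij_betw_def inj_on_def)

lemma vx: "bij_betw (vx i) {..<4} (\<sigma> i)"
proof -
  have "\<exists>e. bij_betw e {..<4::nat} (\<sigma> i)"
    using ex_bij_betw_nat_finite[OF \<sigma>_props(3)[of i]] card_\<sigma>[of i] by (simp add: lessThan_atLeast0)
  then show ?thesis unfolding vx_def by (rule someI_ex)
qed

lemma vx_image: "\<sigma> i = {vx i 0, vx i 1, vx i 2, vx i 3}"
proof -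
  have "{..<4::nat} = {0, 1, 2, 3}" by auto
  then show ?thesis using vx[of i] by (auto simp: bij_betw_def)
qed

lemma sum_\<sigma>: "sum g (\<sigma> i) = g (vx i 0) + g (vx i 1) + g (vx i 2) + (g (vx i 3) :: real)"
proof -
  have "sum g (\<sigma> i) = (\<Sum>j<4. g (vx i j))"
    using sum.reindex_bij_betw[OF vx[of i], of g] by simp
  then show ?thesis by (simp add: eval_nat_numeral)
qed

lemma \<mu>_min4: "\<mu> i x = min4 (\<lambda>j. x (vx i j))"
  unfolding \<mu>_def min4_def by (subst vx_image) (simp add: min.assoc)

lemma std3: "x \<in> geom_simplex (\<sigma> i) \<Longrightarrow> (\<lambda>j. x (vx i j)) \<in> std3"
  using sum_\<sigma>[of x i] by (simp add: geom_simplex_def std3_def)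

lemma \<mu>_le: "v \<in> \<sigma> i \<Longrightarrow> \<mu> i x \<le> x v"
  using \<sigma>_props(3) by (simp add: \<mu>_def)

lemma \<mu>_attained: "\<exists>v\<in>\<sigma> i. \<mu> i x = x v"
proof -
  have "\<mu> i x \<in> x ` \<sigma> i" unfolding \<mu>_def using \<sigma>_props(3,4) by (intro Min_in) auto
  then show ?thesis by blast
qed

lemma \<mu>_nonneg: "x \<in> geom_simplex (\<sigma> i) \<Longrightarrow> 0 \<le> \<mu> i x"
  using \<mu>_attained[of i x] geom_simplex_nonneg by metis

text \<open>A finite subcomplex of \<open>T\<close> that receives the points arriving at the
  boundary; finiteness allows continuity to be checked in coordinates.\<close>

definition bd :: "nat \<Rightarrow> 'a set set" where
  "bd i = {\<tau>. \<tau> \<subset> \<sigma> i \<and> \<tau> \<noteq> {}}"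

lemma bd: "finite (bd i)" "bd i \<subseteq> T" "realization_set (bd i) \<subseteq> realization_set T"
proof -
  show "finite (bd i)" by (rule finite_subset[of _ "Pow (\<sigma> i)"]) (use \<sigma>_props(3) in \<open>auto simp: bd_def\<close>)
  show "bd i \<subseteq> T" using face_\<sigma> by (auto simp: bd_def)
  then show "realization_set (bd i) \<subseteq> realization_set T" by (rule realization_set_mono)
qed

lemma in_bd:
  assumes "x \<in> geom_simplex (\<sigma> i)" "\<mu> i x = 0" shows "x \<in> realization_set (bd i)"
proof -
  obtain v where v: "v \<in> \<sigma> i" "x v = 0" using \<mu>_attained[of i x] assms(2) by auto
  have x: "x \<in> geom_simplex (\<sigma> i - {v})"
    by (rule geom_simplex_restrict[OF assms(1) \<sigma>_props(3)]) (use v in auto)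
  then have "\<sigma> i - {v} \<noteq> {}" by force
  then have "\<sigma> i - {v} \<in> bd i" using v by (auto simp: bd_def)
  then show ?thesis using x unfolding realization_set_def by (rule UN_I)
qed

text \<open>All four coordinates are positive, so a simplex of \<open>K\<close> carrying the point
  contains \<open>\<sigma> i\<close>. It cannot belong to \<open>T\<close>, hence it too has four
  vertices.\<close>

lemma interior_support:
  assumes "x \<in> geom_simplex (\<sigma> i)" "0 < \<mu> i x" "x \<in> geom_simplex \<rho>" "\<rho> \<in> K"
  shows "\<rho> = \<sigma> i"
proof -
  have sub: "\<sigma> i \<subseteq> \<rho>"
  proof
    fix v assume "v \<in> \<sigma> i"
    then have "0 < x v" using \<mu>_le[of v i x] assms(2) by simp
    then show "v \<in> \<rho>" using geom_simplex_outside[OF assms(3)] by force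
  qed
  have "\<rho> \<notin> T"
  proof
    assume "\<rho> \<in> T"
    then have "\<sigma> i \<in> T" using T(1) sub \<sigma>_props(4) unfolding simplicial_complex_def by blast
    then show False using \<sigma>_props(2) by blast
  qed
  then obtain j where j: "\<rho> = \<sigma> j" using assms(4) \<sigma> by (auto simp: bij_betw_def)
  have "card (\<sigma> i) = card \<rho>" using j card_\<sigma> by simp
  then show ?thesis using card_subset_eq[OF _ sub] j \<sigma>_props(3) by metis
qed

lemma in_T_iff: "x \<in> geom_simplex (\<sigma> i) \<Longrightarrow> x \<in> realization_set T \<longleftrightarrow> \<mu> i x = 0"
proof
  assume x: "x \<in> geom_simplex (\<sigma> i)" "x \<in> realization_set T"
  then obtain \<rho> where "\<rho> \<in> T" "x \<in> geom_simplex \<rho>" by (auto simp: realization_set_def)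
  then have "\<not> 0 < \<mu> i x" using interior_support[OF x(1), of \<rho>] T(2) \<sigma>_props(2)[of i] by auto
  then show "\<mu> i x = 0" using \<mu>_nonneg[OF x(1)] by simp
qed (use in_bd bd(3) in blast)

lemma K_cases:
  assumes "x \<in> realization_set K"
  obtains "x \<in> realization_set T" | i where "x \<in> geom_simplex (\<sigma> i)" "0 < \<mu> i x"
proof -
  obtain \<rho> where \<rho>: "\<rho> \<in> K" "x \<in> geom_simplex \<rho>" using assms by (auto simp: realization_set_def)
  show ?thesis
  proof (cases "\<rho> \<in> T")
    case True
    then show ?thesis using \<rho>(2) that(1) by (auto simp: realization_set_def)
  next
    case False
    then obtain i where i: "\<rho> = \<sigma> i" using \<rho>(1) \<sigma> by (auto simp: bij_betw_def)
    then have x: "x \<in> geom_simplex (\<sigma> i)" using \<rho>(2) by simp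
    show ?thesis using that x in_T_iff[OF x] \<mu>_nonneg[OF x] by (cases "\<mu> i x = 0") auto
  qed
qed

lemma cell: 
  assumes "x \<in> geom_simplex (\<sigma> i)" "0 < \<mu> i x" shows "cell x = i"
proof -
  have "x \<in> geom_simplex (\<sigma> (cell x))" unfolding cell_def using assms(1) by (rule someI)
  then show ?thesis using interior_support[OF assms _ \<sigma>_props(1)] \<sigma>_inj by metis
qed

lemma q_base_iff: "x \<in> geom_simplex (\<sigma> i) \<Longrightarrow> q i x = sphere_base \<longleftrightarrow> \<mu> i x = 0"
  unfolding q_def \<mu>_min4 by (rule simplex_to_sphere_base_iff[OF std3])

text \<open>The formula holds up to the boundary: there \<open>q i\<close> hits the base point,
  which the wedge identifies with the image of \<open>T\<close>.\<close>

lemma f_cell: "x \<in> geom_simplex (\<sigma> i) \<Longrightarrow> f x = wedge_incl i (q i x)"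
  using in_T_iff[of x i] q_base_iff[of x i] cell[of x i] \<mu>_nonneg[of x i] wedge_incl_base
  by (cases "\<mu> i x = 0") (auto simp: f_def)

lemma f_T: "x \<in> realization_set T \<Longrightarrow> f x = (0, sphere_base)"
  by (simp add: f_def)

lemma q_in: "x \<in> geom_simplex (\<sigma> i) \<Longrightarrow> q i x \<in> topspace (nsphere 3)"
  unfolding q_def by (rule simplex_to_sphere_in[OF std3])

lemma q_surj:
  assumes "s \<in> topspace (nsphere 3)" shows "\<exists>x\<in>geom_simplex (\<sigma> i). q i x = s"
proof -
  obtain \<xi> where \<xi>: "\<xi> \<in> std3" "simplex_to_sphere \<xi> = s" using simplex_to_sphere_surj[OF assms] by blast
  define x where "x = (\<lambda>v. if v \<in> \<sigma> i then \<xi> (the_inv_into {..<4} (vx i) v) else 0)"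
  have xv: "x (vx i j) = \<xi> j" if "j < 4" for j
    using that vx[of i] by (auto simp: x_def bij_betw_def the_inv_into_f_f)
  have "x \<in> geom_simplex (\<sigma> i)"
    unfolding geom_simplex_def
  proof (intro CollectI conjI allI impI)
    show "sum x (\<sigma> i) = 1" using \<xi>(1) by (simp add: sum_\<sigma> xv std3_def)
    show "0 \<le> x v" for v
    proof (cases "v \<in> \<sigma> i")
      case True
      then show ?thesis using vx_image[of i] xv \<xi>(1) by (auto simp: std3_def)
    qed (simp add: x_def)
  qed (simp add: x_def)
  moreover have "q i x = s"
    using simplex_to_sphere_cong[of "\<lambda>j. x (vx i j)" \<xi>] xv \<xi>(2) by (simp add: q_def)
  ultimately show ?thesis by blast
qed

lemma continuous_on_\<mu>: "continuous_on S (\<mu> i)"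
  unfolding \<mu>_def
  by (rule continuous_on_Min_image[where f = "\<lambda>v x. x v", OF \<sigma>_props(3,4)])
    (rule continuous_on_subset[OF continuous_on_product_coordinates subset_UNIV])

lemma continuous_map_q: "continuous_map (top_of_set (geom_simplex (\<sigma> i))) (nsphere 3) (q i)"
proof -
  have "continuous_on (geom_simplex (\<sigma> i)) (q i)"
    unfolding q_def
    by (intro continuous_on_simplex_to_sphere std3 continuous_on_subset[OF continuous_on_product_coordinates]) auto
  moreover obtain S where S: "nsphere 3 = top_of_set S"
    unfolding nsphere powertop_real_eq_euclidean by blast
  moreover have "q i \<in> geom_simplex (\<sigma> i) \<rightarrow> S" using q_in S by auto
  ultimately show ?thesis
    by (simp only: continuous_map_subtopology_eu)
qed

lemma quotient_map_q: "quotient_map (top_of_set (geom_simplex (\<sigma> i))) (nsphere 3) (q i)"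
proof (rule continuous_imp_quotient_map[OF continuous_map_q _ Hausdorff_nsphere])
  show "compact_space (top_of_set (geom_simplex (\<sigma> i)))"
    using compact_geom_simplex[OF \<sigma>_props(3)] by (simp add: compact_space_subtopology)
  show "q i ` topspace (top_of_set (geom_simplex (\<sigma> i))) = topspace (nsphere 3)"
  proof (intro equalityI subsetI)
    fix s assume "s \<in> topspace (nsphere 3)"
    then obtain x where "x \<in> geom_simplex (\<sigma> i)" "q i x = s" using q_surj by blast
    then show "s \<in> q i ` topspace (top_of_set (geom_simplex (\<sigma> i)))" by auto
  qed (use q_in in auto)
qed

text \<open>A set in the wedge is tested on each sphere, and each sphere is a quotient of its
  tetrahedron; so an open preimage in the realization already gives openness in the wedge.\<close>

lemma quotient_map_f: "quotient_map (geom_realization K) wedge_S3_nat f"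
proof -
  have wc: "continuous_map (nsphere 3) wedge_S3_nat (wedge_incl i)" for i
    using final_topology_continuous_map_component[OF final_topology_wedge] by simp
  have base: "(0, sphere_base) \<in> topspace wedge_S3_nat"
  proof -
    have "wedge_incl 0 sphere_base \<in> topspace wedge_S3_nat"
      unfolding topspace_wedge using sphere_base_in by blast
    then show ?thesis by (simp only: wedge_incl_base)
  qed
  have cont: "continuous_map (geom_realization K) wedge_S3_nat f"
    unfolding continuous_map_geom_realization
  proof
    fix \<rho> assume \<rho>: "\<rho> \<in> K"
    show "continuous_map (top_of_set (geom_simplex \<rho>)) wedge_S3_nat f"
    proof (cases "\<rho> \<in> T")
      case True
      then have "f x = (0, sphere_base)" if "x \<in> geom_simplex \<rho>" for x
        using that by (intro f_T) (auto simp: realization_set_def)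
      then show ?thesis
        using continuous_map_eq[of "top_of_set (geom_simplex \<rho>)" wedge_S3_nat "\<lambda>_. (0, sphere_base)" f] base
        by simp
    next
      case False
      then obtain i where i: "\<rho> = \<sigma> i" using \<rho> \<sigma> by (auto simp: bij_betw_def)
      have "continuous_map (top_of_set (geom_simplex (\<sigma> i))) wedge_S3_nat (wedge_incl i \<circ> q i)"
        by (rule continuous_map_compose[OF continuous_map_q wc])
      then show ?thesis
        using continuous_map_eq[of "top_of_set (geom_simplex \<rho>)" wedge_S3_nat "wedge_incl i \<circ> q i" f] f_cell i
        by simp
    qed
  qed
  have sub: "geom_simplex (\<sigma> i) \<subseteq> realization_set K" for i
    using \<sigma>_props(1) by (auto simp: realization_set_def)
  show ?thesis
    unfolding quotient_map_def
  proof (intro conjI allI impI)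
    have "w \<in> f ` realization_set K" if "w \<in> topspace wedge_S3_nat" for w
    proof -
      obtain i s where "w = wedge_incl i s" "s \<in> topspace (nsphere 3)" using \<open>w \<in> _\<close> unfolding topspace_wedge by blast
      then obtain x where "x \<in> geom_simplex (\<sigma> i)" "w = f x" using q_surj f_cell by metis
      then show ?thesis using sub by blast
    qed
    then show "f ` topspace (geom_realization K) = topspace wedge_S3_nat"
      using continuous_map_image_subset_topspace[OF cont] by auto
    fix U assume U: "U \<subseteq> topspace wedge_S3_nat"
    show "openin (geom_realization K) {x \<in> topspace (geom_realization K). f x \<in> U} = openin wedge_S3_nat U"
    proof
      assume op: "openin (geom_realization K) {x \<in> topspace (geom_realization K). f x \<in> U}"
      have "openin (nsphere 3) {s \<in> topspace (nsphere 3). wedge_incl i s \<in> U}" (is "openin _ ?V") for i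
      proof -
        have "openin (top_of_set (geom_simplex (\<sigma> i))) ({x \<in> topspace (geom_realization K). f x \<in> U} \<inter> geom_simplex (\<sigma> i))"
          using op \<sigma>_props(1) unfolding openin_geom_realization by blast
        moreover have "{x \<in> topspace (geom_realization K). f x \<in> U} \<inter> geom_simplex (\<sigma> i) =
            {x \<in> topspace (top_of_set (geom_simplex (\<sigma> i))). q i x \<in> ?V}"
        proof -
          have "x \<in> realization_set K \<and> (f x \<in> U \<longleftrightarrow> q i x \<in> ?V)" if "x \<in> geom_simplex (\<sigma> i)" for x
            unfolding mem_Collect_eq f_cell[OF that] using subsetD[OF sub that] q_in[OF that] by blast
          then show ?thesis unfolding topspace_geom_realization topspace_euclidean_subtopology by blast
        qed
        moreover have "openin (top_of_set (geom_simplex (\<sigma> i))) {x \<in> topspace (top_of_set (geom_simplex (\<sigma> i))). q i x \<in> ?V}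
            \<longleftrightarrow> openin (nsphere 3) ?V"
          by (rule mp[OF spec[OF conjunct2[OF quotient_map_q[of i, unfolded quotient_map_def]]]]) blast
        ultimately show ?thesis by simp
      qed
      then show "openin wedge_S3_nat U" unfolding openin_wedge using U topspace_wedge by simp
    qed (rule openin_continuous_map_preimage[OF cont])
  qed
qed

text \<open>Each tetrahedron is stretched radially from its barycentre; once a point has reached the
  boundary it follows the contraction of \<open>T\<close>.\<close>

definition push :: "nat \<Rightarrow> ('a \<Rightarrow> real) \<Rightarrow> 'a \<Rightarrow> real" where
  "push i x = (\<lambda>v. if v \<in> \<sigma> i then (x v - \<mu> i x) / (1 - 4 * \<mu> i x) else 0)"

text \<open>Split a point into a multiple of the barycentre of weight \<open>4 * \<mu>\<close> and a
  remainder. At time \<open>t\<close> the weight is moved by the affine map taking the interval from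
  \<open>t / 2\<close> to 1 onto that from 0 to 1, and the factor \<open>2 / (2 - t)\<close> on the
  remainder keeps the total 1.\<close>

definition stretch :: "nat \<Rightarrow> real \<times> ('a \<Rightarrow> real) \<Rightarrow> 'a \<Rightarrow> real" where
  "stretch i p = (\<lambda>v. if v \<in> \<sigma> i
     then (8 * \<mu> i (snd p) - fst p) / (2 - fst p) / 4 + 2 / (2 - fst p) * (snd p v - \<mu> i (snd p)) else 0)"

text \<open>The boundary is reached at time \<open>8 * \<mu>\<close>, and the remaining time is
  spent in \<open>C\<close>. Points that arrive by time 1 have \<open>4 * \<mu>\<close> at most 1/2,
  which keeps \<open>push\<close> away from the barycentre, where its denominator vanishes.\<close>

definition g :: "nat \<Rightarrow> real \<times> ('a \<Rightarrow> real) \<Rightarrow> 'a \<Rightarrow> real" where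
  "g i p = (if 8 * \<mu> i (snd p) \<le> fst p then C (fst p - 8 * \<mu> i (snd p), push i (snd p)) else stretch i p)"

text \<open>An explicit homotopy extension for the pair of \<open>K\<close> and \<open>T\<close>: it
  starts at the identity and restricts to \<open>C\<close> on \<open>T\<close>.\<close>

definition h :: "real \<times> ('a \<Rightarrow> real) \<Rightarrow> 'a \<Rightarrow> real" where
  "h p = (if snd p \<in> realization_set T then C p else g (cell (snd p)) p)"

lemma push_in_bd:
  assumes x: "x \<in> geom_simplex (\<sigma> i)" and m: "4 * \<mu> i x < 1"
  shows "push i x \<in> realization_set (bd i)"
proof (rule in_bd)
  have vx_in: "vx i 0 \<in> \<sigma> i" "vx i 1 \<in> \<sigma> i" "vx i 2 \<in> \<sigma> i" "vx i 3 \<in> \<sigma> i" using vx_image by blast+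
  have "sum (push i x) (\<sigma> i) = (sum x (\<sigma> i) - 4 * \<mu> i x) / (1 - 4 * \<mu> i x)"
    using vx_in by (simp add: sum_\<sigma> push_def flip: add_divide_distrib)
  also have "\<dots> = 1" using x m by (simp add: geom_simplex_def)
  finally show "push i x \<in> geom_simplex (\<sigma> i)"
    unfolding geom_simplex_def using m \<mu>_le by (auto simp: push_def)
  then have "0 \<le> \<mu> i (push i x)" by (rule \<mu>_nonneg)
  moreover obtain v where "v \<in> \<sigma> i" "\<mu> i x = x v" using \<mu>_attained by blast
  then have "\<mu> i (push i x) \<le> 0" using \<mu>_le[of v i "push i x"] by (simp add: push_def)
  ultimately show "\<mu> i (push i x) = 0" by simp
qed

lemma push_id:
  assumes "x \<in> geom_simplex (\<sigma> i)" "\<mu> i x = 0" shows "push i x = x"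
  using assms geom_simplex_outside[OF assms(1)] by (auto simp: push_def)

lemma stretch_in:
  assumes x: "x \<in> geom_simplex (\<sigma> i)" and t: "t \<in> {0..1}" and le: "t \<le> 8 * \<mu> i x"
  shows "stretch i (t, x) \<in> geom_simplex (\<sigma> i)"
proof -
  have vx_in: "vx i 0 \<in> \<sigma> i" "vx i 1 \<in> \<sigma> i" "vx i 2 \<in> \<sigma> i" "vx i 3 \<in> \<sigma> i" using vx_image by blast+
  have s1: "x (vx i 0) + x (vx i 1) + x (vx i 2) + x (vx i 3) = 1" using std3[OF x] by (simp add: std3_def)
  have t2: "2 - t \<noteq> 0" using t by auto
  define a c where "a = (8 * \<mu> i x - t) / (2 - t)" and "c = 2 / (2 - t)"
  have st: "stretch i (t, x) v = a / 4 + c * (x v - \<mu> i x)" if "v \<in> \<sigma> i" for v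
    using that by (simp add: stretch_def a_def c_def)
  have "sum (stretch i (t, x)) (\<sigma> i) =
      a + c * (x (vx i 0) + x (vx i 1) + x (vx i 2) + x (vx i 3) - 4 * \<mu> i x)"
    using vx_in by (simp add: sum_\<sigma> st algebra_simps)
  also have "\<dots> = a + c * (1 - 4 * \<mu> i x)" by (simp only: s1)
  also have "\<dots> = (8 * \<mu> i x - t + 2 * (1 - 4 * \<mu> i x)) / (2 - t)"
    by (simp only: a_def c_def add_divide_distrib times_divide_eq_left)
  also have "\<dots> = 1" using t2 by simp
  finally have "sum (stretch i (t, x)) (\<sigma> i) = 1" .
  moreover have "0 \<le> stretch i (t, x) v" for v
    using t le \<mu>_le[of v i x] by (simp add: stretch_def)
  ultimately show ?thesis by (simp add: geom_simplex_def stretch_def)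
qed

lemma push_eq_stretch:
  assumes "t = 8 * \<mu> i x" "t \<in> {0..1}" shows "push i x = stretch i (t, x)"
proof -
  have e: "1 - 4 * \<mu> i x = (2 - t) / 2" "8 * \<mu> i x - t = 0" using assms by auto
  have "(x v - \<mu> i x) / (1 - 4 * \<mu> i x) = 2 / (2 - t) * (x v - \<mu> i x)" for v
    unfolding e(1) by simp
  note r = this
  show ?thesis unfolding push_def stretch_def fst_conv snd_conv e(2) r by (intro ext) (simp only: div_0 add_0)
qed

lemma continuous_map_g:
  "continuous_map (top_of_set ({0..1} \<times> geom_simplex (\<sigma> i))) (geom_realization K) (g i)"
proof -
  let ?D = "{0..1::real} \<times> geom_simplex (\<sigma> i)"
  have \<mu>: "continuous_on S (\<lambda>p :: real \<times> ('a \<Rightarrow> real). \<mu> i (snd p))" for S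
    by (rule continuous_on_compose2[OF continuous_on_\<mu>[of UNIV]]) (auto intro: continuous_on_snd continuous_on_id)
  have coord: "continuous_on S (\<lambda>p :: real \<times> ('a \<Rightarrow> real). snd p v)" for S v
    by (rule continuous_on_compose2[OF continuous_on_product_coordinates continuous_on_snd]) auto
  have fst: "continuous_on S (\<lambda>p :: real \<times> ('a \<Rightarrow> real). fst p)" for S
    by (intro continuous_on_fst continuous_on_id)
  show ?thesis
    unfolding g_def
  proof (rule continuous_map_cases_le)
    let ?A = "{p \<in> ?D. 8 * \<mu> i (snd p) \<le> fst p}"
    have A: "4 * \<mu> i (snd p) < 1" "snd p \<in> geom_simplex (\<sigma> i)" "fst p - 8 * \<mu> i (snd p) \<in> {0..1}" if "p \<in> ?A" for p
      using that \<mu>_nonneg[of "snd p" i] by auto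
    have "continuous_on ?A (\<lambda>p. push i (snd p))"
    proof (rule continuous_on_coordinatewise_then_product)
      fix v
      show "continuous_on ?A (\<lambda>p. push i (snd p) v)"
        unfolding push_def using A(1) by (cases "v \<in> \<sigma> i") (auto intro!: continuous_intros \<mu> coord)
    qed
    then have "continuous_map (top_of_set ?A) (top_of_set (realization_set (bd i))) (\<lambda>p. push i (snd p))"
      using push_in_bd A by (auto simp: continuous_map_subtopology_eu)
    then have "continuous_map (top_of_set ?A) (geom_realization T) (\<lambda>p. push i (snd p))"
      using continuous_map_compose[OF _ continuous_map_finite_into_realization[OF bd(1,2)]]
      unfolding o_def by blast
    moreover have "continuous_map (top_of_set ?A) unit_interval (\<lambda>p. fst p - 8 * \<mu> i (snd p))"
      using A(3) by (auto simp: continuous_map_subtopology_eu intro!: continuous_intros \<mu> fst)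
    ultimately have "continuous_map (top_of_set ?A) (prod_topology unit_interval (geom_realization T))
        (\<lambda>p. (fst p - 8 * \<mu> i (snd p), push i (snd p)))"
      by (rule continuous_map_pairedI[rotated])
    from continuous_map_compose[OF continuous_map_compose[OF this C] continuous_map_subcomplex[OF T(2)]]
    have "continuous_map (top_of_set ?A) (geom_realization K) (\<lambda>p. C (fst p - 8 * \<mu> i (snd p), push i (snd p)))"
      by (simp add: o_def)
    moreover have "subtopology (top_of_set ?D) {p \<in> topspace (top_of_set ?D). 8 * \<mu> i (snd p) \<le> fst p} = top_of_set ?A"
      by (simp add: subtopology_subtopology Int_def conj_commute)
    ultimately show "continuous_map (subtopology (top_of_set ?D) {p \<in> topspace (top_of_set ?D). 8 * \<mu> i (snd p) \<le> fst p})
        (geom_realization K) (\<lambda>p. C (fst p - 8 * \<mu> i (snd p), push i (snd p)))" by simp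
    let ?B = "{p \<in> ?D. fst p \<le> 8 * \<mu> i (snd p)}"
    have "continuous_on ?B (stretch i)"
    proof (rule continuous_on_coordinatewise_then_product)
      fix v
      show "continuous_on ?B (\<lambda>p. stretch i p v)"
        unfolding stretch_def by (cases "v \<in> \<sigma> i") (auto intro!: continuous_intros \<mu> coord fst)
    qed
    then have "continuous_map (top_of_set ?B) (top_of_set (geom_simplex (\<sigma> i))) (stretch i)"
      using stretch_in by (auto simp: continuous_map_subtopology_eu)
    then have "continuous_map (top_of_set ?B) (geom_realization K) (stretch i)"
      using continuous_map_compose[OF _ final_topology_continuous_map_component[OF final_topology_geom_realization \<sigma>_props(1)]]
      unfolding o_def by blast
    moreover have "subtopology (top_of_set ?D) {p \<in> topspace (top_of_set ?D). fst p \<le> 8 * \<mu> i (snd p)} = top_of_set ?B"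
      by (simp add: subtopology_subtopology Int_def conj_commute)
    ultimately show "continuous_map (subtopology (top_of_set ?D) {p \<in> topspace (top_of_set ?D). fst p \<le> 8 * \<mu> i (snd p)})
        (geom_realization K) (stretch i)" by simp
    fix p assume p: "p \<in> topspace (top_of_set ?D)" "8 * \<mu> i (snd p) = fst p"
    then have "push i (snd p) = stretch i p" using push_eq_stretch[of "fst p" i "snd p"] by auto
    moreover have "push i (snd p) \<in> realization_set (bd i)"
      using push_in_bd[of "snd p" i] p by auto
    then have "push i (snd p) \<in> realization_set T" using bd(3) by blast
    ultimately show "C (fst p - 8 * \<mu> i (snd p), push i (snd p)) = stretch i p" using p(2) C0 by simp
  qed (auto simp: continuous_map_subtopology_eu intro!: continuous_intros \<mu> fst)
qed

text \<open>On the boundary the arrival time is 0 and \<open>push\<close> is the identity, so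
  \<open>g\<close> runs \<open>C\<close> from the start and agrees with the definition on
  \<open>T\<close>.\<close>

lemma h_cell:
  assumes "x \<in> geom_simplex (\<sigma> i)" "t \<in> {0..1}" shows "h (t, x) = g i (t, x)"
proof (cases "\<mu> i x = 0")
  case True
  then show ?thesis using in_T_iff[OF assms(1)] push_id[OF assms(1)] assms(2) by (simp add: h_def g_def)
next
  case False
  then show ?thesis using in_T_iff[OF assms(1)] cell[OF assms(1)] \<mu>_nonneg[OF assms(1)] by (simp add: h_def)
qed

lemma continuous_map_h: "continuous_map (prod_topology unit_interval (geom_realization K)) (geom_realization K) h"
proof (rule continuous_map_prod_geom_realization)
  fix \<rho> assume \<rho>: "\<rho> \<in> K"
  show "continuous_map (prod_topology unit_interval (top_of_set (geom_simplex \<rho>))) (geom_realization K) h"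
  proof (cases "\<rho> \<in> T")
    case True
    have "continuous_map (top_of_set (geom_simplex \<rho>)) (geom_realization T) (\<lambda>x. x)"
      by (rule final_topology_continuous_map_component[OF final_topology_geom_realization True])
    then have "continuous_map (prod_topology unit_interval (top_of_set (geom_simplex \<rho>)))
        (prod_topology unit_interval (geom_realization T)) (\<lambda>p. (fst p, snd p))"
      by (intro continuous_map_pairedI continuous_map_fst continuous_map_compose[OF continuous_map_snd, unfolded o_def])
    from continuous_map_compose[OF continuous_map_compose[OF this C] continuous_map_subcomplex[OF T(2)]]
    have "continuous_map (prod_topology unit_interval (top_of_set (geom_simplex \<rho>))) (geom_realization K) C"
      by (simp add: o_def)
    then show ?thesis
    proof (rule continuous_map_eq)
      show "C p = h p" if "p \<in> topspace (prod_topology unit_interval (top_of_set (geom_simplex \<rho>)))" for p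
      proof -
        have "snd p \<in> realization_set T" using that True by (auto simp: realization_set_def)
        then show ?thesis by (simp add: h_def)
      qed
    qed
  next
    case False
    then obtain i where i: "\<rho> = \<sigma> i" using \<rho> \<sigma> by (auto simp: bij_betw_def)
    show ?thesis
      unfolding prod_topology_unit_interval i
      by (rule continuous_map_eq[OF continuous_map_g]) (use h_cell in auto)
  qed
qed

theorem homotopy_equivalent_wedge: "geom_realization K homotopy_equivalent_space wedge_S3_nat"
proof (rule homotopy_equivalent_space_collapse[OF quotient_map_f _ _ continuous_map_h, where A = "realization_set T"])
  fix x y assume xy: "x \<in> topspace (geom_realization K)" "y \<in> topspace (geom_realization K)" "f x = f y"
  have inj: "x = y" if x: "x \<in> geom_simplex (\<sigma> i)" "0 < \<mu> i x" and y: "y \<in> geom_simplex (\<sigma> i)" "0 < \<mu> i y"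
    and eq: "q i x = q i y" for x y i
  proof
    fix v
    have "x (vx i j) = y (vx i j)" if "j < 4" for j
      using simplex_to_sphere_inj[OF std3[OF x(1)] _ std3[OF y(1)] _ _ that] x(2) y(2) eq
      by (simp add: \<mu>_min4 q_def)
    then have "v \<in> \<sigma> i \<Longrightarrow> x v = y v" using vx_image[of i] by auto
    moreover have "v \<notin> \<sigma> i \<Longrightarrow> x v = y v" using geom_simplex_outside[OF x(1)] geom_simplex_outside[OF y(1)] by simp
    ultimately show "x v = y v" by blast
  qed
  have fi: "f x = (i, q i x)" "q i x \<noteq> sphere_base" if "x \<in> geom_simplex (\<sigma> i)" "0 < \<mu> i x" for x i
    using f_cell[OF that(1)] q_base_iff[OF that(1)] that(2) by (auto simp: wedge_incl_def)
  have "x \<in> realization_set K" "y \<in> realization_set K" using xy by auto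
  then show "x = y \<or> x \<in> realization_set T \<and> y \<in> realization_set T"
    using xy(3) fi f_T inj by (elim K_cases) (metis prod.inject)+
next
  show "h (0, x) = x" if "x \<in> topspace (geom_realization K)" for x
  proof -
    have "x \<in> realization_set K" using that by simp
    then show ?thesis
    proof (cases rule: K_cases)
      case 1 then show ?thesis using C0 by (simp add: h_def)
    next
      case (2 i)
      then have "h (0, x) = stretch i (0, x)" using h_cell[of x i 0] by (simp add: g_def)
      also have "\<dots> = x"
        using geom_simplex_outside[OF 2(1)] by (auto simp: stretch_def fun_eq_iff)
      finally show ?thesis .
    qed
  qed
  show "h (t, x) \<in> realization_set T" if "t \<in> {0..1}" "x \<in> realization_set T" for t x
    using continuous_map_image_subset_topspace[OF C] that by (auto simp: h_def)
qed (use f_T C1 in \<open>auto simp: h_def\<close>)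

end

text \<open>At a point with all coordinates positive every negative axis direction descends. Moving
  this point along the diagonal gives one corner tetrahedron for each natural number, told apart by
  their highest vertices.\<close>

lemma infinite_noncore:
  assumes "3 \<le> CARD('n::finite)"
  shows "infinite ((lattice_VR :: (int ^ 'n) set set) - core)"
proof -
  obtain i j k :: 'n where ijk: "i \<noteq> j" "i \<noteq> k" "j \<noteq> k"
  proof -
    obtain S :: "'n set" where "card S = 3" using obtain_subset_with_card_n[OF assms] by metis
    then show ?thesis using that by (auto simp: card_3_iff)
  qed
  define v :: "nat \<Rightarrow> int ^ 'n" where "v = (\<lambda>N. \<chi> l. int (Suc N))"
  define a :: "'n \<Rightarrow> int ^ 'n" where "a = (\<lambda>l. axis l (- 1))"
  have a_down: "a l \<in> down (v N)" for l N
  proof -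
    have "a l \<in> units" by (auto simp: units_def a_def)
    moreover have "stp (v N) (a l) < 0" by (simp add: stp_def a_def crd_axis axis_nth' v_def zeta_def)
    ultimately show ?thesis by (simp add: down_iff)
  qed
  have a_inj: "a l \<noteq> a m" if "l \<noteq> m" for l m
    using that by (simp add: a_def axis_eq_axis_int)
  define E where "E = (\<lambda>N. {v N, v N + (a i + a j), v N + (a i + a k), v N + (a j + a k)})"
  have E: "E N \<in> lattice_VR - core" "\<And>x. x \<in> E N \<Longrightarrow> x \<noteq> v N \<Longrightarrow> height x < height (v N)" for N
    using corner_tetrahedron[OF a_down[of i N] a_down[of j N] a_down[of k N]] a_inj ijk unfolding E_def by blast+
  have "inj E"
  proof (rule injI)
    fix M N assume "E M = E N"
    moreover have "v M \<in> E M" "v N \<in> E N" by (auto simp: E_def)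
    ultimately have "v M = v N" using E(2)[of "v M" N] E(2)[of "v N" M] by fastforce
    then have "v M $ i = v N $ i" by simp
    then show "M = N" by (simp add: v_def)
  qed
  then show ?thesis
    using E(1) infinite_iff_countable_subset by (metis image_subsetI)
qed

theorem theorem4p15:
  assumes "CARD('n::finite) \<ge> 3"
  shows "geom_realization (VR_complex (manhattan :: int ^ 'n \<Rightarrow> int ^ 'n \<Rightarrow> real) UNIV 2)
           homotopy_equivalent_space wedge_S3_nat"
proof -
  let ?K = "lattice_VR :: (int ^ 'n) set set"
  have "countable {A :: (int ^ 'n) set. finite A \<and> A \<subseteq> UNIV}"
    by (rule countable_Collect_finite_subset) simp
  then have "countable (?K - core)"
    by (rule countable_subset[rotated]) (auto simp: lattice_VR_iff)
  then have bij: "bij_betw (from_nat_into (?K - core)) UNIV (?K - core)"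
    using infinite_noncore[OF assms] by (rule bij_betw_from_nat_into)
  have in_diff: "from_nat_into (?K - core) i \<in> lattice_VR" "from_nat_into (?K - core) i \<notin> core" for i
    using bij by (auto simp: bij_betw_def)
  have "\<exists>C b. continuous_map (prod_topology unit_interval (geom_realization core)) (geom_realization core) C \<and>
      (\<forall>x \<in> realization_set (core :: (int ^ 'n) set set). C (0, x) = x \<and> C (1, x) = b)"
    unfolding core_def by (rule shelling_contraction[where G = stage and a = 0, OF stage_0 finite_stage])
      (fact stage_finite, fact stage_shelling)
  then obtain C b where C: "continuous_map (prod_topology unit_interval (geom_realization core)) (geom_realization core) C"
    "\<forall>x \<in> realization_set (core :: (int ^ 'n) set set). C (0, x) = x \<and> C (1, x) = b"
    by blast
  interpret tetrahedra_over_contractible ?K core "from_nat_into (?K - core)" C b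
    using simplicial_complex_lattice_VR simplicial_complex_core core_subset bij C not_core[OF in_diff]
    by unfold_locales auto
  show ?thesis by (rule homotopy_equivalent_wedge)
qed

end
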